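(* Let $\mu\in\mathbb{R}$ and let $f\in L^2(\mathbb{S}^2)$ with $f=\sum_{\ell=0}^{+\infty}\sum_{m=-\ell}^{\ell}f_{\ell,m}Y_{\ell,m}$. Then the time-nonlocal partial differential equation $$\frac{d^{\Phi}u}{dt^{\Phi}}(t)=\mathcal{G}_\mu u(t)\quad (t>0),\qquad u(0)=f,$$ admits a unique Laplace transformable very weak solution $u$, in the sense that: (i) $u\in C([0,\infty);L^2(\mathbb{S}^2))$; (ii) for almost all $x\in\mathbb{S}^2$ there exists $\lambda_0\ge0$ such that for all $\lambda>\lambda_0$ $$\int_0^\infty e^{-\lambda t}|u(t,x)|\,dt<\infty;$$ (iii) for all $h\in H^2(\mathbb{S}^2)$, $$\frac{d}{dt}\int_{\mathbb{S}^2}h(x)\,\bigl(\overline{\nu}_\Phi*(u(\cdot,x)-f(x))\bigr)(t)\,d\sigma(x)=\int_{\mathbb{S}^2}u(t,x)\,\mathcal{G}_{-\mu}h(x)\,d\sigma(x).$$ In particular, this solution belongs to $C((0,\infty);H^2(\mathbb{S}^2))$ and is given, for $t>0$, by $$u(t)=\sum_{\ell=0}^{+\infty}\sum_{m=-\ell}^{\ell}f_{\ell,m}\,\mathfrak{e}_\Phi(t;i\mu m-\ell(\ell+1))\,Y_{\ell,m},$$ where the equality holds in $H^2(\mathbb{S}^2)$.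
   Context: Sphere. $\mathbb{S}^2\subset\mathbb{R}^3$ is the unit sphere with the round metric $g$, surface measure $\sigma$ and spherical coordinates $(\sin\theta\cos\varphi,\sin\theta\sin\varphi,\cos\theta)$, $\theta\in[0,\pi]$, $\varphi\in[0,2\pi)$. Functions are complex-valued, $L^2(\mathbb{S}^2)=L^2(\mathbb{S}^2,\sigma)$. $\Delta_g$ is the Laplace–Beltrami operator, $X_\mu$ is the smooth vector field equal to $\mu\,\partial/\partial\varphi$ in spherical coordinates (and zero at the poles), and $\mathcal{G}_\mu=\Delta_g+X_\mu$. The spherical harmonics are $Y_{\ell,m}(\theta,\varphi)=\sqrt{\frac{(2\ell+1)(\ell-m)!}{4\pi(\ell+m)!}}P_\ell^m(\cos\theta)e^{im\varphi}$, $\ell=0,1,\dots$, $m=-\ell,\dots,\ell$, with $P_\ell^m(x)=\frac{(-1)^m}{2^\ell\ell!}(1-x^2)^{m/2}\frac{d^{\ell+m}}{dx^{\ell+m}}(x^2-1)^\ell$; they form an orthonormal basis of $L^2(\mathbb{S}^2)$ and $\mathcal{G}_\mu Y_{\ell,m}=(i\mu m-\ell(\ell+1))Y_{\ell,m}$. The coefficients are $f_{\ell,m}=\int_{\mathbb{S}^2}f\,\overline{Y}_{\ell,m}\,d\sigma$, and $A_\ell(f)=\sum_{m=-\ell}^{\ell}|f_{\ell,m}|^2$. $H^s(\mathbb{S}^2)$, $s\ge0$, is the set of $f\in L^2(\mathbb{S}^2)$ with $[f]_{H^s}^2:=\sum_{\ell\ge0}\ell^{2s}A_\ell(f)<\infty$,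 with norm $\|f\|_{L^2}+[f]_{H^s}$. For $h\in H^2(\mathbb{S}^2)$, $\mathcal{G}_{\mu}h$ is understood weakly, i.e. $\mathcal{G}_\mu h=\sum_{\ell,m}(i\mu m-\ell(\ell+1))h_{\ell,m}Y_{\ell,m}$. Subordinator. $\Phi(\lambda)=\int_0^{+\infty}(1-e^{-\lambda t})\nu_\Phi(dt)$, $\lambda\ge0$, where $\nu_\Phi$ is a measure on $(0,+\infty)$ with $\int_0^{+\infty}(1\wedge t)\nu_\Phi(dt)<\infty$ and $\nu_\Phi(0,+\infty)=+\infty$; $\overline{\nu}_\Phi(t)=\nu_\Phi(t,+\infty)$. $S_\Phi$ is a subordinator (increasing Lévy process with $S_\Phi(0)=0$) with $\mathbb{E}[e^{-\lambda S_\Phi(t)}]=e^{-t\Phi(\lambda)}$, $L_\Phi(t)=\inf\{s>0:S_\Phi(s)>t\}$, and $\mathfrak{e}_\Phi(t;\lambda)=\mathbb{E}[e^{\lambda L_\Phi(t)}]$ for $\lambda\in\mathbb{C}$. $\frac{d^{\Phi}u}{dt^{\Phi}}(t)=\frac{d}{dt}\int_0^t\overline{\nu}_\Phi(t-\tau)(u(\tau)-u(0^+))\,d\tau$ is the formal nonlocal time derivative; the notion of solution used is the one spelled out in (i)–(iii). The convolution is $(\overline{\nu}_\Phi*v)(t)=\int_0^t\overline{\nu}_\Phi(t-\tau)v(\tau)\,d\tau$, and in (iii) $t>0$. *)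

theory Defs
  imports "HOL-Probability.Probability"
begin

section \<open>The unit sphere and spherical harmonics\<close>

definition sph_coords :: "real \<Rightarrow> real \<Rightarrow> real^3" where
  "sph_coords \<theta> \<phi> = vector [sin \<theta> * cos \<phi>, sin \<theta> * sin \<phi>, cos \<theta>]"

text \<open>Surface measure: the image of \<open>sin \<theta> d\<theta> d\<phi>\<close> under spherical coordinates.\<close>

definition sphere_measure :: "(real^3) measure" where
  "sphere_measure =
     distr (density (restrict_space lborel ({0..pi} \<times> {0..<2 * pi})) (\<lambda>(\<theta>, \<phi>). ennreal (sin \<theta>)))
       (restrict_space borel (sphere 0 1)) (\<lambda>(\<theta>, \<phi>). sph_coords \<theta> \<phi>)"

text \<open>
  We write \<open>(1 - x\<^sup>2)\<^bsup>m/2\<^esup>\<close> as an integer power of \<open>sqrt (1 - x\<^sup>2)\<close>, since \<open>0 powr 0 = 0\<close> but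
  \<open>0 powi 0 = 1\<close>. For \<open>m < 0\<close> and \<open>x = \<plusminus>1\<close> the value is \<open>0\<close>, which is also the limit.
\<close>

definition assoc_legendre :: "nat \<Rightarrow> int \<Rightarrow> real \<Rightarrow> real" where
  "assoc_legendre l m x =
     (-1) powi m / (2 ^ l * fact l) * sqrt (1 - x\<^sup>2) powi m *
     (deriv ^^ nat (int l + m)) (\<lambda>y. (y\<^sup>2 - 1) ^ l) x"

definition sph_harm_coord :: "nat \<Rightarrow> int \<Rightarrow> real \<Rightarrow> real \<Rightarrow> complex" where
  "sph_harm_coord l m \<theta> \<phi> =
     complex_of_real
       (sqrt ((2 * real l + 1) * fact (nat (int l - m)) / (4 * pi * fact (nat (int l + m))))
        * assoc_legendre l m (cos \<theta>))
     * exp (\<i> * of_int m * of_real \<phi>)"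

text \<open>
  The same function on the sphere. The azimuth is taken in \<open>[0, 2\<pi>)\<close>; at the poles, where it is
  \<open>0\<close> by convention, the harmonics with \<open>m \<noteq> 0\<close> vanish.
\<close>

definition sph_harm :: "nat \<Rightarrow> int \<Rightarrow> real^3 \<Rightarrow> complex" where
  "sph_harm l m x = sph_harm_coord l m (arccos (x $ 3)) (Arg2pi (Complex (x $ 1) (x $ 2)))"


section \<open>Function spaces on the sphere\<close>

text \<open>
  Elements of \<open>L\<^sup>2\<close> are represented by functions, to be identified when they agree almost everywhere
  on the sphere; values off the sphere are irrelevant.
\<close>

definition L2_sphere :: "(real^3 \<Rightarrow> complex) set" where
  "L2_sphere = {f \<in> borel_measurable sphere_measure. integrable sphere_measure (\<lambda>x. (cmod (f x))\<^sup>2)}"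

definition L2_norm :: "(real^3 \<Rightarrow> complex) \<Rightarrow> real" where
  "L2_norm f = sqrt (\<integral>x. (cmod (f x))\<^sup>2 \<partial>sphere_measure)"

definition sph_coeff :: "(real^3 \<Rightarrow> complex) \<Rightarrow> nat \<Rightarrow> int \<Rightarrow> complex" where
  "sph_coeff f l m = (\<integral>x. f x * cnj (sph_harm l m x) \<partial>sphere_measure)"

definition sph_power :: "(real^3 \<Rightarrow> complex) \<Rightarrow> nat \<Rightarrow> real" where
  "sph_power f l = (\<Sum>m = - int l..int l. (cmod (sph_coeff f l m))\<^sup>2)"

text \<open>
  For \<open>s = 0\<close> the term \<open>l = 0\<close> is \<open>0\<close> in Isabelle; this affects neither the space nor, up to
  equivalence, its norm.
\<close>

definition sobolev :: "real \<Rightarrow> (real^3 \<Rightarrow> complex) set" where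
  "sobolev s = {f \<in> L2_sphere. summable (\<lambda>l. real l powr (2 * s) * sph_power f l)}"

definition sobolev_norm :: "real \<Rightarrow> (real^3 \<Rightarrow> complex) \<Rightarrow> real" where
  "sobolev_norm s f = L2_norm f + sqrt (\<Sum>l. real l powr (2 * s) * sph_power f l)"

text \<open>Continuity on \<open>T\<close> of a curve of functions with respect to a (semi)norm \<open>N\<close>.\<close>

definition continuous_curve ::
    "((real^3 \<Rightarrow> complex) \<Rightarrow> real) \<Rightarrow> real set \<Rightarrow> (real \<Rightarrow> real^3 \<Rightarrow> complex) \<Rightarrow> bool" where
  "continuous_curve N T u \<longleftrightarrow>
     (\<forall>t\<in>T. ((\<lambda>s. N (\<lambda>x. u s x - u t x)) \<longlongrightarrow> 0) (at t within T))"

definition sph_partial_sum :: "(nat \<Rightarrow> int \<Rightarrow> complex) \<Rightarrow> nat \<Rightarrow> real^3 \<Rightarrow> complex" where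
  "sph_partial_sum c n x = (\<Sum>l\<le>n. \<Sum>m = - int l..int l. c l m * sph_harm l m x)"

definition sph_sums :: "(nat \<Rightarrow> int \<Rightarrow> complex) \<Rightarrow> (real^3 \<Rightarrow> complex) \<Rightarrow> bool" where
  "sph_sums c g \<longleftrightarrow>
     g \<in> L2_sphere \<and> (\<lambda>n. L2_norm (\<lambda>x. g x - sph_partial_sum c n x)) \<longlonglongrightarrow> 0"

text \<open>
  A representative of the sum of an \<open>L\<^sup>2\<close>-convergent series of harmonics, unique up to null sets.
\<close>

definition sph_suminf :: "(nat \<Rightarrow> int \<Rightarrow> complex) \<Rightarrow> real^3 \<Rightarrow> complex" where
  "sph_suminf c = (SOME g. sph_sums c g)"

definition gen_eigenvalue :: "real \<Rightarrow> nat \<Rightarrow> int \<Rightarrow> complex" where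
  "gen_eigenvalue \<mu> l m = \<i> * of_real \<mu> * of_int m - of_nat l * (of_nat l + 1)"

text \<open>The operator \<open>\<Delta>\<^sub>g + \<mu> \<partial>/\<partial>\<phi>\<close> on \<open>H\<^sup>2\<close>, in the weak (spectral) sense.\<close>

definition gen_op :: "real \<Rightarrow> (real^3 \<Rightarrow> complex) \<Rightarrow> real^3 \<Rightarrow> complex" where
  "gen_op \<mu> h = sph_suminf (\<lambda>l m. gen_eigenvalue \<mu> l m * sph_coeff h l m)"


section \<open>Subordinators\<close>

text \<open>A measure on \<open>(0, \<infinity>)\<close> is a Borel measure on the line that does not charge \<open>(-\<infinity>, 0]\<close>.\<close>

definition subordinator_levy_measure :: "real measure \<Rightarrow> bool" where
  "subordinator_levy_measure \<nu> \<longleftrightarrow>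
     sets \<nu> = sets borel \<and> emeasure \<nu> {..0} = 0 \<and>
     (\<integral>\<^sup>+t. ennreal (min 1 t) \<partial>\<nu>) < \<infinity> \<and> emeasure \<nu> {0<..} = \<infinity>"

definition laplace_exponent :: "real measure \<Rightarrow> real \<Rightarrow> real" where
  "laplace_exponent \<nu> q = (\<integral>t. 1 - exp (- q * t) \<partial>\<nu>)"

text \<open>Used for \<open>t > 0\<close> only, up to null sets; there the tail is finite.\<close>

definition levy_tail :: "real measure \<Rightarrow> real \<Rightarrow> real" where
  "levy_tail \<nu> t = measure \<nu> {t<..}"

text \<open>
  Only the restriction of a process to times in \<open>[0, \<infinity>)\<close> matters. Stochastic continuity
  follows from right-continuity and stationarity of the increments.
\<close>

definition levy_process :: "'w measure \<Rightarrow> (real \<Rightarrow> 'w \<Rightarrow> real) \<Rightarrow> bool" where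
  "levy_process M X \<longleftrightarrow>
     prob_space M \<and>
     (\<forall>t\<ge>0. X t \<in> borel_measurable M) \<and>
     (\<forall>\<omega>\<in>space M. X 0 \<omega> = 0) \<and>
     (\<forall>(n::nat) \<tau>. 0 \<le> \<tau> 0 \<and> mono \<tau> \<longrightarrow>
        prob_space.indep_vars M (\<lambda>_. borel) (\<lambda>i \<omega>. X (\<tau> (Suc i)) \<omega> - X (\<tau> i) \<omega>) {..<n}) \<and>
     (\<forall>s\<ge>0. \<forall>t\<ge>0. distr M borel (\<lambda>\<omega>. X (s + t) \<omega> - X s \<omega>) = distr M borel (X t)) \<and>
     (\<forall>\<omega>\<in>space M.
        (\<forall>t\<ge>0. ((\<lambda>s. X s \<omega>) \<longlongrightarrow> X t \<omega>) (at_right t)) \<and>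
        (\<forall>t>0. \<exists>y. ((\<lambda>s. X s \<omega>) \<longlongrightarrow> y) (at_left t)))"

definition subordinator :: "'w measure \<Rightarrow> (real \<Rightarrow> 'w \<Rightarrow> real) \<Rightarrow> bool" where
  "subordinator M S \<longleftrightarrow> levy_process M S \<and> (\<forall>\<omega>\<in>space M. mono_on {0..} (\<lambda>t. S t \<omega>))"

definition inverse_process :: "(real \<Rightarrow> 'w \<Rightarrow> real) \<Rightarrow> real \<Rightarrow> 'w \<Rightarrow> real" where
  "inverse_process S t \<omega> = Inf {s. 0 < s \<and> t < S s \<omega>}"

definition relaxation :: "'w measure \<Rightarrow> (real \<Rightarrow> 'w \<Rightarrow> real) \<Rightarrow> real \<Rightarrow> complex \<Rightarrow> complex" where
  "relaxation M S t z = (\<integral>\<omega>. exp (z * of_real (inverse_process S t \<omega>)) \<partial>M)"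


section \<open>The nonlocal equation\<close>

definition conv :: "(real \<Rightarrow> real) \<Rightarrow> (real \<Rightarrow> complex) \<Rightarrow> real \<Rightarrow> complex" where
  "conv k v t = (LINT \<tau>:{0..t}|lborel. of_real (k (t - \<tau>)) * v \<tau>)"

definition laplace_transformable :: "(real \<Rightarrow> real^3 \<Rightarrow> complex) \<Rightarrow> bool" where
  "laplace_transformable u \<longleftrightarrow>
     (AE x in sphere_measure. \<exists>q0\<ge>0. \<forall>q>q0.
        (\<integral>\<^sup>+t\<in>{0..}. ennreal (exp (- q * t) * cmod (u t x)) \<partial>lborel) < \<infinity>)"

text \<open>
  Conditions that evaluate \<open>u(\<cdot>, x)\<close> for fixed \<open>x\<close> presuppose a jointly measurable representative;
  given one, they do not depend on its choice.
\<close>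

definition very_weak_solution ::
    "real measure \<Rightarrow> real \<Rightarrow> (real^3 \<Rightarrow> complex) \<Rightarrow> (real \<Rightarrow> real^3 \<Rightarrow> complex) \<Rightarrow> bool" where
  "very_weak_solution \<nu> \<mu> f u \<longleftrightarrow>
     (\<lambda>(t, x). u t x) \<in> borel_measurable (restrict_space borel {0..} \<Otimes>\<^sub>M sphere_measure) \<and>
     (\<forall>t\<ge>0. u t \<in> L2_sphere) \<and> continuous_curve L2_norm {0..} u \<and>
     (\<forall>h \<in> sobolev 2. \<forall>t>0.
        ((\<lambda>s. \<integral>x. h x * conv (levy_tail \<nu>) (\<lambda>\<tau>. u \<tau> x - f x) s \<partial>sphere_measure)
           has_vector_derivative (\<integral>x. u t x * gen_op (- \<mu>) h x \<partial>sphere_measure)) (at t))"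

end

theory Submission
  imports Defs
begin

text \<open>
  The spherical harmonics form an orthonormal basis of \<open>L\<^sup>2\<close> of the sphere
  (sph_harm_orthonormal, sph_harm_complete) which diagonalises the generator, so the equation separates into one
  scalar Volterra equation per harmonic. With \<open>z = i\<mu>m - l(l+1)\<close>, with
  \<open>N(t) = \<nu>(t,\<infinity>)\<close> and with \<open>*\<close> for convolution on the half line, the
  coefficient of a solution must be \<open>f\<^sub>l\<^sub>m w(t)\<close>, where
  \<open>N * (w - 1) = z (1 * w)\<close>. Note that \<open>Re z \<le> 0\<close>.

  The scalar equation is solved by \<open>w(t) = E exp (z L(t))\<close>. Because \<open>S(s) \<le> t\<close> for
  \<open>s < L(t)\<close> and \<open>S(s) > t\<close> for \<open>s > L(t)\<close>, this is
  \<open>w = 1 + z (1 * U)\<close>, where \<open>U\<close> is the complex measure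
  \<open>E \<integral> e\<^bsup>zs\<^esup> \<delta>\<^bsub>S(s)\<^esub> ds\<close> (relaxation_eq). The Laplace
  transform of \<open>U\<close> at \<open>q\<close> is \<open>1 / (\<Phi>(q) - z)\<close>, and that of
  \<open>N\<close> is \<open>\<Phi>(q) / q\<close>; hence \<open>N * U\<close> and \<open>w\<close> have the
  same transform and \<open>N * U = w\<close> almost everywhere (wconv_tail_kernel). This one identity gives
  both halves of the scalar theory. Convolving it with \<open>1\<close> yields the equation for \<open>w\<close>
  (relax_equation). Conversely, it says that \<open>1 = N * U - z (1 * U)\<close>, so if
  \<open>N * d = z (1 * d)\<close>, then \<open>1 * d = U * (N * d - z (1 * d)) = 0\<close> and
  \<open>d = 0\<close> (homogeneous_Volterra).

  Uniqueness follows by testing with a single harmonic: each coefficient of the difference of two solutions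
  satisfies the homogeneous scalar equation after integration in time, the constant of integration being
  \<open>0\<close> because a locally integrable kernel makes both sides vanish at \<open>0+\<close>
  (weak_solution_unique).

  For existence, \<open>|w| \<le> 1\<close> makes the series converge in \<open>L\<^sup>2\<close> uniformly in
  \<open>t\<close>, and along a single subsequence almost everywhere for each \<open>t\<close>, which produces a
  representative that is jointly measurable in time and space (solution_exists). Since \<open>\<nu>\<close> has
  infinite mass, \<open>S\<close> is almost surely strictly increasing, so \<open>U\<close> has no atoms and
  \<open>w\<close> is continuous; dominated convergence for series turns this into continuity of the solution.
  The weak equation holds for test functions that are finite sums of harmonics by the scalar equation and
  Fubini, and for \<open>h\<close> in \<open>H\<^sup>2\<close> by approximation (solution_weak_equation).
  Finally, comparing the indicator of \<open>S(s) \<le> t\<close> with exponentials shows that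
  \<open>|w(t)| \<le> \<Phi>(1) / ((1 - e\<^bsup>-t\<^esup>) l(l+1))\<close> for \<open>l > 0\<close>
  (relaxation_decay), which is exactly the decay in \<open>l\<close> that puts the solution into
  \<open>H\<^sup>2\<close>, locally uniformly in \<open>t > 0\<close>.
\<close>

section \<open>Functions determined by their moments\<close>

text \<open>
  Closed sets are stable under intersection and generate the Borel sets, so the vanishing of the integral
  spreads to all Borel sets by Dynkin's lemma.
\<close>

lemma AE_eq_0_if_integrals_over_closed_sets_vanish:
  fixes f :: "'a::metric_space \<Rightarrow> real"
  assumes M: "sets M = sets borel" and f: "integrable M f"
    and closed: "\<And>C. closed C \<Longrightarrow> (LINT x:C|M. f x) = 0"
  shows "AE x in M. f x = 0"
proof -
  have space: "space M = UNIV" using sets_eq_imp_space_eq[OF M] by simp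
  have si: "set_integrable M A f" if "A \<in> sets M" for A
    using integrable_mult_indicator[OF that f] by (simp add: set_integrable_def)
  have all: "(LINT x:A|M. f x) = 0" if "A \<in> sets M" for A
  proof -
    have A: "A \<in> sigma_sets UNIV (Collect closed)"
      using that unfolding M by (simp add: borel_eq_closed)
    have "Int_stable (Collect (closed :: 'a set \<Rightarrow> bool))" by (auto simp: Int_stable_def closed_Int)
    moreover have "Collect (closed :: 'a set \<Rightarrow> bool) \<subseteq> Pow UNIV" by simp
    ultimately show ?thesis using A
    proof (induction rule: sigma_sets_induct_disjoint)
      case (basic A) then show ?case using closed by simp
    next
      case empty then show ?case by (simp add: set_lebesgue_integral_def)
    next
      case (compl A)
      have A: "A \<in> sets M" unfolding M borel_eq_closed using compl(1) by simp
      have "(LINT x:UNIV|M. f x) = (LINT x:A|M. f x) + (LINT x:UNIV - A|M. f x)"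
        using set_integral_Un[OF _ si[OF A] si[of "UNIV - A"]] A sets.compl_sets[OF A] space
        by (simp add: Un_commute)
      then show ?case using closed[of UNIV] compl by simp
    next
      case (union A)
      have A: "A i \<in> sets M" for i unfolding M borel_eq_closed using union(2) by auto
      have "(LINT x:(\<Union>i. A i)|M. f x) = (\<Sum>i. (LINT x:A i|M. f x))"
        by (rule lebesgue_integral_countable_add)
           (use A union(1) si[of "\<Union>i. A i"] in \<open>auto simp: disjoint_family_on_def\<close>)
      then show ?case using union by simp
    qed
  qed
  have "AE x in M. f x = (\<lambda>_. 0) x"
    by (rule density_unique_real) (use f all in auto)
  then show ?thesis by simp
qed

text \<open>
  By the Stone--Weierstrass theorem on \<open>K\<close>, orthogonality extends to continuous functions;
  indicators of closed sets are bounded limits of these.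
\<close>

lemma AE_eq_0_if_orthogonal_to_polynomials_real:
  fixes f :: "'a::euclidean_space \<Rightarrow> real"
  assumes M: "sets M = sets borel" and K: "compact K" "AE x in M. x \<in> K"
    and f: "integrable M f"
    and orth: "\<And>p. real_polynomial_function p \<Longrightarrow> (\<integral>x. f x * p x \<partial>M) = 0"
  shows "AE x in M. f x = 0"
proof (rule AE_eq_0_if_integrals_over_closed_sets_vanish[OF M f])
  have cm: "g \<in> borel_measurable M" if "continuous_on UNIV g" for g :: "'a \<Rightarrow> real"
    using borel_measurable_continuous_onI[OF that] M measurable_cong_sets by blast
  have fm [measurable]: "f \<in> borel_measurable M" using f by auto
  have int: "integrable M (\<lambda>x. f x * g x)" if g: "continuous_on UNIV g" for g :: "'a \<Rightarrow> real"
  proof -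
    have "bounded (g ` K)"
      by (meson K(1) g compact_imp_bounded compact_continuous_image continuous_on_subset top_greatest)
    then obtain B where B: "\<And>x. x \<in> K \<Longrightarrow> \<bar>g x\<bar> \<le> B" unfolding bounded_iff by auto
    show ?thesis
    proof (rule Bochner_Integration.integrable_bound[of M "\<lambda>x. B * \<bar>f x\<bar>"])
      show "AE x in M. norm (f x * g x) \<le> norm (B * \<bar>f x\<bar>)"
        using K(2)
      proof eventually_elim
        case (elim x)
        have "\<bar>f x\<bar> * \<bar>g x\<bar> \<le> \<bar>f x\<bar> * \<bar>B\<bar>" using B[OF elim] by (intro mult_left_mono) auto
        then show ?case by (simp add: abs_mult mult.commute)
      qed
    qed (use f cm[OF g] in auto)
  qed
  have cont: "(\<integral>x. f x * g x \<partial>M) = 0" if g: "continuous_on UNIV g" for g :: "'a \<Rightarrow> real"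
  proof -
    have "\<bar>\<integral>x. f x * g x \<partial>M\<bar> \<le> e * (\<integral>x. \<bar>f x\<bar> \<partial>M)" if e: "e > 0" for e
    proof -
      obtain p where p: "real_polynomial_function p" "\<And>x. x \<in> K \<Longrightarrow> \<bar>g x - p x\<bar> < e"
        using Stone_Weierstrass_real_polynomial_function[OF K(1) continuous_on_subset[OF g] e] by auto
      have cp: "continuous_on UNIV p"
        using p(1) continuous_on_polymonial_function real_polynomial_function_eq by blast
      have "(\<integral>x. f x * g x \<partial>M) = (\<integral>x. f x * g x - f x * p x \<partial>M)"
        using orth[OF p(1)] Bochner_Integration.integral_diff[OF int[OF g] int[OF cp]] by simp
      also have "\<bar>\<dots>\<bar> \<le> (\<integral>x. \<bar>f x * g x - f x * p x\<bar> \<partial>M)"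
        by (rule integral_abs_bound)
      also have "\<dots> \<le> (\<integral>x. e * \<bar>f x\<bar> \<partial>M)"
      proof (rule integral_mono_AE)
        show "AE x in M. \<bar>f x * g x - f x * p x\<bar> \<le> e * \<bar>f x\<bar>"
          using K(2)
        proof eventually_elim
          case (elim x)
          have "\<bar>f x * g x - f x * p x\<bar> = \<bar>f x\<bar> * \<bar>g x - p x\<bar>"
            by (simp add: abs_mult flip: right_diff_distrib)
          also have "\<dots> \<le> \<bar>f x\<bar> * e" using p(2)[OF elim] by (intro mult_left_mono) auto
          finally show ?case by (simp add: mult.commute)
        qed
      qed (use f int[OF g] int[OF cp] in auto)
      finally show ?thesis by simp
    qed
    note b = this
    show ?thesis
    proof (rule ccontr)
      assume n: "(\<integral>x. f x * g x \<partial>M) \<noteq> 0"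
      let ?I = "\<bar>\<integral>x. f x * g x \<partial>M\<bar>" and ?J = "\<integral>x. \<bar>f x\<bar> \<partial>M"
      have J: "?J \<ge> 0" by simp
      \<comment> \<open>The accuracy \<open>I / (2 (J + 1))\<close> makes the bound smaller than \<open>I\<close>; adding \<open>1\<close> covers \<open>J = 0\<close>.\<close>
      have "?I \<le> ?I / (2 * (?J + 1)) * ?J" by (rule b) (use n J in \<open>auto intro!: divide_pos_pos add_nonneg_pos\<close>)
      also have "\<dots> = ?I * (?J / (2 * (?J + 1)))" by simp
      also have "\<dots> \<le> ?I * (1/2)"
      proof (rule mult_left_mono)
        have "a / (2 * (a + 1)) \<le> 1 / 2" if "a \<ge> 0" for a :: real
          using that by (simp add: divide_simps)
        then show "?J / (2 * (?J + 1)) \<le> 1 / 2" using J .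
      qed simp
      finally show False using n by simp
    qed
  qed
  fix C :: "'a set" assume C: "closed C"
  show "(LINT x:C|M. f x) = 0"
  proof (cases "C = {}")
    case False
    \<comment> \<open>Continuous functions decreasing to the indicator of \<open>C\<close>.\<close>
    define g where "g n x = max 0 (1 - real n * infdist x C)" for n x
    have gc: "continuous_on UNIV (g n)" for n unfolding g_def by (intro continuous_intros)
    have gm [measurable]: "g n \<in> borel_measurable M" for n using cm[OF gc] .
    have Cm [measurable]: "C \<in> sets M" using C M by auto
    have lim: "(\<lambda>n. g n x) \<longlonglongrightarrow> indicator C x" for x
    proof (cases "x \<in> C")
      case True then show ?thesis by (simp add: g_def)
    next
      case outside: False
      have d: "infdist x C > 0"
        using infdist_pos_not_in_closed[OF C False outside] .
      obtain N :: nat where N: "real N * infdist x C > 1" using d reals_Archimedean3 by blast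
      have "g n x = 0" if "n \<ge> N" for n
      proof -
        have "real N * infdist x C \<le> real n * infdist x C"
          using that d by (intro mult_right_mono) auto
        then show ?thesis using N by (simp add: g_def)
      qed
      then show ?thesis using outside by (intro tendsto_eventually) (auto simp: eventually_sequentially)
    qed
    have "(\<lambda>n. \<integral>x. f x * g n x \<partial>M) \<longlonglongrightarrow> (\<integral>x. f x * indicator C x \<partial>M)"
    proof (rule integral_dominated_convergence[where w="\<lambda>x. \<bar>f x\<bar>"])
      show "AE x in M. (\<lambda>n. f x * g n x) \<longlonglongrightarrow> f x * indicator C x"
        by (intro AE_I2 tendsto_intros lim)
      show "AE x in M. norm (f x * g n x) \<le> \<bar>f x\<bar>" for n
      proof (rule AE_I2)
        fix x
        have "\<bar>g n x\<bar> \<le> 1" unfolding g_def by (auto simp: infdist_nonneg)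
        then show "norm (f x * g n x) \<le> \<bar>f x\<bar>"
          by (simp add: abs_mult mult_left_le)
      qed
    qed (use f in auto)
    then have "(\<integral>x. f x * indicator C x \<partial>M) = 0"
      using cont[OF gc] by (simp add: LIMSEQ_const_iff)
    then show ?thesis by (simp add: set_lebesgue_integral_def mult.commute)
  qed (simp add: set_lebesgue_integral_def)
qed

lemma AE_eq_0_if_orthogonal_to_polynomials:
  fixes f :: "'a::euclidean_space \<Rightarrow> complex"
  assumes M: "sets M = sets borel" and K: "compact K" "AE x in M. x \<in> K"
    and f: "integrable M f"
    and orth: "\<And>p. real_polynomial_function p \<Longrightarrow> (\<integral>x. f x * of_real (p x) \<partial>M) = 0"
  shows "AE x in M. f x = 0"
proof -
  have int: "integrable M (\<lambda>x. f x * of_real (p x))" if p: "real_polynomial_function p" for p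
  proof -
    have c: "continuous_on UNIV p"
      using p continuous_on_polymonial_function real_polynomial_function_eq by blast
    then have "bounded (p ` K)"
      by (meson K(1) compact_imp_bounded compact_continuous_image continuous_on_subset top_greatest)
    then obtain B where B: "\<And>x. x \<in> K \<Longrightarrow> \<bar>p x\<bar> \<le> B" unfolding bounded_iff by auto
    have pm: "p \<in> borel_measurable M"
      using borel_measurable_continuous_onI[OF c] M measurable_cong_sets by blast
    show ?thesis
    proof (rule Bochner_Integration.integrable_bound[of M "\<lambda>x. B * cmod (f x)"])
      show "AE x in M. norm (f x * of_real (p x)) \<le> norm (B * cmod (f x))"
        using K(2)
      proof eventually_elim
        case (elim x)
        have "cmod (f x) * \<bar>p x\<bar> \<le> cmod (f x) * \<bar>B\<bar>" using B[OF elim] by (intro mult_left_mono) auto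
        then show ?case by (simp add: norm_mult abs_mult mult.commute)
      qed
    qed (use f pm in auto)
  qed
  have "AE x in M. Re (f x) = 0"
  proof (rule AE_eq_0_if_orthogonal_to_polynomials_real[OF M K])
    fix p :: "'a \<Rightarrow> real" assume p: "real_polynomial_function p"
    have "(\<integral>x. Re (f x * of_real (p x)) \<partial>M) = 0"
      unfolding integral_Re[OF int[OF p]] orth[OF p] by simp
    then show "(\<integral>x. Re (f x) * p x \<partial>M) = 0" by simp
  qed (use f in auto)
  moreover have "AE x in M. Im (f x) = 0"
  proof (rule AE_eq_0_if_orthogonal_to_polynomials_real[OF M K])
    fix p :: "'a \<Rightarrow> real" assume p: "real_polynomial_function p"
    have "(\<integral>x. Im (f x * of_real (p x)) \<partial>M) = 0"
      unfolding integral_Im[OF int[OF p]] orth[OF p] by simp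
    then show "(\<integral>x. Im (f x) * p x \<partial>M) = 0" by simp
  qed (use f in auto)
  ultimately show ?thesis by eventually_elim (simp add: complex_eq_iff)
qed

text \<open>
  The substitution \<open>x = e\<^bsup>-t\<^esup>\<close> turns the Laplace transform at the integers into the
  moments of \<open>g (- ln x)\<close> on \<open>[0,1]\<close>, to which the previous lemma applies.
\<close>

lemma Lerch:
  fixes g :: "real \<Rightarrow> complex"
  assumes g [measurable]: "g \<in> borel_measurable borel"
    and int: "\<And>n::nat. 1 \<le> n \<Longrightarrow> set_integrable lborel {0..} (\<lambda>t. exp (- real n * t) *\<^sub>R g t)"
    and zero: "\<And>n::nat. 1 \<le> n \<Longrightarrow> (LINT t:{0..}|lborel. exp (- real n * t) *\<^sub>R g t) = 0"
  shows "AE t in lborel. 0 \<le> t \<longrightarrow> g t = 0"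
proof -
  \<comment> \<open>The density spends one factor \<open>e\<^bsup>-t\<^esup>\<close> and \<open>M\<close> is Lebesgue measure on the unit interval. The moment of order \<open>n\<close> is therefore the Laplace transform at \<open>n + 1\<close>.\<close>
  define D where "D = density lborel (\<lambda>t. ennreal (indicator {0..} t * exp (- t)))"
  define M where "M = distr D borel (\<lambda>t. exp (- t))"
  have e [measurable]: "(\<lambda>t. exp (- t)) \<in> measurable D borel" unfolding D_def by measurable
  have SD [measurable_cong]: "sets D = sets borel" unfolding D_def by simp
  have eqD: "(\<lambda>t. (indicator {0..} t * exp (- t)) *\<^sub>R (g (- ln (exp (- t))) * of_real (exp (-t) ^ n)))
      = (\<lambda>t. indicator {0..} t *\<^sub>R (exp (- real (Suc n) * t) *\<^sub>R g t))" for n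
    by (intro ext) (auto simp: indicator_def scaleR_conv_of_real exp_of_nat_mult[symmetric]
          exp_add[symmetric] of_real_mult[symmetric] algebra_simps simp del: of_real_mult)
  have intD: "integrable D (\<lambda>t. g (- ln (exp (- t))) * of_real (exp (-t) ^ n))" for n
    unfolding D_def using int[of "Suc n"] eqD[of n]
    by (subst integrable_density) (auto simp: set_integrable_def)
  have zeroD: "(\<integral>t. g (- ln (exp (- t))) * of_real (exp (-t) ^ n) \<partial>D) = 0" for n
    unfolding D_def using zero[of "Suc n"] eqD[of n]
    by (subst integral_density) (auto simp: set_lebesgue_integral_def)
  have "AE x in M. g (- ln x) = 0"
  proof (rule AE_eq_0_if_orthogonal_to_polynomials[where K="{0..1}"])
    show "sets M = sets borel" by (simp add: M_def)
    have "AE t in D. exp (- t) \<in> {0..1}"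
      unfolding D_def by (subst AE_density) (auto simp: indicator_def)
    then show "AE x in M. x \<in> {0..1}" unfolding M_def
      by (subst AE_distr_iff) auto
    have "integrable M (\<lambda>x. g (- ln x) * of_real (x ^ 0))"
      unfolding M_def by (subst integrable_distr_eq[OF e]) (use intD[of 0] in auto)
    then show "integrable M (\<lambda>x. g (- ln x))" by simp
    fix p :: "real \<Rightarrow> real" assume "real_polynomial_function p"
    then obtain a n where p: "p = (\<lambda>x. \<Sum>i\<le>n. a i * x ^ i)"
      unfolding real_polynomial_function_iff_sum by auto
    have "(\<integral>x. g (- ln x) * of_real (p x) \<partial>M)
        = (\<integral>t. (\<Sum>i\<le>n. of_real (a i) * (g (- ln (exp (- t))) * of_real (exp (-t) ^ i))) \<partial>D)"
      unfolding M_def p by (subst integral_distr[OF e])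
        (auto simp: sum_distrib_left mult_ac intro!: Bochner_Integration.integral_cong sum.cong)
    also have "\<dots> = 0" using intD zeroD by simp
    finally show "(\<integral>x. g (- ln x) * of_real (p x) \<partial>M) = 0" .
  qed auto
  then have "AE t in D. g t = 0" unfolding M_def by (subst (asm) AE_distr_iff) auto
  then show ?thesis unfolding D_def by (subst (asm) AE_density) (auto simp: indicator_def)
qed

section \<open>Derivatives of powers of the Legendre kernel\<close>

definition X2 :: "real poly" where "X2 = [:-1, 0, 1:]"

lemma poly_X2 [simp]: "poly X2 x = x\<^sup>2 - 1"
  and pderiv_X2 [simp]: "pderiv X2 = [:0, 2:]"
  and degree_X2 [simp]: "degree X2 = 2"
  and lead_coeff_X2: "coeff X2 2 = 1"
  by (simp_all add: X2_def pderiv_pCons power2_eq_square numeral_2_eq_2)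

definition rodrigues :: "nat \<Rightarrow> nat \<Rightarrow> real poly" where
  "rodrigues l k = (pderiv ^^ k) (X2 ^ l)"

lemma rodrigues_0: "rodrigues l 0 = X2 ^ l"
  and pderiv_rodrigues: "pderiv (rodrigues l k) = rodrigues l (Suc k)"
  by (simp_all add: rodrigues_def)

lemma degree_rodrigues: "degree (rodrigues l k) = 2 * l - k"
  by (simp add: rodrigues_def degree_higher_pderiv degree_power_eq X2_def)

lemma higher_deriv_legendre_kernel:
  "(deriv ^^ n) (\<lambda>y. (y\<^sup>2 - 1) ^ l) = poly (rodrigues l n)"
proof (induction n)
  case 0
  then show ?case by (auto simp: rodrigues_def power2_eq_square)
next
  case (Suc n)
  have "deriv (poly (rodrigues l n)) x = poly (rodrigues l (Suc n)) x" for x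
    by (metis DERIV_imp_deriv poly_DERIV pderiv_rodrigues)
  then show ?case using Suc by auto
qed

lemma rodrigues_first_order: "X2 * rodrigues l 1 = smult (2 * real l) ([:0, 1:] * rodrigues l 0)"
proof (cases l)
  case (Suc k)
  then show ?thesis
    by (intro poly_ext)
       (simp add: rodrigues_def pderiv_power_Suc pderiv_pCons del: power_Suc, simp add: algebra_simps)
qed (simp add: rodrigues_def)

text \<open>
  For \<open>n = l\<close> this is Legendre's equation. The case \<open>n = 0\<close> is the derivative of the
  first-order equation satisfied by \<open>(x\<^sup>2 - 1)\<^bsup>l\<^esup>\<close>; differentiating once more
  takes \<open>n\<close> to \<open>n + 1\<close>.
\<close>

lemma rodrigues_ode:
  "poly X2 x * poly (rodrigues l (n + 2)) x + 2 * (real n + 1 - real l) * x * poly (rodrigues l (n + 1)) x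
     + (real n + 1) * (real n - 2 * real l) * poly (rodrigues l n) x = 0"
proof -
  have "X2 * rodrigues l (n + 2) + smult (2 * (real n + 1 - real l)) ([:0, 1:] * rodrigues l (n + 1))
     + smult ((real n + 1) * (real n - 2 * real l)) (rodrigues l n) = 0" (is "?P n = 0")
  proof (induction n)
    case 0
    have "pderiv (X2 * rodrigues l 1) = pderiv (smult (2 * real l) ([:0, 1:] * rodrigues l 0))"
      by (simp only: rodrigues_first_order)
    then have e: "poly (pderiv (X2 * rodrigues l 1)) x
        = poly (pderiv (smult (2 * real l) ([:0, 1:] * rodrigues l 0))) x" for x by simp
    show ?case
    proof (rule poly_ext)
      fix x show "poly (?P 0) x = poly 0 x"
        using e[of x]
        by (simp add: pderiv_mult pderiv_smult pderiv_pCons pderiv_rodrigues numeral_2_eq_2)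
           (simp add: algebra_simps)
    qed
  next
    case (Suc n)
    have e: "poly (pderiv (?P n)) x = 0" for x using Suc by simp
    show ?case
    proof (rule poly_ext)
      fix x show "poly (?P (Suc n)) x = poly 0 x"
        using e[of x]
        by (simp add: pderiv_mult pderiv_add pderiv_smult pderiv_pCons pderiv_rodrigues)
           (simp add: algebra_simps)
    qed
  qed
  then have "poly (X2 * rodrigues l (n + 2) + smult (2 * (real n + 1 - real l)) ([:0, 1:] * rodrigues l (n + 1))
     + smult ((real n + 1) * (real n - 2 * real l)) (rodrigues l n)) x = 0" by simp
  then show ?thesis by (simp add: algebra_simps)
qed

text \<open>
  Each derivative lowers the order of the zeros at \<open>\<plusminus>1\<close> by at most one.
\<close>

lemma X2_power_dvd_rodrigues: "k \<le> l \<Longrightarrow> X2 ^ (l - k) dvd rodrigues l k"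
proof (induction k)
  case (Suc k)
  then obtain r where r: "rodrigues l k = X2 ^ Suc (l - Suc k) * r"
    by (auto simp: Suc_diff_Suc)
  have "X2 ^ (l - Suc k) dvd pderiv (X2 ^ Suc (l - Suc k) * r)"
    unfolding pderiv_mult pderiv_power_Suc
    by (intro dvd_add[OF dvd_mult2[OF le_imp_power_dvd] dvd_mult[OF dvd_mult2[OF dvd_smult[OF dvd_refl]]]]) simp
  then show ?case unfolding r[symmetric] by (simp only: pderiv_rodrigues)
qed (simp add: rodrigues_0)

lemma poly_rodrigues_endpoints:
  assumes "k < l" shows "poly (rodrigues l k) 1 = 0" "poly (rodrigues l k) (-1) = 0"
proof -
  obtain r where "rodrigues l k = X2 ^ (l - k) * r" using X2_power_dvd_rodrigues[of k l] assms by auto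
  then show "poly (rodrigues l k) 1 = 0" "poly (rodrigues l k) (-1) = 0" using assms by auto
qed

text \<open>
  The relation between the associated Legendre functions of orders \<open>j\<close> and \<open>-j\<close>. It is
  proved by induction: differentiating the claim for \<open>j + 1\<close> and eliminating the highest derivative
  by the differential equation leaves a multiple of the claim for \<open>j\<close>.
\<close>

lemma rodrigues_reflect:
  "j \<le> l \<Longrightarrow> X2 ^ j * rodrigues l (l + j) = smult (fact (l + j) / fact (l - j)) (rodrigues l (l - j))"
proof (induction j)
  case (Suc j)
  let ?L = "X2 ^ Suc j * rodrigues l (l + Suc j)"
  let ?c = "fact (l + Suc j) / fact (l - Suc j) :: real"
  let ?R = "smult ?c (rodrigues l (l - Suc j))"
  have lj: "Suc (l - Suc j) = l - j" using Suc.prems by simp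
  have c: "?c = (real l + real j + 1) * (real l - real j) * (fact (l + j) / fact (l - j))"
    using Suc.prems by (subst lj[symmetric]) (simp add: of_nat_diff field_simps)
  have IH: "poly X2 x ^ j * poly (rodrigues l (l + j)) x = fact (l + j) / fact (l - j) * poly (rodrigues l (l - j)) x" for x
    using arg_cong[OF Suc.IH, of "\<lambda>p. poly p x"] Suc.prems by simp
  have "pderiv ?L = pderiv ?R"
  proof (rule poly_ext)
    fix x
    have ode: "poly X2 x * poly (rodrigues l (l + j + 2)) x
        = - 2 * (real j + 1) * x * poly (rodrigues l (l + j + 1)) x
        + (real l + real j + 1) * (real l - real j) * poly (rodrigues l (l + j)) x"
      using rodrigues_ode[of x l "l + j"] by (simp add: algebra_simps)
    have "poly (pderiv ?L) x = poly X2 x ^ j * (poly X2 x * poly (rodrigues l (l + j + 2)) x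
        + 2 * (real j + 1) * x * poly (rodrigues l (l + j + 1)) x)"
      by (simp add: pderiv_mult pderiv_power_Suc pderiv_pCons pderiv_rodrigues del: power_Suc)
         (simp add: algebra_simps)
    also have "\<dots> = (real l + real j + 1) * (real l - real j) * (poly X2 x ^ j * poly (rodrigues l (l + j)) x)"
      unfolding ode by (simp add: algebra_simps)
    also have "\<dots> = ?c * poly (rodrigues l (l - j)) x"
      unfolding IH c by (simp only: mult.assoc)
    also have "\<dots> = poly (pderiv ?R) x"
      by (simp only: pderiv_smult pderiv_rodrigues lj poly_smult)
    finally show "poly (pderiv ?L) x = poly (pderiv ?R) x" .
  qed
  then have "pderiv (?L - ?R) = 0" by (simp add: pderiv_diff)
  then obtain a where a: "?L - ?R = [:a:]" using pderiv_iszero by auto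
  \<comment> \<open>The constant of integration is \<open>0\<close>: both sides vanish at \<open>1\<close>.\<close>
  have "poly (?L - ?R) 1 = 0" using poly_rodrigues_endpoints(1)[of "l - Suc j" l] Suc.prems by simp
  then have "a = 0" unfolding a by simp
  then show ?case using a by simp
qed simp

text \<open>
  The integral of \<open>p\<close> over \<open>[-1,1]\<close> in the variable \<open>x = cos \<theta>\<close>,
  the form in which it arises from surface measure.
\<close>

definition leg_int :: "real poly \<Rightarrow> real" where
  "leg_int p = (LBINT \<theta>:{0..pi}. poly p (cos \<theta>) * sin \<theta>)"

lemma set_integrable_leg_int: "set_integrable lborel {0..pi} (\<lambda>\<theta>. poly p (cos \<theta>) * sin \<theta>)"
  by (rule borel_integrable_atLeastAtMost') (intro continuous_intros)

lemma leg_int_add: "leg_int (p + q) = leg_int p + leg_int q"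
  using set_integral_add(2)[OF set_integrable_leg_int set_integrable_leg_int, of p q]
  by (simp add: leg_int_def algebra_simps)

lemma leg_int_smult: "leg_int (smult c p) = c * leg_int p"
  unfolding leg_int_def by (simp add: mult.assoc)

lemma leg_int_pderiv: "leg_int (pderiv p) = poly p 1 - poly p (-1)"
proof -
  have "(LBINT \<theta>:{0..pi}. poly (pderiv p) (cos \<theta>) * sin \<theta>) = - poly p (cos pi) - (- poly p (cos 0))"
    unfolding set_lebesgue_integral_def
  proof (rule integral_FTC_Icc)
    show "((\<lambda>x. - poly p (cos x)) has_vector_derivative poly (pderiv p) (cos x) * sin x) (at x within {0..pi})" for x
      unfolding has_real_derivative_iff_has_vector_derivative[symmetric]
      by (auto intro!: derivative_eq_intros DERIV_subset[OF DERIV_chain2[OF poly_DERIV]])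
    show "continuous_on {0..pi} (\<lambda>x. poly (pderiv p) (cos x) * sin x)"
      by (intro continuous_intros)
  qed simp
  then show ?thesis by (simp add: leg_int_def)
qed

lemma leg_int_by_parts:
  assumes "poly (p * q) 1 = 0" "poly (p * q) (-1) = 0"
  shows "leg_int (p * pderiv q) = - leg_int (pderiv p * q)"
proof -
  have "leg_int (p * pderiv q) + leg_int (pderiv p * q) = leg_int (pderiv (p * q))"
    by (simp add: leg_int_add[symmetric] pderiv_mult mult.commute)
  also have "\<dots> = 0" using assms by (simp only: leg_int_pderiv)
  finally show ?thesis by simp
qed

text \<open>
  Integrating by parts against the derivative of \<open>x\<close> gives a two-term recursion in
  \<open>l\<close>.
\<close>

lemma leg_int_X2_power: "leg_int (X2 ^ l) = (-1) ^ l * 2 ^ (2 * l + 1) * (fact l)\<^sup>2 / fact (2 * l + 1)"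
proof (induction l)
  case 0
  have "leg_int (pderiv [:0, 1:]) = 2" unfolding leg_int_pderiv by simp
  then show ?case by (simp add: pderiv_pCons one_pCons)
next
  case (Suc l)
  have "leg_int (X2 ^ Suc l * pderiv [:0, 1:]) = - leg_int (pderiv (X2 ^ Suc l) * [:0, 1:])"
    by (rule leg_int_by_parts) auto
  also have "pderiv (X2 ^ Suc l) * [:0, 1:] = smult (2 * (real l + 1)) (X2 ^ Suc l + X2 ^ l)"
    by (rule poly_ext) (simp add: pderiv_power_Suc pderiv_pCons del: power_Suc, simp add: algebra_simps power2_eq_square)
  also have "X2 ^ Suc l * pderiv [:0, 1:] = X2 ^ Suc l"
    by (simp add: pderiv_pCons)
  finally have "(2 * real l + 3) * leg_int (X2 ^ Suc l) = - (2 * real l + 2) * leg_int (X2 ^ l)"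
    by (simp add: leg_int_smult leg_int_add algebra_simps)
  then have "leg_int (X2 ^ Suc l) = - (2 * real l + 2) / (2 * real l + 3) * leg_int (X2 ^ l)"
    by (simp add: field_simps)
  also have "\<dots> = (-1) ^ Suc l * 2 ^ (2 * Suc l + 1) * (fact (Suc l))\<^sup>2 / fact (2 * Suc l + 1)"
  proof -
    have f: "fact (2 * Suc l + 1) = (2 * real l + 3) * (2 * real l + 2) * fact (2 * l + 1)"
      by (simp add: algebra_simps)
    have g: "fact (Suc l) = (real l + 1) * fact l" by simp
    have alg: "- (2 * x + 2) / (2 * x + 3) * (s * p * F\<^sup>2 / A)
        = (- s) * (4 * p) * ((x + 1) * F)\<^sup>2 / ((2 * x + 3) * (2 * x + 2) * A)"
      if "x \<ge> 0" "A > 0" for x s p F A :: real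
    proof -
      have "2 * x + 3 \<noteq> 0" "2 * x + 2 \<noteq> 0" "A \<noteq> 0" using that by auto
      then show ?thesis by (simp add: divide_simps) (simp add: algebra_simps power2_eq_square)
    qed
    show ?thesis unfolding Suc f g using alg[of "real l" "fact (2 * l + 1)" "(-1) ^ l" "2 ^ (2 * l + 1)" "fact l"]
      by (simp del: fact_Suc)
  qed
  finally show ?case .
qed

text \<open>
  Repeated integration by parts. The boundary terms vanish because at each stage one of the two factors is a
  derivative of too low an order to have lost its zeros at \<open>\<plusminus>1\<close>.
\<close>

lemma leg_int_rodrigues_transfer:
  assumes "m \<le> l" "m \<le> l'" "k \<le> l' + m"
  shows "leg_int (rodrigues l (l - m) * rodrigues l' (l' + m))
      = (-1) ^ k * leg_int (rodrigues l (l - m + k) * rodrigues l' (l' + m - k))"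
  using assms(3)
proof (induction k)
  case (Suc k)
  let ?p = "rodrigues l (l - m + k)" and ?q = "rodrigues l' (l' + m - Suc k)"
  have q: "rodrigues l' (l' + m - k) = pderiv ?q"
    using Suc.prems by (simp add: pderiv_rodrigues Suc_diff_Suc)
  have z: "poly (?p * ?q) 1 = 0 \<and> poly (?p * ?q) (-1) = 0"
  proof (cases "k < m")
    case True
    then show ?thesis using poly_rodrigues_endpoints[of "l - m + k" l] assms by simp
  next
    case False
    then show ?thesis using poly_rodrigues_endpoints[of "l' + m - Suc k" l'] Suc.prems by simp
  qed
  have "leg_int (?p * pderiv ?q) = - leg_int (pderiv ?p * ?q)"
    by (rule leg_int_by_parts) (use z in auto)
  then show ?case using Suc by (simp add: q pderiv_rodrigues)
qed simp

text \<open>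
  Orthogonality of the associated Legendre functions. For \<open>l \<le> l'\<close>, one factor is reflected to
  order \<open>l - m\<close>, and then all derivatives of the other factor are moved onto it. What remains is a
  derivative of order \<open>l + l'\<close> of a polynomial of degree \<open>2l\<close>, which is
  \<open>0\<close> for \<open>l < l'\<close> and a constant for \<open>l = l'\<close>.
\<close>

lemma leg_int_rodrigues:
  assumes "m \<le> l" "m \<le> l'"
  shows "leg_int ((- X2) ^ m * (rodrigues l (l + m) * rodrigues l' (l' + m)))
     = (if l = l' then fact (l + m) / fact (l - m) * (2 ^ l * fact l)\<^sup>2 * 2 / (2 * real l + 1) else 0)"
  using assms
proof (induction l l' rule: linorder_wlog)
  case (le l l')
  have X: "(- X2) ^ m * (rodrigues l (l + m) * rodrigues l' (l' + m))
     = smult ((-1) ^ m * (fact (l + m) / fact (l - m))) (rodrigues l (l - m) * rodrigues l' (l' + m))"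
  proof -
    have "(- X2) ^ m = smult ((-1) ^ m) (X2 ^ m)"
      by (metis mult_minus1 power_mult_distrib smult_1_left smult_minus_left smult_power)
    then show ?thesis using rodrigues_reflect[OF le(2)]
      by (simp add: mult.assoc[symmetric])
  qed
  have "leg_int (rodrigues l (l - m) * rodrigues l' (l' + m))
      = (-1) ^ (l' + m) * leg_int (rodrigues l (l + l') * X2 ^ l')"
    using leg_int_rodrigues_transfer[OF le(2,3), of "l' + m"] le by (simp add: rodrigues_0)
  moreover have "leg_int (rodrigues l (l + l') * X2 ^ l')
      = (if l = l' then fact (2 * l) * leg_int (X2 ^ l) else 0)"
  proof (cases "l = l'")
    case True
    have "degree (rodrigues l (2 * l)) = 0" by (simp add: degree_rodrigues)
    moreover have "coeff (rodrigues l (2 * l)) 0 = fact (2 * l)"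
    proof -
      have "degree (X2 ^ l) = 2 * l" by (simp add: degree_power_eq X2_def)
      then have "coeff (X2 ^ l) (2 * l) = 1"
        using lead_coeff_power[of X2 l] by (simp add: lead_coeff_X2)
      then show ?thesis
        by (simp add: rodrigues_def coeff_higher_pderiv pochhammer_fact)
    qed
    ultimately have "rodrigues l (2 * l) = [:fact (2 * l):]"
      using degree_0_id by metis
    then show ?thesis using True by (simp add: leg_int_smult mult_2[symmetric])
  next
    case False
    have "rodrigues l (l + l') = 0"
    proof (rule ccontr)
      let ?p = "rodrigues l (2 * l)"
      have "rodrigues l (Suc (2 * l)) = 0"
        using pderiv_eq_0_iff[of ?p] by (simp add: degree_rodrigues pderiv_rodrigues)
      moreover have "(pderiv ^^ (l' - l - 1)) (rodrigues l (Suc (2 * l))) = rodrigues l (l' - l - 1 + Suc (2 * l))"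
        by (simp only: rodrigues_def funpow_add o_apply)
      moreover have "l' - l - 1 + Suc (2 * l) = l + l'" using le False by simp
      moreover assume "rodrigues l (l + l') \<noteq> 0"
      ultimately show False by simp
    qed
    then show ?thesis using False by (simp add: leg_int_def)
  qed
  ultimately have *: "leg_int (rodrigues l (l - m) * rodrigues l' (l' + m))
      = (if l = l' then (-1) ^ (l + m) * (fact (2 * l) * leg_int (X2 ^ l)) else 0)" by simp
  show ?case
  proof (cases "l = l'")
    case True
    have sgn: "(-1) ^ m * ((-1) ^ (l + m) * (-1) ^ l) = (1 :: real)"
      by (cases "even m"; cases "even l"; simp add: power_add)
    have "(-1) ^ m * (fact (l + m) / fact (l - m)) * ((-1) ^ (l + m) * (fact (2 * l) * leg_int (X2 ^ l)))
        = ((-1) ^ m * ((-1) ^ (l + m) * (-1) ^ l)) * (fact (l + m) / fact (l - m) * (2 ^ l * fact l)\<^sup>2 * 2 / (2 * real l + 1))"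
    proof -
      have alg: "s1 * K * (s2 * (A * (s3 * (2 * p * p) * F\<^sup>2 / (D * A)))) = s1 * (s2 * s3) * (K * (p * F)\<^sup>2 * 2 / D)"
        if "A \<noteq> 0" for s1 s2 s3 K A p F D :: real
        using that by (simp add: power2_eq_square)
      have f: "fact (2 * l + 1) = (2 * real l + 1) * fact (2 * l)" by simp
      have p: "(2 :: real) ^ (2 * l + 1) = 2 * 2 ^ l * 2 ^ l"
      proof -
        have "2 * l + 1 = Suc (l + l)" by simp
        then show ?thesis by (simp only: power_Suc power_add mult.assoc)
      qed
      show ?thesis unfolding leg_int_X2_power f p by (rule alg) simp
    qed
    then show ?thesis unfolding X leg_int_smult * sgn using True by simp
  next
    case False
    then show ?thesis unfolding X leg_int_smult * by simp
  qed
next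
  case (sym l l')
  have "leg_int ((- X2) ^ m * (rodrigues l (l + m) * rodrigues l' (l' + m)))
      = leg_int ((- X2) ^ m * (rodrigues l' (l' + m) * rodrigues l (l + m)))"
    by (simp only: mult.commute)
  then show ?case using sym by auto
qed

section \<open>Spherical harmonics in coordinates and their orthonormality\<close>

abbreviation \<sigma> :: "(real^3) measure" where "\<sigma> \<equiv> sphere_measure"

text \<open>
  On the sphere this is \<open>sin \<theta> e\<^bsup>i\<phi>\<^esup>\<close>, so it absorbs the factor
  \<open>sin\<^bsup>m\<^esup> \<theta> e\<^bsup>im\<phi>\<^esup>\<close> of a harmonic with
  \<open>m \<ge> 0\<close>.
\<close>

definition zeta :: "real^3 \<Rightarrow> complex" where "zeta x = Complex (x $ 1) (x $ 2)"

lemma space_sphere [simp]: "space \<sigma> = sphere 0 1"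
  by (simp add: sphere_measure_def space_restrict_space)

lemma sets_sphere [measurable_cong]: "sets \<sigma> = sets (restrict_space borel (sphere 0 1))"
  by (simp add: sphere_measure_def)

lemma mem_sphere3: "x \<in> sphere 0 1 \<longleftrightarrow> (x $ 1)\<^sup>2 + (x $ 2)\<^sup>2 + (x $ 3)\<^sup>2 = 1" for x :: "real^3"
  by (simp add: norm_vec_def L2_set_def sum_3)

lemma sph_coords_sphere [simp]: "sph_coords \<theta> \<phi> \<in> sphere 0 1"
proof -
  have "(sin \<theta> * cos \<phi>)\<^sup>2 + (sin \<theta> * sin \<phi>)\<^sup>2 + (cos \<theta>)\<^sup>2
      = (sin \<theta>)\<^sup>2 * ((sin \<phi>)\<^sup>2 + (cos \<phi>)\<^sup>2) + (cos \<theta>)\<^sup>2"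
    by (simp only: power_mult_distrib algebra_simps)
  then show ?thesis unfolding mem_sphere3 by (simp add: sph_coords_def)
qed

lemma continuous_sph_coords: "continuous_on UNIV (\<lambda>p. sph_coords (fst p) (snd p))"
proof -
  have "continuous_on UNIV (\<lambda>p. \<chi> i. (sph_coords (fst p) (snd p)) $ i)"
  proof (rule continuous_on_vec_lambda)
    fix i :: 3
    have "i = 1 \<or> i = 2 \<or> i = 3" using exhaust_3 by blast
    then show "continuous_on UNIV (\<lambda>p. sph_coords (fst p) (snd p) $ i)"
      unfolding sph_coords_def by (elim disjE) (auto intro!: continuous_intros)
  qed
  then show ?thesis by simp
qed

lemma measurable_sph_coords:
  "(\<lambda>(\<theta>, \<phi>). sph_coords \<theta> \<phi>) \<in> lborel \<rightarrow>\<^sub>M restrict_space borel (sphere 0 1)"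
  using borel_measurable_continuous_onI[OF continuous_sph_coords] sph_coords_sphere
  by (intro measurable_restrict_space2) (auto simp: case_prod_beta' simp del: mem_sphere_0)

lemma
  assumes F [measurable]: "F \<in> borel_measurable \<sigma>"
  defines "G \<equiv> \<lambda>p. indicator ({0..pi} \<times> {0..<2 * pi}) p *\<^sub>R sin (fst p) *\<^sub>R F (sph_coords (fst p) (snd p))"
  shows sphere_integral_coords:
      "integral\<^sup>L \<sigma> F = (integral\<^sup>L (lborel \<Otimes>\<^sub>M lborel) G :: 'a::{banach, second_countable_topology})"
    and sphere_integrable_coords: "integrable \<sigma> F \<longleftrightarrow> integrable (lborel \<Otimes>\<^sub>M lborel) G"
proof -
  let ?R = "restrict_space (lborel :: (real \<times> real) measure) ({0..pi} \<times> {0..<2 * pi})"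
  let ?D = "density ?R (\<lambda>(\<theta>, \<phi>). ennreal (sin \<theta>))"
  have box: "{0..pi} \<times> {0..<2 * pi} \<in> sets (lborel :: (real \<times> real) measure)"
  proof -
    have "{0..pi} \<times> {0..<2 * pi} \<in> sets (borel \<Otimes>\<^sub>M borel :: (real \<times> real) measure)"
      by (intro pair_measureI) auto
    then show ?thesis by (metis borel_prod sets_lborel)
  qed
  have F' [measurable]: "F \<in> borel_measurable (restrict_space borel (sphere 0 1))"
    using F measurable_cong_sets sets_sphere by blast
  have c: "(\<lambda>(\<theta>, \<phi>). sph_coords \<theta> \<phi>) \<in> ?D \<rightarrow>\<^sub>M restrict_space borel (sphere 0 1)"
    using measurable_restrict_space1[OF measurable_sph_coords] by simp
  have cF: "(\<lambda>p. F (sph_coords (fst p) (snd p))) \<in> borel_measurable ?R"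
    using measurable_compose[OF c F'] by (simp add: case_prod_beta')
  have s: "(\<lambda>p. sin (fst p)) \<in> borel_measurable (lborel :: (real \<times> real) measure)"
  proof -
    have "continuous_on UNIV (\<lambda>p :: real \<times> real. sin (fst p))" by (intro continuous_intros)
    from borel_measurable_continuous_onI[OF this] show ?thesis by simp
  qed
  have sR: "(\<lambda>p. sin (fst p)) \<in> borel_measurable ?R"
    by (rule measurable_restrict_space1[OF s])
  have pos: "AE p in ?R. 0 \<le> sin (fst p)"
    by (rule AE_I2) (auto simp: space_restrict_space intro!: sin_ge_zero)
  have "integral\<^sup>L \<sigma> F = (\<integral>p. F (sph_coords (fst p) (snd p)) \<partial>?D)"
    unfolding sphere_measure_def by (subst integral_distr[OF c F']) (simp add: case_prod_beta')
  also have "\<dots> = (\<integral>p. sin (fst p) *\<^sub>R F (sph_coords (fst p) (snd p)) \<partial>?R)"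
    using cF sR pos by (simp add: case_prod_beta' integral_density)
  also have "\<dots> = integral\<^sup>L lborel G"
    unfolding G_def by (subst integral_restrict_space) (use box in auto)
  finally show "integral\<^sup>L \<sigma> F = integral\<^sup>L (lborel \<Otimes>\<^sub>M lborel) G" by (simp add: lborel_prod)
  have "integrable \<sigma> F \<longleftrightarrow> integrable ?D (\<lambda>p. F (sph_coords (fst p) (snd p)))"
    unfolding sphere_measure_def by (subst integrable_distr_eq[OF c F']) (simp add: case_prod_beta')
  also have "\<dots> \<longleftrightarrow> integrable ?R (\<lambda>p. sin (fst p) *\<^sub>R F (sph_coords (fst p) (snd p)))"
    using cF sR pos by (simp add: case_prod_beta' integrable_density)
  also have "\<dots> \<longleftrightarrow> integrable lborel G"
    unfolding G_def by (subst integrable_restrict_space) (use box in auto)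
  finally show "integrable \<sigma> F \<longleftrightarrow> integrable (lborel \<Otimes>\<^sub>M lborel) G" by (simp add: lborel_prod)
qed

lemma
  fixes a :: "real \<Rightarrow> real" and b :: "real \<Rightarrow> complex"
  assumes F: "F \<in> borel_measurable \<sigma>"
    and a: "continuous_on {0..pi} a" and b: "continuous_on {0..2 * pi} b"
    and eq: "\<And>\<theta> \<phi>. 0 < \<theta> \<Longrightarrow> \<theta> < pi \<Longrightarrow> 0 \<le> \<phi> \<Longrightarrow> \<phi> < 2 * pi \<Longrightarrow> F (sph_coords \<theta> \<phi>) = of_real (a \<theta>) * b \<phi>"
  shows sphere_integral_product:
      "integral\<^sup>L \<sigma> F = of_real (LBINT \<theta>:{0..pi}. a \<theta> * sin \<theta>) * (LBINT \<phi>:{0..2 * pi}. b \<phi>)"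
    and sphere_integrable_product: "integrable \<sigma> F"
proof -
  let ?G = "\<lambda>p. indicator ({0..pi} \<times> {0..<2 * pi}) p *\<^sub>R sin (fst p) *\<^sub>R F (sph_coords (fst p) (snd p))"
  let ?A = "\<lambda>\<theta>. indicator {0..pi} \<theta> * (a \<theta> * sin \<theta>)"
  let ?B = "\<lambda>\<phi>. indicator {0..<2 * pi} \<phi> *\<^sub>R b \<phi>"
  have G: "?G = (\<lambda>p. of_real (?A (fst p)) * ?B (snd p))"
  proof
    fix p :: "real \<times> real"
    show "?G p = of_real (?A (fst p)) * ?B (snd p)"
    \<comment> \<open>At the poles the factor \<open>sin \<theta>\<close> is \<open>0\<close>.\<close>
    proof (cases "fst p = 0 \<or> fst p = pi")
      case False
      then show ?thesis
        using eq[of "fst p" "snd p"] by (cases p) (auto simp: indicator_def scaleR_conv_of_real)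
    qed auto
  qed
  have Gp: "?G (x, y) = of_real (?A x) * ?B y" for x y
    using fun_cong[OF G, of "(x, y)"] by simp
  have intA: "integrable lborel ?A"
  proof -
    have "continuous_on {0..pi} (\<lambda>\<theta>. a \<theta> * sin \<theta>)" by (intro continuous_intros a)
    from borel_integrable_atLeastAtMost'[OF this] show ?thesis by (simp add: set_integrable_def)
  qed
  have sB: "set_integrable lborel {0..2 * pi} b"
    by (rule borel_integrable_atLeastAtMost'[OF b])
  have "set_integrable lborel {0..<2 * pi} b"
    by (rule set_integrable_subset[OF sB]) auto
  then have intB: "integrable lborel ?B" by (simp add: set_integrable_def)
  have mA: "?A \<in> borel_measurable lborel" and mB: "?B \<in> borel_measurable lborel"
    using intA intB by (auto dest: borel_measurable_integrable)
  have mG: "?G \<in> borel_measurable (lborel \<Otimes>\<^sub>M lborel)"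
    unfolding G using measurable_compose[OF measurable_compose[OF measurable_fst mA] borel_measurable_of_real]
      measurable_compose[OF measurable_snd mB]
    by (intro borel_measurable_times) (auto simp del: of_real_mult)
  have intG: "integrable (lborel \<Otimes>\<^sub>M lborel) ?G"
  proof (rule lborel_pair.Fubini_integrable[OF mG])
    show "integrable lborel (\<lambda>x. \<integral>y. norm (?G (x, y)) \<partial>lborel)"
      unfolding Gp norm_mult norm_of_real using integrable_norm[OF intA] by simp
    show "AE x in lborel. integrable lborel (\<lambda>y. ?G (x, y))"
      unfolding Gp by (intro AE_I2 integrable_mult_right intB)
  qed
  then show "integrable \<sigma> F" unfolding sphere_integrable_coords[OF F] .
  have "integral\<^sup>L \<sigma> F = (\<integral>x. \<integral>y. ?G (x, y) \<partial>lborel \<partial>lborel)"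
    unfolding sphere_integral_coords[OF F] using lborel_pair.integral_fst'[OF intG] by simp
  also have "\<dots> = of_real (LBINT \<theta>:{0..pi}. a \<theta> * sin \<theta>) * (LBINT \<phi>:{0..<2 * pi}. b \<phi>)"
    by (simp only: Gp integral_mult_right_zero integral_mult_left_zero integral_complex_of_real
        set_lebesgue_integral_def real_scaleR_def)
  also have "(LBINT \<phi>:{0..<2 * pi}. b \<phi>) = (LBINT \<phi>:{0..2 * pi}. b \<phi>)"
    unfolding set_lebesgue_integral_def
  proof (rule integral_cong_AE)
    have "AE x in lborel. x \<noteq> 2 * pi" by (rule AE_lborel_singleton)
    then show "AE x in lborel. indicator {0..<2 * pi} x *\<^sub>R b x = indicator {0..2 * pi} x *\<^sub>R b x"
      by eventually_elim (auto simp: indicator_def)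
    show "?B \<in> borel_measurable lborel" by (rule mB)
    show "(\<lambda>x. indicator {0..2 * pi} x *\<^sub>R b x) \<in> borel_measurable lborel"
      using sB by (auto simp: set_integrable_def)
  qed
  finally show "integral\<^sup>L \<sigma> F = of_real (LBINT \<theta>:{0..pi}. a \<theta> * sin \<theta>) * (LBINT \<phi>:{0..2 * pi}. b \<phi>)" .
qed

lemma integrable_sphere_const: "integrable \<sigma> (\<lambda>_. 1 :: complex)"
  by (rule sphere_integrable_product[where a="\<lambda>_. 1" and b="\<lambda>_. 1"]) auto

lemma finite_measure_sphere: "finite_measure \<sigma>"
proof
  have "integrable \<sigma> (\<lambda>x. indicat_real (space \<sigma>) x)"
    by (rule Bochner_Integration.integrable_cong[THEN iffD2, OF refl _ integrable_norm[OF integrable_sphere_const]]) simp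
  then have "emeasure \<sigma> (space \<sigma> \<inter> space \<sigma>) < \<infinity>"
    unfolding integrable_indicator_iff by simp
  then show "emeasure \<sigma> (space \<sigma>) \<noteq> \<infinity>" by simp
qed

interpretation sphere: finite_measure \<sigma> by (rule finite_measure_sphere)

lemma borel_measurable_sphere_continuous:
  "continuous_on (sphere 0 1) g \<Longrightarrow> g \<in> borel_measurable \<sigma>"
  using borel_measurable_continuous_on_restrict[of "sphere 0 1" g] measurable_cong_sets[OF sets_sphere refl] by blast

lemma continuous_zeta: "continuous_on A zeta"
proof -
  have "zeta = (\<lambda>x. of_real (x $ 1) + \<i> * of_real (x $ 2))"
    by (auto simp: zeta_def complex_eq_iff)
  then show ?thesis by (rule ssubst) (intro continuous_intros)
qed

text \<open>
  The normalised associated Legendre function of order \<open>j\<close> with its factor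
  \<open>(1 - x\<^sup>2)\<^bsup>j/2\<^esup>\<close> removed.
\<close>

definition leg_poly :: "nat \<Rightarrow> nat \<Rightarrow> real poly" where
  "leg_poly l j = smult (sqrt ((2 * real l + 1) * fact (l - j) / (4 * pi * fact (l + j)))
      * (-1) ^ j / (2 ^ l * fact l)) (rodrigues l (l + j))"

lemma legendre_normalised_nonneg:
  assumes "j \<le> l"
  shows "sqrt ((2 * real l + 1) * fact (nat (int l - int j)) / (4 * pi * fact (nat (int l + int j))))
      * assoc_legendre l (int j) x = sqrt (1 - x\<^sup>2) ^ j * poly (leg_poly l j) x"
proof -
  have "nat (int l - int j) = l - j" "nat (int l + int j) = l + j" using assms by auto
  then show ?thesis
    by (simp add: assoc_legendre_def leg_poly_def higher_deriv_legendre_kernel)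
qed

text \<open>
  For negative order the definition has a negative power of \<open>1 - x\<^sup>2\<close> and a derivative of low
  order; reflection converts this into the expression for positive order. At \<open>x = \<plusminus>1\<close>
  both sides are \<open>0\<close> unless \<open>j = 0\<close>.
\<close>

lemma legendre_normalised_neg:
  assumes j: "j \<le> l" and x: "x\<^sup>2 \<le> 1"
  shows "sqrt ((2 * real l + 1) * fact (nat (int l - - int j)) / (4 * pi * fact (nat (int l + - int j))))
      * assoc_legendre l (- int j) x = (-1) ^ j * (sqrt (1 - x\<^sup>2) ^ j * poly (leg_poly l j) x)"
proof (cases "j = 0")
  case True
  then show ?thesis using legendre_normalised_nonneg[of 0 l x] by simp
next
  case j0: False
  have n: "nat (int l - - int j) = l + j" "nat (int l + - int j) = l - j" using j by auto
  show ?thesis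
  proof (cases "x\<^sup>2 = 1")
    case True
    then show ?thesis using j0 by (simp add: assoc_legendre_def power_int_minus zero_power[of j])
  next
    case False
    define s where "s = sqrt (1 - x\<^sup>2)"
    have s: "s > 0" "s\<^sup>2 = 1 - x\<^sup>2" using x False by (auto simp: s_def)
    define \<kappa> :: real where "\<kappa> = fact (l + j) / fact (l - j)"
    have \<kappa>: "\<kappa> > 0" by (simp add: \<kappa>_def)
    have "(x\<^sup>2 - 1) ^ j * poly (rodrigues l (l + j)) x = \<kappa> * poly (rodrigues l (l - j)) x"
      using arg_cong[OF rodrigues_reflect[OF j], of "\<lambda>p. poly p x"] by (simp add: \<kappa>_def)
    moreover have "(x\<^sup>2 - 1) ^ j = (-1) ^ j * (s ^ j * s ^ j)"
    proof -
      have "x\<^sup>2 - 1 = (-1) * (s * s)" using s(2) by (simp add: power2_eq_square)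
      then show ?thesis by (simp only: power_mult_distrib)
    qed
    ultimately have r: "poly (rodrigues l (l - j)) x = (-1) ^ j * (s ^ j * s ^ j) * poly (rodrigues l (l + j)) x / \<kappa>"
      using \<kappa> by (simp add: field_simps)
    have norm: "sqrt ((2 * real l + 1) * fact (l + j) / (4 * pi * fact (l - j)))
        = \<kappa> * sqrt ((2 * real l + 1) * fact (l - j) / (4 * pi * fact (l + j)))"
    proof -
      have "(2 * real l + 1) * fact (l + j) / (4 * pi * fact (l - j))
          = \<kappa>\<^sup>2 * ((2 * real l + 1) * fact (l - j) / (4 * pi * fact (l + j)))"
        by (simp add: \<kappa>_def power2_eq_square field_simps)
      then show ?thesis using \<kappa> by (simp only: real_sqrt_mult real_sqrt_abs abs_of_pos)
    qed
    have P: "assoc_legendre l (- int j) x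
        = (-1) ^ j / (2 ^ l * fact l) * (1 / s ^ j) * poly (rodrigues l (l - j)) x"
    proof -
      have "(-1) powi (- int j) = ((-1) ^ j :: real)" by (cases "even j") (simp_all add: power_int_minus)
      moreover have "s powi (- int j) = 1 / s ^ j" by (simp add: power_int_minus divide_inverse)
      ultimately show ?thesis
        unfolding assoc_legendre_def higher_deriv_legendre_kernel n s_def[symmetric] by simp
    qed
    show ?thesis
      unfolding P r norm n leg_poly_def s_def[symmetric]
      using s(1) \<kappa> by (simp add: field_simps)
  qed
qed

lemma sph_harm_coord_eq:
  assumes "nat \<bar>m\<bar> \<le> l" "0 \<le> \<theta>" "\<theta> \<le> pi"
  shows "sph_harm_coord l m \<theta> \<phi> = of_real ((if m < 0 then (-1) ^ nat \<bar>m\<bar> else 1)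
      * (sin \<theta> ^ nat \<bar>m\<bar> * poly (leg_poly l (nat \<bar>m\<bar>)) (cos \<theta>))) * exp (\<i> * of_int m * of_real \<phi>)"
proof -
  have s: "sqrt (1 - (cos \<theta>)\<^sup>2) = sin \<theta>"
    using sin_ge_zero[OF assms(2,3)] by (simp add: sin_squared_eq[symmetric])
  have c: "(cos \<theta>)\<^sup>2 \<le> 1" by (simp add: abs_square_le_1)
  show ?thesis
  proof (cases "m < 0")
    case True
    then have m: "m = - int (nat \<bar>m\<bar>)" by simp
    show ?thesis unfolding sph_harm_coord_def
      using legendre_normalised_neg[OF assms(1) c] s True
      by (simp add: m[symmetric] del: of_real_mult)
  next
    case False
    then have m: "m = int (nat \<bar>m\<bar>)" by simp
    show ?thesis unfolding sph_harm_coord_def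
      using legendre_normalised_nonneg[OF assms(1), of "cos \<theta>"] s False
      by (simp add: m[symmetric] del: of_real_mult)
  qed
qed

lemma sph_harm_sph_coords:
  assumes "0 < \<theta>" "\<theta> < pi" "0 \<le> \<phi>" "\<phi> < 2 * pi"
  shows "sph_harm l m (sph_coords \<theta> \<phi>) = sph_harm_coord l m \<theta> \<phi>"
proof -
  have "Arg2pi (Complex (sin \<theta> * cos \<phi>) (sin \<theta> * sin \<phi>)) = \<phi>"
    by (rule Arg2pi_unique[of "sin \<theta>"])
       (use assms sin_gt_zero in \<open>auto simp: complex_eq_iff Re_exp Im_exp\<close>)
  then show ?thesis using assms by (simp add: sph_harm_def sph_coords_def arccos_cos)
qed

text \<open>
  In Cartesian coordinates the harmonics are polynomials, including at the poles and on the meridian where the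
  azimuth jumps. Continuity and measurability are read off from here.
\<close>

lemma sph_harm_on_sphere:
  assumes "nat \<bar>m\<bar> \<le> l" and x: "x \<in> sphere 0 1"
  shows "sph_harm l m x = of_real (poly (leg_poly l (nat \<bar>m\<bar>)) (x $ 3))
      * (if m < 0 then (- cnj (zeta x)) ^ nat \<bar>m\<bar> else zeta x ^ nat \<bar>m\<bar>)"
proof -
  have x3: "\<bar>x $ 3\<bar> \<le> 1"
    using x unfolding mem_sphere3 by (metis abs_le_square_iff abs_one le_add_same_cancel2 one_power2 add_nonneg_nonneg zero_le_power2)
  have s: "sin (arccos (x $ 3)) = cmod (zeta x)"
    using x x3 unfolding mem_sphere3
    by (simp add: sin_arccos_abs zeta_def cmod_def)
  have c: "cos (arccos (x $ 3)) = x $ 3" using x3 by (simp add: cos_arccos_abs)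
  let ?A = "Arg2pi (Complex (x $ 1) (x $ 2))"
  have z: "zeta x = cmod (zeta x) * exp (\<i> * of_real ?A)"
    using Arg2pi_eq[of "zeta x"] by (simp add: zeta_def)
  then have zc: "cnj (zeta x) = cmod (zeta x) * exp (- (\<i> * of_real ?A))"
    by (metis complex_cnj_complex_of_real complex_cnj_mult complex_cnj_i exp_cnj mult_minus_left)
  have zn: "zeta x ^ n = of_real (cmod (zeta x)) ^ n * exp (\<i> * of_real ?A) ^ n" for n
    using arg_cong[OF z, of "\<lambda>w. w ^ n"] by (simp only: power_mult_distrib)
  have zcn: "(- cnj (zeta x)) ^ n = (-1) ^ n * (of_real (cmod (zeta x)) ^ n * exp (- (\<i> * of_real ?A)) ^ n)" for n
    unfolding power_minus[of "cnj (zeta x)"] using arg_cong[OF zc, of "\<lambda>w. w ^ n"] by (simp only: power_mult_distrib)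
  have ex: "exp (\<i> * of_int m * of_real ?A) = (if m < 0 then exp (- (\<i> * of_real ?A)) ^ nat \<bar>m\<bar> else exp (\<i> * of_real ?A) ^ nat \<bar>m\<bar>)"
    by (cases "m < 0") (simp_all add: exp_of_nat_mult[symmetric] mult_ac)
  have arc: "0 \<le> arccos (x $ 3)" "arccos (x $ 3) \<le> pi" using x3 arccos_lbound arccos_ubound by auto
  show ?thesis
    unfolding sph_harm_def sph_harm_coord_eq[OF assms(1) arc] s c ex
    unfolding zn zcn by (simp add: mult_ac)
qed

lemma sph_harm_neg:
  assumes "nat \<bar>m\<bar> \<le> l" "x \<in> sphere 0 1"
  shows "sph_harm l (- m) x = (-1) ^ nat \<bar>m\<bar> * cnj (sph_harm l m x)"
proof -
  have p: "(- w) ^ j = (-1) ^ j * w ^ j" for w :: complex and j by (rule power_minus)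
  have q: "(-1) ^ j * ((-1) ^ j * w) = w" for w :: complex and j
    by (simp add: mult.assoc[symmetric] power_mult_distrib[symmetric])
  have "m = 0 \<or> m < 0 \<or> m > 0" by auto
  then show ?thesis
    using sph_harm_on_sphere[OF assms] sph_harm_on_sphere[of "- m" l x] assms
    by (elim disjE) (simp_all add: p[of "zeta x"] p[of "cnj (zeta x)"] q)
qed

lemma continuous_sph_harm:
  assumes "nat \<bar>m\<bar> \<le> l" shows "continuous_on (sphere 0 1) (sph_harm l m)"
proof -
  have "continuous_on (sphere 0 1) (\<lambda>x. of_real (poly (leg_poly l (nat \<bar>m\<bar>)) (x $ 3))
      * (if m < 0 then (- cnj (zeta x)) ^ nat \<bar>m\<bar> else zeta x ^ nat \<bar>m\<bar>))"
    by (cases "m < 0"; simp; intro continuous_intros continuous_zeta)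
  then show ?thesis by (subst continuous_on_cong[OF refl sph_harm_on_sphere[OF assms]]) auto
qed

lemma azimuth_integral:
  "(LBINT \<phi>:{0..2 * pi}. exp (\<i> * of_int k * of_real \<phi>)) = (if k = 0 then 2 * pi else 0)"
proof (cases "k = 0")
  case True
  then show ?thesis by (simp add: set_lebesgue_integral_def scaleR_conv_of_real)
next
  case False
  let ?F = "\<lambda>\<phi>. exp (\<i> * of_int k * complex_of_real \<phi>) / (\<i> * of_int k)"
  have "(LBINT \<phi>:{0..2 * pi}. exp (\<i> * of_int k * of_real \<phi>)) = ?F (2 * pi) - ?F 0"
    unfolding set_lebesgue_integral_def
  proof (rule integral_FTC_Icc)
    show "(?F has_vector_derivative exp (\<i> * of_int k * of_real x)) (at x within {0..2 * pi})" for x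
    proof -
      have "((\<lambda>z. exp (\<i> * of_int k * z) / (\<i> * of_int k)) has_field_derivative exp (\<i> * of_int k * of_real x)) (at (of_real x))"
        using False by (auto intro!: derivative_eq_intros)
      then show ?thesis
        by (auto intro: has_vector_derivative_real_field has_vector_derivative_at_within)
    qed
  qed (auto intro!: continuous_intros)
  also have "\<dots> = 0"
  proof -
    have "exp (2 * of_int k * of_real pi * \<i>) = (1::complex)"
      by (simp add: exp_eq_1)
    then show ?thesis by (simp add: mult_ac)
  qed
  finally show ?thesis using False by simp
qed

lemma leg_int_leg_poly:
  assumes "j \<le> l" "j \<le> l'"
  shows "leg_int ((- X2) ^ j * (leg_poly l j * leg_poly l' j)) = (if l = l' then 1 / (2 * pi) else 0)"
proof -
  define C where "C l = sqrt ((2 * real l + 1) * fact (l - j) / (4 * pi * fact (l + j)))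
      * (-1) ^ j / (2 ^ l * fact l)" for l
  have "(- X2) ^ j * (leg_poly l j * leg_poly l' j) = smult (C l * C l') ((- X2) ^ j * (rodrigues l (l + j) * rodrigues l' (l' + j)))"
    unfolding leg_poly_def C_def[symmetric] by (simp add: mult.commute)
  then have *: "leg_int ((- X2) ^ j * (leg_poly l j * leg_poly l' j))
      = C l * C l' * (if l = l' then fact (l + j) / fact (l - j) * (2 ^ l * fact l)\<^sup>2 * 2 / (2 * real l + 1) else 0)"
    using leg_int_rodrigues[OF assms] by (simp add: leg_int_smult)
  have "C l * C l * (fact (l + j) / fact (l - j) * (2 ^ l * fact l)\<^sup>2 * 2 / (2 * real l + 1)) = 1 / (2 * pi)"
  proof -
    have "C l * C l = (2 * real l + 1) * fact (l - j) / (4 * pi * fact (l + j)) / (2 ^ l * fact l)\<^sup>2"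
      by (simp add: C_def power2_eq_square power_mult_distrib[symmetric] mult_ac)
    show ?thesis unfolding \<open>C l * C l = _\<close> by (simp add: divide_simps)
  qed
  then show ?thesis unfolding * by auto
qed

text \<open>
  The integral splits into an azimuthal factor, which forces \<open>m = m'\<close>, and for
  \<open>m = m'\<close> a Legendre integral of one common order \<open>|m|\<close>.
\<close>

lemma sph_harm_orthonormal:
  assumes "nat \<bar>m\<bar> \<le> l" "nat \<bar>m'\<bar> \<le> l'"
  shows "(\<integral>x. sph_harm l m x * cnj (sph_harm l' m' x) \<partial>\<sigma>) = (if l = l' \<and> m = m' then 1 else 0)"
proof -
  let ?j = "nat \<bar>m\<bar>" and ?j' = "nat \<bar>m'\<bar>"
  let ?s = "\<lambda>m::int. (if m < 0 then (-1) ^ nat \<bar>m\<bar> else 1 :: real)"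
  define a where "a \<theta> = (?s m * (sin \<theta> ^ ?j * poly (leg_poly l ?j) (cos \<theta>)))
      * (?s m' * (sin \<theta> ^ ?j' * poly (leg_poly l' ?j') (cos \<theta>)))" for \<theta>
  have "(\<integral>x. sph_harm l m x * cnj (sph_harm l' m' x) \<partial>\<sigma>)
      = of_real (LBINT \<theta>:{0..pi}. a \<theta> * sin \<theta>) * (LBINT \<phi>:{0..2 * pi}. exp (\<i> * of_int (m - m') * of_real \<phi>))"
  proof (rule sphere_integral_product)
    show "(\<lambda>x. sph_harm l m x * cnj (sph_harm l' m' x)) \<in> borel_measurable \<sigma>"
      using continuous_sph_harm assms
      by (intro borel_measurable_sphere_continuous continuous_intros) auto
    show "continuous_on {0..pi} a" unfolding a_def by (intro continuous_intros)
    show "continuous_on {0..2 * pi} (\<lambda>\<phi>. exp (\<i> * of_int (m - m') * of_real \<phi>))"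
      by (intro continuous_intros)
    fix \<theta> \<phi> :: real assume h: "0 < \<theta>" "\<theta> < pi" "0 \<le> \<phi>" "\<phi> < 2 * pi"
    have "exp (\<i> * of_int m * of_real \<phi>) * cnj (exp (\<i> * of_int m' * of_real \<phi>)) = exp (\<i> * of_int (m - m') * of_real \<phi>)"
      by (simp add: exp_cnj exp_add[symmetric] algebra_simps)
    note e = this
    show "sph_harm l m (sph_coords \<theta> \<phi>) * cnj (sph_harm l' m' (sph_coords \<theta> \<phi>)) = of_real (a \<theta>) * exp (\<i> * of_int (m - m') * of_real \<phi>)"
      unfolding sph_harm_sph_coords[OF h] e[symmetric] using h
      by (simp only: sph_harm_coord_eq assms less_imp_le a_def complex_cnj_mult complex_cnj_complex_of_real of_real_mult mult_ac)
  qed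
  also have "\<dots> = (if l = l' \<and> m = m' then 1 else 0)"
  proof (cases "m = m'")
    case True
    have "(LBINT \<theta>:{0..pi}. a \<theta> * sin \<theta>) = leg_int ((- X2) ^ ?j * (leg_poly l ?j * leg_poly l' ?j))"
    proof -
      have "a \<theta> = poly ((- X2) ^ ?j * (leg_poly l ?j * leg_poly l' ?j)) (cos \<theta>)" for \<theta>
      proof -
        have "1 - (cos \<theta>)\<^sup>2 = sin \<theta> * sin \<theta>" by (simp add: power2_eq_square[symmetric] sin_squared_eq)
        then have "poly ((- X2) ^ ?j) (cos \<theta>) = sin \<theta> ^ ?j * sin \<theta> ^ ?j" by (simp add: power_mult_distrib)
        moreover have "?s m * ?s m = 1" by (simp add: power_mult_distrib[symmetric])
        then have "a \<theta> = (sin \<theta> ^ ?j * sin \<theta> ^ ?j) * (poly (leg_poly l ?j) (cos \<theta>) * poly (leg_poly l' ?j) (cos \<theta>))"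
          unfolding a_def True[symmetric] by (auto simp: mult_ac)
        ultimately show ?thesis by simp
      qed
      then show ?thesis by (simp add: leg_int_def)
    qed
    then show ?thesis using True assms leg_int_leg_poly[of ?j l l'] azimuth_integral[of "m - m'"] by auto
  next
    case False
    then show ?thesis using azimuth_integral[of "m - m'"] by simp
  qed
  finally show ?thesis .
qed

section \<open>Completeness of the spherical harmonics\<close>

lemma integrable_times_continuous:
  fixes f g :: "real^3 \<Rightarrow> complex"
  assumes f: "integrable \<sigma> f" and g: "continuous_on (sphere 0 1) g"
  shows "integrable \<sigma> (\<lambda>x. f x * g x)"
proof -
  have "bounded (g ` sphere 0 1)" by (intro compact_imp_bounded compact_continuous_image g) simp
  then obtain B where "\<forall>y\<in>g ` sphere 0 1. cmod y \<le> B" unfolding bounded_iff ..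
  then have B: "cmod (g x) \<le> B" if "x \<in> sphere 0 1" for x using imageI[OF that, of g] by (rule bspec)
  show ?thesis
  proof (rule Bochner_Integration.integrable_bound[of \<sigma> "\<lambda>x. B *\<^sub>R f x"])
    show "(\<lambda>x. f x * g x) \<in> borel_measurable \<sigma>"
      using f borel_measurable_sphere_continuous[OF g] by auto
    show "AE x in \<sigma>. norm (f x * g x) \<le> norm (B *\<^sub>R f x)"
    proof (rule AE_I2)
      fix x assume "x \<in> space \<sigma>"
      then have "cmod (g x) \<le> \<bar>B\<bar>" using B[of x] by simp
      from mult_left_mono[OF this, of "cmod (f x)"] show "norm (f x * g x) \<le> norm (B *\<^sub>R f x)"
        by (simp add: norm_mult mult.commute)
    qed
  qed (use f in auto)
qed

text \<open>
  A member of the same degree cancels the leading coefficient.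
\<close>

lemma poly_linear_closed_all_degrees:
  fixes V :: "real poly \<Rightarrow> bool"
  assumes add: "\<And>p q. V p \<Longrightarrow> V q \<Longrightarrow> V (p + q)" and smult: "\<And>c p. V p \<Longrightarrow> V (smult c p)"
    and deg: "\<And>k. \<exists>q. V q \<and> q \<noteq> 0 \<and> degree q = k"
  shows "V p"
proof -
  have V0: "V 0" using deg[of 0] smult[of _ 0] by auto
  have "p = 0 \<or> degree p < n \<Longrightarrow> V p" for n
  proof (induction n arbitrary: p)
    case (Suc n)
    show ?case
    proof (cases "p = 0 \<or> degree p < n")
      case False
      then have d: "degree p = n" "p \<noteq> 0" using Suc.prems by auto
      obtain q where q: "V q" "q \<noteq> 0" "degree q = n" using deg by blast
      let ?c = "lead_coeff p / lead_coeff q"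
      let ?r = "p - smult ?c q"
      have "?r = 0 \<or> degree ?r < n"
      proof (cases "?r = 0")
        case r0: False
        have "coeff q n \<noteq> 0" using q by (metis leading_coeff_0_iff)
        then have "coeff ?r n = 0" using d q by auto
        moreover have "degree ?r \<le> n" using d q by (intro degree_diff_le) auto
        ultimately show ?thesis using r0 by (metis le_neq_implies_less leading_coeff_0_iff)
      qed simp
      then have "V ?r" by (rule Suc.IH)
      from add[OF this smult[OF q(1), of ?c]] show ?thesis by simp
    qed (rule Suc.IH)
  qed (use V0 in auto)
  then show ?thesis by blast
qed

text \<open>
  The span of the terms that make up the harmonics, one azimuthal order at a time. It contains the restriction
  of every polynomial to the sphere, because \<open>zeta x * cnj (zeta x)\<close> is a polynomial in the third
  coordinate and mixed monomials therefore reduce to the two generating forms.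
\<close>

inductive sphere_polynomial :: "(real^3 \<Rightarrow> complex) \<Rightarrow> bool" where
  pos: "sphere_polynomial (\<lambda>x. zeta x ^ j * of_real (poly p (x $ 3)))"
| neg: "sphere_polynomial (\<lambda>x. cnj (zeta x) ^ j * of_real (poly p (x $ 3)))"
| add: "sphere_polynomial g \<Longrightarrow> sphere_polynomial h \<Longrightarrow> sphere_polynomial (\<lambda>x. g x + h x)"
| scale: "sphere_polynomial g \<Longrightarrow> sphere_polynomial (\<lambda>x. c * g x)"
| cong: "sphere_polynomial g \<Longrightarrow> (\<And>x. x \<in> sphere 0 1 \<Longrightarrow> h x = g x) \<Longrightarrow> sphere_polynomial h"

lemma zeta_cnj_zeta:
  assumes "x \<in> sphere 0 1" shows "zeta x * cnj (zeta x) = of_real (1 - (x $ 3)\<^sup>2)"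
  using assms unfolding mem_sphere3
  by (auto simp: zeta_def complex_eq_iff power2_eq_square algebra_simps)

lemma sphere_polynomial_times_coordinates:
  assumes "sphere_polynomial g"
  shows "sphere_polynomial (\<lambda>x. of_real (x $ 3) * g x) \<and> sphere_polynomial (\<lambda>x. zeta x * g x)
    \<and> sphere_polynomial (\<lambda>x. cnj (zeta x) * g x)"
  using assms
proof induction
  case (pos j p)
  have "sphere_polynomial (\<lambda>x. cnj (zeta x) * (zeta x ^ j * of_real (poly p (x $ 3))))"
  proof (cases j)
    case 0
    then show ?thesis by (intro sphere_polynomial.cong[OF sphere_polynomial.neg[of 1 p]]) auto
  next
    case (Suc i)
    show ?thesis
    proof (intro sphere_polynomial.cong[OF sphere_polynomial.pos[of i "[:1, 0, -1:] * p"]])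
      fix x :: "real^3" assume x: "x \<in> sphere 0 1"
      have "cnj (zeta x) * (zeta x ^ j * of_real (poly p (x $ 3)))
          = (zeta x * cnj (zeta x)) * (zeta x ^ i * of_real (poly p (x $ 3)))" by (simp add: Suc)
      then show "cnj (zeta x) * (zeta x ^ j * of_real (poly p (x $ 3)))
          = zeta x ^ i * of_real (poly ([:1, 0, -1:] * p) (x $ 3))"
        unfolding zeta_cnj_zeta[OF x] by (simp add: power2_eq_square algebra_simps)
    qed
  qed
  moreover have "sphere_polynomial (\<lambda>x. of_real (x $ 3) * (zeta x ^ j * of_real (poly p (x $ 3))))"
    by (intro sphere_polynomial.cong[OF sphere_polynomial.pos[of j "[:0, 1:] * p"]]) simp
  moreover have "sphere_polynomial (\<lambda>x. zeta x * (zeta x ^ j * of_real (poly p (x $ 3))))"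
    by (intro sphere_polynomial.cong[OF sphere_polynomial.pos[of "Suc j" p]]) simp
  ultimately show ?case by blast
next
  case (neg j p)
  have "sphere_polynomial (\<lambda>x. zeta x * (cnj (zeta x) ^ j * of_real (poly p (x $ 3))))"
  proof (cases j)
    case 0
    then show ?thesis by (intro sphere_polynomial.cong[OF sphere_polynomial.pos[of 1 p]]) auto
  next
    case (Suc i)
    show ?thesis
    proof (intro sphere_polynomial.cong[OF sphere_polynomial.neg[of i "[:1, 0, -1:] * p"]])
      fix x :: "real^3" assume x: "x \<in> sphere 0 1"
      have "zeta x * (cnj (zeta x) ^ j * of_real (poly p (x $ 3)))
          = (zeta x * cnj (zeta x)) * (cnj (zeta x) ^ i * of_real (poly p (x $ 3)))" by (simp add: Suc)
      then show "zeta x * (cnj (zeta x) ^ j * of_real (poly p (x $ 3)))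
          = cnj (zeta x) ^ i * of_real (poly ([:1, 0, -1:] * p) (x $ 3))"
        unfolding zeta_cnj_zeta[OF x] by (simp add: power2_eq_square algebra_simps)
    qed
  qed
  moreover have "sphere_polynomial (\<lambda>x. of_real (x $ 3) * (cnj (zeta x) ^ j * of_real (poly p (x $ 3))))"
    by (intro sphere_polynomial.cong[OF sphere_polynomial.neg[of j "[:0, 1:] * p"]]) simp
  moreover have "sphere_polynomial (\<lambda>x. cnj (zeta x) * (cnj (zeta x) ^ j * of_real (poly p (x $ 3))))"
    by (intro sphere_polynomial.cong[OF sphere_polynomial.neg[of "Suc j" p]]) simp
  ultimately show ?case by blast
next
  case (add g h)
  then show ?case unfolding distrib_left
    by (elim conjE, intro conjI) (rule sphere_polynomial.add; assumption)+
next
  case (scale g c)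
  then show ?case unfolding mult.left_commute[of _ c]
    by (elim conjE, intro conjI) (rule sphere_polynomial.scale; assumption)+
next
  case (cong g h)
  have "sphere_polynomial (\<lambda>x. k x * h x)" if "sphere_polynomial (\<lambda>x. k x * g x)" for k
    by (rule sphere_polynomial.cong[OF that]) (simp add: cong(2))
  then show ?case using cong(3) by (elim conjE, intro conjI) (assumption | rule)+
qed

lemma sphere_polynomial_times_real_polynomial:
  assumes "real_polynomial_function p" "sphere_polynomial g"
  shows "sphere_polynomial (\<lambda>x. of_real (p x) * g x)"
  using assms
proof (induction arbitrary: g)
  case (linear h)
  interpret bounded_linear h by fact
  have h: "h x = x $ 1 * h (axis 1 1) + x $ 2 * h (axis 2 1) + x $ 3 * h (axis 3 1)" for x
  proof -
    have "x = x $ 1 *\<^sub>R axis 1 1 + x $ 2 *\<^sub>R axis 2 1 + x $ 3 *\<^sub>R axis 3 1"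
      by (simp add: vec_eq_iff forall_3 axis_def)
    from arg_cong[OF this, of h] show ?thesis by (simp only: add scale real_scaleR_def)
  qed
  let ?a = "complex_of_real (h (axis 1 1))" and ?b = "complex_of_real (h (axis 2 1))" and ?c = "complex_of_real (h (axis 3 1))"
  have eq: "complex_of_real (h x) * g x = ((?a - \<i> * ?b) / 2) * (zeta x * g x) + ((?a + \<i> * ?b) / 2) * (cnj (zeta x) * g x)
     + ?c * (of_real (x $ 3) * g x)" for x
  proof -
    have "complex_of_real (h x) = ((?a - \<i> * ?b) / 2) * zeta x + ((?a + \<i> * ?b) / 2) * cnj (zeta x) + ?c * of_real (x $ 3)"
      by (simp add: h[of x] zeta_def complex_eq_iff field_simps)
    then show ?thesis by (simp only: distrib_right mult.assoc)
  qed
  show ?case unfolding eq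
    using sphere_polynomial_times_coordinates[OF linear.prems]
    by (elim conjE) (intro sphere_polynomial.add sphere_polynomial.scale; assumption)
next
  case (add p q)
  then show ?case by (simp add: distrib_right sphere_polynomial.add)
next
  case (mult p q)
  then show ?case by (simp add: mult.assoc)
next
  case (const c)
  then show ?case by (rule sphere_polynomial.scale)
qed

lemma continuous_sphere_polynomial: "sphere_polynomial g \<Longrightarrow> continuous_on (sphere 0 1) g"
proof (induction rule: sphere_polynomial.induct)
  case (cong g h)
  then show ?case using continuous_on_cong[OF refl, of "sphere 0 1" h g] by simp
next
  case (add g h)
  then show ?case by (intro continuous_on_add)
next
  case (scale g c)
  then show ?case by (intro continuous_on_mult continuous_on_const)
next
  case (pos j p)
  show ?case by (intro continuous_intros continuous_zeta)
next
  case (neg j p)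
  show ?case by (intro continuous_intros continuous_zeta)
qed

text \<open>
  For fixed order \<open>j\<close>, the polynomials \<open>leg_poly l j\<close> with
  \<open>l = j, j + 1, \<dots>\<close> have degrees \<open>0, 1, \<dots>\<close>, so they span all polynomials
  in the third coordinate.
\<close>

lemma orthogonal_to_sphere_polynomials:
  assumes f: "integrable \<sigma> f"
    and coeff: "\<And>l m. nat \<bar>m\<bar> \<le> l \<Longrightarrow> sph_coeff f l m = 0"
    and g: "sphere_polynomial g"
  shows "(\<integral>x. f x * g x \<partial>\<sigma>) = 0"
proof -
  have all: "(\<integral>x. f x * (w x * of_real (poly p (x $ 3))) \<partial>\<sigma>) = 0"
    if w: "continuous_on (sphere 0 1) w"
      and leg: "\<And>l. j \<le> l \<Longrightarrow> (\<integral>x. f x * (w x * of_real (poly (leg_poly l j) (x $ 3))) \<partial>\<sigma>) = 0" for w j p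
  proof (rule poly_linear_closed_all_degrees[where V="\<lambda>p. (\<integral>x. f x * (w x * of_real (poly p (x $ 3))) \<partial>\<sigma>) = 0"])
    have int: "integrable \<sigma> (\<lambda>x. f x * (w x * of_real (poly p (x $ 3))))" for p
      by (intro integrable_times_continuous f continuous_intros w)
    show "(\<integral>x. f x * (w x * of_real (poly (p + q) (x $ 3))) \<partial>\<sigma>) = 0"
      if "(\<integral>x. f x * (w x * of_real (poly p (x $ 3))) \<partial>\<sigma>) = 0" "(\<integral>x. f x * (w x * of_real (poly q (x $ 3))) \<partial>\<sigma>) = 0" for p q
      using Bochner_Integration.integral_add[OF int[of p] int[of q]] that by (simp add: distrib_left)
    show "(\<integral>x. f x * (w x * of_real (poly (smult c p) (x $ 3))) \<partial>\<sigma>) = 0"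
      if "(\<integral>x. f x * (w x * of_real (poly p (x $ 3))) \<partial>\<sigma>) = 0" for c p
    proof -
      have "(\<lambda>x. f x * (w x * of_real (poly (smult c p) (x $ 3)))) = (\<lambda>x. of_real c * (f x * (w x * of_real (poly p (x $ 3)))))"
        by (simp add: mult_ac)
      then show ?thesis using that by simp
    qed
    fix k
    let ?q = "leg_poly (k + j) j"
    have "?q \<noteq> 0"
    proof
      assume "?q = 0"
      then have "leg_int ((- X2) ^ j * (?q * ?q)) = 0" by (simp add: leg_int_def)
      then show False using leg_int_leg_poly[of j "k + j" "k + j"] by simp
    qed
    moreover have "degree ?q = k"
      using \<open>?q \<noteq> 0\<close> by (auto simp: leg_poly_def degree_rodrigues)
    ultimately show "\<exists>q. (\<integral>x. f x * (w x * of_real (poly q (x $ 3))) \<partial>\<sigma>) = 0 \<and> q \<noteq> 0 \<and> degree q = k"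
      using leg[of "k + j"] by auto
  qed
  have coeff': "(\<integral>x. f x * ((if m < 0 then (- zeta x) ^ nat \<bar>m\<bar> else cnj (zeta x) ^ nat \<bar>m\<bar>)
       * of_real (poly (leg_poly l (nat \<bar>m\<bar>)) (x $ 3))) \<partial>\<sigma>) = 0" if "nat \<bar>m\<bar> \<le> l" for l m
  proof -
    have "sph_coeff f l m = (\<integral>x. f x * ((if m < 0 then (- zeta x) ^ nat \<bar>m\<bar> else cnj (zeta x) ^ nat \<bar>m\<bar>)
       * of_real (poly (leg_poly l (nat \<bar>m\<bar>)) (x $ 3))) \<partial>\<sigma>)"
      unfolding sph_coeff_def
      by (rule Bochner_Integration.integral_cong) (use sph_harm_on_sphere[OF that] in auto)
    then show ?thesis using coeff[OF that] by simp
  qed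
  show ?thesis using g
  proof induction
    case (pos j p)
    show ?case
    proof (rule all[where j=j])
      show "(\<integral>x. f x * (zeta x ^ j * of_real (poly (leg_poly l j) (x $ 3))) \<partial>\<sigma>) = 0" if "j \<le> l" for l
      proof (cases "j = 0")
        case True
        then show ?thesis using coeff'[of 0 l] by simp
      next
        case False
        have "(\<integral>x. (-1) ^ j * (f x * (zeta x ^ j * of_real (poly (leg_poly l j) (x $ 3)))) \<partial>\<sigma>) = 0"
          using coeff'[of "- int j" l] that False by (simp add: power_minus[of "zeta _"] mult_ac)
        then show ?thesis by simp
      qed
    qed (intro continuous_intros continuous_zeta)
  next
    case (neg j p)
    show ?case
    proof (rule all[where j=j])
      show "(\<integral>x. f x * (cnj (zeta x) ^ j * of_real (poly (leg_poly l j) (x $ 3))) \<partial>\<sigma>) = 0" if "j \<le> l" for l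
        using coeff'[of "int j" l] that by simp
    qed (intro continuous_intros continuous_zeta)
  next
    case (add g h)
    then show ?case
      using Bochner_Integration.integral_add[OF integrable_times_continuous integrable_times_continuous, OF f _ f, of g h]
        continuous_sphere_polynomial by (simp add: distrib_left)
  next
    case (scale g c)
    then show ?case by (simp add: mult.left_commute[of _ c])
  next
    case (cong g h)
    have "(\<integral>x. f x * h x \<partial>\<sigma>) = (\<integral>x. f x * g x \<partial>\<sigma>)"
      by (rule Bochner_Integration.integral_cong) (use cong in auto)
    then show ?case using cong by simp
  qed
qed

text \<open>
  Polynomials determine an integrable function on a compact set, and every polynomial restricts to a combination
  of harmonics.
\<close>

lemma sph_harm_complete:
  assumes f: "integrable \<sigma> f"
    and coeff: "\<And>l m. nat \<bar>m\<bar> \<le> l \<Longrightarrow> sph_coeff f l m = 0"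
  shows "AE x in \<sigma>. f x = 0"
proof -
  have S: "sphere 0 1 \<in> sets (borel :: (real^3) measure)" by (intro borel_closed closed_sphere)
  have id: "(\<lambda>x. x) \<in> \<sigma> \<rightarrow>\<^sub>M borel"
  proof -
    have "(\<lambda>x. x) \<in> restrict_space borel (sphere 0 1) \<rightarrow>\<^sub>M (borel :: (real^3) measure)"
      by (rule measurable_restrict_space1) simp
    then show ?thesis by (simp only: measurable_cong_sets[OF sets_sphere refl])
  qed
  define f' where "f' x = (if x \<in> sphere 0 1 then f x else 0)" for x
  have f': "f' \<in> borel_measurable borel"
  proof -
    have "f \<in> borel_measurable (restrict_space borel (sphere 0 1))"
      using borel_measurable_integrable[OF f] by (simp only: measurable_cong_sets[OF sets_sphere refl])
    then have "(\<lambda>x. indicator (sphere 0 1) x *\<^sub>R f x) \<in> borel_measurable borel"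
      using borel_measurable_restrict_space_iff[of "sphere 0 1" borel f] S by simp
    moreover have "f' = (\<lambda>x. indicator (sphere 0 1) x *\<^sub>R f x)" by (auto simp: f'_def indicator_def)
    ultimately show ?thesis by simp
  qed
  have "AE x in distr \<sigma> borel (\<lambda>x. x). f' x = 0"
  proof (rule AE_eq_0_if_orthogonal_to_polynomials[where K="sphere 0 1"])
    show "AE x in distr \<sigma> borel (\<lambda>x. x). x \<in> sphere 0 1"
      by (subst AE_distr_iff[OF id]) (auto intro: AE_I2)
    have "integrable \<sigma> f'"
      by (rule Bochner_Integration.integrable_cong[THEN iffD1, OF refl _ f]) (simp add: f'_def)
    then show "integrable (distr \<sigma> borel (\<lambda>x. x)) f'"
      by (subst integrable_distr_eq[OF id f'])
    fix p :: "real^3 \<Rightarrow> real" assume p: "real_polynomial_function p"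
    have pm: "p \<in> borel_measurable borel"
      using p continuous_on_polymonial_function[of p UNIV] real_polynomial_function_eq[of p]
      by (intro borel_measurable_continuous_onI) simp
    have one: "sphere_polynomial (\<lambda>x. 1)"
      using sphere_polynomial.pos[of 0 1] by simp
    have "(\<integral>x. f' x * of_real (p x) \<partial>distr \<sigma> borel (\<lambda>x. x)) = (\<integral>x. f' x * of_real (p x) \<partial>\<sigma>)"
      by (rule integral_distr[OF id]) (use pm f' in auto)
    also have "\<dots> = (\<integral>x. f x * (of_real (p x) * 1) \<partial>\<sigma>)"
      by (rule Bochner_Integration.integral_cong) (auto simp: f'_def)
    also have "\<dots> = 0"
      using orthogonal_to_sphere_polynomials[OF f coeff sphere_polynomial_times_real_polynomial[OF p one]] by simp
    finally show "(\<integral>x. f' x * of_real (p x) \<partial>distr \<sigma> borel (\<lambda>x. x)) = 0" .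
  qed auto
  then have "AE x in \<sigma>. f' x = 0"
    by (subst (asm) AE_distr_iff[OF id]) (use f' in auto)
  moreover have "AE x in \<sigma>. x \<in> sphere 0 1" by (rule AE_I2) simp
  ultimately show ?thesis by eventually_elim (simp add: f'_def)
qed

section \<open>Mean-square expansions on the sphere\<close>

lemma L2D: assumes "f \<in> L2_sphere"
  shows "f \<in> borel_measurable \<sigma>" "integrable \<sigma> (\<lambda>x. (cmod (f x))\<^sup>2)"
  using assms by (auto simp: L2_sphere_def)

lemma L2_prod_integrable:
  assumes "f \<in> L2_sphere" "g \<in> L2_sphere"
  shows "integrable \<sigma> (\<lambda>x. f x * g x)"
proof (rule Bochner_Integration.integrable_bound[of \<sigma> "\<lambda>x. (cmod (f x))\<^sup>2 + (cmod (g x))\<^sup>2"])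
  show "AE x in \<sigma>. norm (f x * g x) \<le> norm ((cmod (f x))\<^sup>2 + (cmod (g x))\<^sup>2)"
  proof (rule AE_I2)
    fix x
    have "2 * (cmod (f x) * cmod (g x)) \<le> (cmod (f x))\<^sup>2 + (cmod (g x))\<^sup>2"
      using sum_squares_bound[of "cmod (f x)" "cmod (g x)"] by simp
    moreover have "0 \<le> cmod (f x) * cmod (g x)" by simp
    ultimately have "cmod (f x) * cmod (g x) \<le> (cmod (f x))\<^sup>2 + (cmod (g x))\<^sup>2" by linarith
    then show "norm (f x * g x) \<le> norm ((cmod (f x))\<^sup>2 + (cmod (g x))\<^sup>2)"
      by (simp add: norm_mult)
  qed
qed (use assms L2D in auto)

lemma L2_const: "(\<lambda>_. c) \<in> L2_sphere"
  by (simp add: L2_sphere_def)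

lemma L2_integrable: "f \<in> L2_sphere \<Longrightarrow> integrable \<sigma> f"
  using L2_prod_integrable[OF _ L2_const[of 1]] by simp

lemma L2_cnj: assumes "f \<in> L2_sphere" shows "(\<lambda>x. cnj (f x)) \<in> L2_sphere"
proof -
  have "continuous_on UNIV cnj" by (intro continuous_intros)
  from measurable_compose[OF L2D(1)[OF assms] borel_measurable_continuous_onI[OF this]]
  show ?thesis using assms by (simp add: L2_sphere_def)
qed

lemma L2_scale: "f \<in> L2_sphere \<Longrightarrow> (\<lambda>x. c * f x) \<in> L2_sphere"
  by (auto simp: L2_sphere_def norm_mult power_mult_distrib)

lemma L2_add: assumes "f \<in> L2_sphere" "g \<in> L2_sphere" shows "(\<lambda>x. f x + g x) \<in> L2_sphere"
proof -
  have "integrable \<sigma> (\<lambda>x. (cmod (f x + g x))\<^sup>2)"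
  proof (rule Bochner_Integration.integrable_bound[of \<sigma> "\<lambda>x. 2 * (cmod (f x))\<^sup>2 + 2 * (cmod (g x))\<^sup>2"])
    show "AE x in \<sigma>. norm ((cmod (f x + g x))\<^sup>2) \<le> norm (2 * (cmod (f x))\<^sup>2 + 2 * (cmod (g x))\<^sup>2)"
    proof (rule AE_I2)
      fix x
      have "(cmod (f x + g x))\<^sup>2 \<le> (cmod (f x) + cmod (g x))\<^sup>2"
        by (intro power_mono norm_triangle_ineq) simp
      also have "\<dots> \<le> 2 * (cmod (f x))\<^sup>2 + 2 * (cmod (g x))\<^sup>2"
        using sum_squares_bound[of "cmod (f x)" "cmod (g x)"] by (simp add: power2_sum)
      finally show "norm ((cmod (f x + g x))\<^sup>2) \<le> norm (2 * (cmod (f x))\<^sup>2 + 2 * (cmod (g x))\<^sup>2)" by simp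
    qed
  qed (use assms L2D in auto)
  then show ?thesis using assms by (auto simp: L2_sphere_def)
qed

lemma L2_diff: "f \<in> L2_sphere \<Longrightarrow> g \<in> L2_sphere \<Longrightarrow> (\<lambda>x. f x - g x) \<in> L2_sphere"
  using L2_add[of f "\<lambda>x. (-1) * g x"] L2_scale[of g "-1"] by simp

lemma L2_sum: "(\<And>i. i \<in> I \<Longrightarrow> f i \<in> L2_sphere) \<Longrightarrow> (\<lambda>x. \<Sum>i\<in>I. f i x) \<in> L2_sphere"
  by (induction I rule: infinite_finite_induct) (auto intro: L2_add L2_const)

lemma L2_cong_AE:
  assumes "f \<in> L2_sphere" "g \<in> borel_measurable \<sigma>" "AE x in \<sigma>. f x = g x"
  shows "g \<in> L2_sphere"
proof -
  have "integrable \<sigma> (\<lambda>x. (cmod (g x))\<^sup>2)"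
    by (rule integrable_cong_AE[THEN iffD1, OF _ _ _ L2D(2)[OF assms(1)]])
       (use assms L2D in auto)
  then show ?thesis using assms by (simp add: L2_sphere_def)
qed

lemma L2_norm_cong_AE: "f \<in> borel_measurable \<sigma> \<Longrightarrow> g \<in> borel_measurable \<sigma> \<Longrightarrow> AE x in \<sigma>. f x = g x \<Longrightarrow> L2_norm f = L2_norm g"
  unfolding L2_norm_def by (intro arg_cong[of _ _ sqrt] integral_cong_AE) auto

lemma L2_norm_nonneg: "0 \<le> L2_norm f"
  by (simp add: L2_norm_def)

lemma L2_norm_square: "(L2_norm f)\<^sup>2 = (\<integral>x. (cmod (f x))\<^sup>2 \<partial>\<sigma>)"
  by (simp add: L2_norm_def)

lemma L2_norm_nn: "f \<in> L2_sphere \<Longrightarrow> ennreal ((L2_norm f)\<^sup>2) = (\<integral>\<^sup>+x. ennreal ((cmod (f x))\<^sup>2) \<partial>\<sigma>)"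
  unfolding L2_norm_square by (subst nn_integral_eq_integral) (use L2D in auto)

lemma L2_Cauchy_Schwarz_abs:
  assumes f: "f \<in> L2_sphere" and g: "g \<in> L2_sphere"
  shows "(\<integral>x. cmod (f x) * cmod (g x) \<partial>\<sigma>) \<le> L2_norm f * L2_norm g"
proof -
  have i: "integrable \<sigma> (\<lambda>x. cmod (f x) * cmod (g x))"
    using integrable_norm[OF L2_prod_integrable[OF f g]] by (simp add: norm_mult)
  have m [measurable]: "f \<in> borel_measurable \<sigma>" "g \<in> borel_measurable \<sigma>" using f g L2D by auto
  have "(\<integral>\<^sup>+x. ennreal (cmod (f x)) * ennreal (cmod (g x)) \<partial>\<sigma>)\<^sup>2
     \<le> (\<integral>\<^sup>+x. (ennreal (cmod (f x)))\<^sup>2 \<partial>\<sigma>) * (\<integral>\<^sup>+x. (ennreal (cmod (g x)))\<^sup>2 \<partial>\<sigma>)"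
    by (rule Cauchy_Schwarz_nn_integral) auto
  also have "\<dots> = ennreal ((L2_norm f)\<^sup>2) * ennreal ((L2_norm g)\<^sup>2)"
    unfolding L2_norm_nn[OF f] L2_norm_nn[OF g] by (simp add: ennreal_power)
  also have "(\<integral>\<^sup>+x. ennreal (cmod (f x)) * ennreal (cmod (g x)) \<partial>\<sigma>) = ennreal (\<integral>x. cmod (f x) * cmod (g x) \<partial>\<sigma>)"
    using i by (subst nn_integral_eq_integral[symmetric]) (auto simp: ennreal_mult)
  finally have "(\<integral>x. cmod (f x) * cmod (g x) \<partial>\<sigma>)\<^sup>2 \<le> (L2_norm f * L2_norm g)\<^sup>2"
    by (simp add: ennreal_power ennreal_mult[symmetric] power_mult_distrib)
  then show ?thesis by (rule power2_le_imp_le) (simp add: L2_norm_nonneg)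
qed

lemma L2_Cauchy_Schwarz:
  assumes f: "f \<in> L2_sphere" and g: "g \<in> L2_sphere"
  shows "cmod (\<integral>x. f x * g x \<partial>\<sigma>) \<le> L2_norm f * L2_norm g"
  using integral_norm_bound[of \<sigma> "\<lambda>x. f x * g x"] L2_Cauchy_Schwarz_abs[OF f g]
  by (simp add: norm_mult)

lemma L2_norm_triangle:
  assumes f: "f \<in> L2_sphere" and g: "g \<in> L2_sphere"
  shows "L2_norm (\<lambda>x. f x + g x) \<le> L2_norm f + L2_norm g"
proof (rule power2_le_imp_le)
  have i: "integrable \<sigma> (\<lambda>x. cmod (f x) * cmod (g x))"
    using integrable_norm[OF L2_prod_integrable[OF f g]] by (simp add: norm_mult)
  have "(L2_norm (\<lambda>x. f x + g x))\<^sup>2 \<le> (\<integral>x. (cmod (f x))\<^sup>2 + (cmod (g x))\<^sup>2 + 2 * (cmod (f x) * cmod (g x)) \<partial>\<sigma>)"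
    unfolding L2_norm_square
  proof (rule integral_mono)
    show "(cmod (f x + g x))\<^sup>2 \<le> (cmod (f x))\<^sup>2 + (cmod (g x))\<^sup>2 + 2 * (cmod (f x) * cmod (g x))" for x
    proof -
      have "(cmod (f x + g x))\<^sup>2 \<le> (cmod (f x) + cmod (g x))\<^sup>2"
        by (intro power_mono norm_triangle_ineq) simp
      then show ?thesis by (simp add: power2_sum)
    qed
  qed (use L2D[OF L2_add[OF f g]] L2D[OF f] L2D[OF g] i in auto)
  also have "\<dots> = (L2_norm f)\<^sup>2 + (L2_norm g)\<^sup>2 + 2 * (\<integral>x. cmod (f x) * cmod (g x) \<partial>\<sigma>)"
    unfolding L2_norm_square using L2D[OF f] L2D[OF g] i by simp
  also have "\<dots> \<le> (L2_norm f + L2_norm g)\<^sup>2"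
    using L2_Cauchy_Schwarz_abs[OF f g] by (simp add: power2_sum)
  finally show "(L2_norm (\<lambda>x. f x + g x))\<^sup>2 \<le> (L2_norm f + L2_norm g)\<^sup>2" .
qed (simp add: L2_norm_nonneg)

lemma L2_norm_triangle_diff:
  assumes "f \<in> L2_sphere" "g \<in> L2_sphere" "h \<in> L2_sphere"
  shows "L2_norm (\<lambda>x. f x - h x) \<le> L2_norm (\<lambda>x. f x - g x) + L2_norm (\<lambda>x. g x - h x)"
  using L2_norm_triangle[OF L2_diff[OF assms(1,2)] L2_diff[OF assms(2,3)]] by simp

lemma L2_norm_minus_commute: "L2_norm (\<lambda>x. f x - g x) = L2_norm (\<lambda>x. g x - f x)"
  by (simp add: L2_norm_def norm_minus_commute)

lemma L2_norm_le_diff: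
  assumes "f \<in> L2_sphere" "g \<in> L2_sphere"
  shows "L2_norm f \<le> L2_norm g + L2_norm (\<lambda>x. f x - g x)"
  using L2_norm_triangle[OF assms(2) L2_diff[OF assms]] by simp

definition sph_idx :: "nat \<Rightarrow> (nat \<times> int) set" where
  "sph_idx n = Sigma {..n} (\<lambda>l. {- int l..int l})"

lemma finite_sph_idx [simp]: "finite (sph_idx n)"
  by (simp add: sph_idx_def)

lemma sph_idx_iff: "(l, m) \<in> sph_idx n \<longleftrightarrow> l \<le> n \<and> nat \<bar>m\<bar> \<le> l"
  by (auto simp: sph_idx_def)

lemma sph_partial_sum_idx: "sph_partial_sum c n x = (\<Sum>p\<in>sph_idx n. c (fst p) (snd p) * sph_harm (fst p) (snd p) x)"
  unfolding sph_partial_sum_def sph_idx_def by (subst sum.Sigma) (auto simp: case_prod_beta')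

lemma sph_harm_L2: assumes "nat \<bar>m\<bar> \<le> l" shows "sph_harm l m \<in> L2_sphere"
proof -
  have "integrable \<sigma> (\<lambda>x. of_real ((cmod (sph_harm l m x))\<^sup>2) :: complex)"
  proof -
    have "continuous_on (sphere 0 1) (\<lambda>x. of_real ((cmod (sph_harm l m x))\<^sup>2) :: complex)"
      by (intro continuous_on_of_real continuous_on_power continuous_on_norm continuous_sph_harm[OF assms])
    from integrable_times_continuous[OF integrable_sphere_const this] show ?thesis by simp
  qed
  then have "integrable \<sigma> (\<lambda>x. Re (of_real ((cmod (sph_harm l m x))\<^sup>2)))" by (rule integrable_Re)
  then show ?thesis
    using borel_measurable_sphere_continuous[OF continuous_sph_harm[OF assms]] by (simp add: L2_sphere_def)
qed

lemma sph_partial_sum_L2: "sph_partial_sum c n \<in> L2_sphere"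
proof -
  have "(\<lambda>x. \<Sum>p\<in>sph_idx n. c (fst p) (snd p) * sph_harm (fst p) (snd p) x) \<in> L2_sphere"
    by (intro L2_sum L2_scale sph_harm_L2) (auto simp: sph_idx_def)
  then show ?thesis by (simp add: sph_partial_sum_idx[abs_def])
qed

lemma sph_coeff_integrable: "f \<in> L2_sphere \<Longrightarrow> nat \<bar>m\<bar> \<le> l \<Longrightarrow> integrable \<sigma> (\<lambda>x. f x * cnj (sph_harm l m x))"
  by (intro L2_prod_integrable L2_cnj sph_harm_L2)

lemma sph_coeff_diff:
  assumes "f \<in> L2_sphere" "g \<in> L2_sphere" "nat \<bar>m\<bar> \<le> l"
  shows "sph_coeff (\<lambda>x. f x - g x) l m = sph_coeff f l m - sph_coeff g l m"
  unfolding sph_coeff_def using sph_coeff_integrable[OF _ assms(3)] assms by (simp add: left_diff_distrib)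

lemma sph_harm_norm: assumes "nat \<bar>m\<bar> \<le> l" shows "L2_norm (sph_harm l m) = 1"
proof -
  have "complex_of_real (\<integral>x. (cmod (sph_harm l m x))\<^sup>2 \<partial>\<sigma>) = (\<integral>x. sph_harm l m x * cnj (sph_harm l m x) \<partial>\<sigma>)"
    unfolding integral_complex_of_real[symmetric] by (simp only: complex_norm_square)
  also have "\<dots> = 1" using sph_harm_orthonormal[OF assms assms] by simp
  finally show ?thesis unfolding L2_norm_def by simp
qed

lemma sph_coeff_bound:
  assumes "f \<in> L2_sphere" "nat \<bar>m\<bar> \<le> l" shows "cmod (sph_coeff f l m) \<le> L2_norm f"
proof -
  have "L2_norm (\<lambda>x. cnj (sph_harm l m x)) = 1" using sph_harm_norm[OF assms(2)] by (simp add: L2_norm_def)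
  then show ?thesis
    using L2_Cauchy_Schwarz[OF assms(1) L2_cnj[OF sph_harm_L2[OF assms(2)]]] by (simp add: sph_coeff_def)
qed

lemma sph_coeff_finite_sum:
  assumes "finite A" "A \<subseteq> {(l, m). nat \<bar>m\<bar> \<le> l}" "nat \<bar>m\<bar> \<le> l"
  shows "sph_coeff (\<lambda>x. \<Sum>p\<in>A. c p * sph_harm (fst p) (snd p) x) l m = (if (l, m) \<in> A then c (l, m) else 0)"
proof -
  have "sph_coeff (\<lambda>x. \<Sum>p\<in>A. c p * sph_harm (fst p) (snd p) x) l m
     = (\<Sum>p\<in>A. c p * (\<integral>x. sph_harm (fst p) (snd p) x * cnj (sph_harm l m x) \<partial>\<sigma>))"
    unfolding sph_coeff_def sum_distrib_right mult.assoc
  proof (subst Bochner_Integration.integral_sum)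
    fix p assume "p \<in> A"
    then have "nat \<bar>snd p\<bar> \<le> fst p" using assms(2) by auto
    then show "integrable \<sigma> (\<lambda>x. c p * (sph_harm (fst p) (snd p) x * cnj (sph_harm l m x)))"
      by (intro integrable_mult_right sph_coeff_integrable sph_harm_L2 assms)
  qed simp
  also have "\<dots> = (\<Sum>p\<in>A. if p = (l, m) then c (l, m) else 0)"
  proof (rule sum.cong[OF refl])
    fix p assume "p \<in> A"
    then have "nat \<bar>snd p\<bar> \<le> fst p" using assms(2) by auto
    from sph_harm_orthonormal[OF this assms(3)]
    show "c p * (\<integral>x. sph_harm (fst p) (snd p) x * cnj (sph_harm l m x) \<partial>\<sigma>) = (if p = (l, m) then c (l, m) else 0)"
      by (cases p) auto
  qed
  also have "\<dots> = (if (l, m) \<in> A then c (l, m) else 0)" using assms(1) by (simp add: sum.delta')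
  finally show ?thesis .
qed

lemma sph_coeff_partial_sum:
  assumes "nat \<bar>m\<bar> \<le> l" shows "sph_coeff (sph_partial_sum c n) l m = (if l \<le> n then c l m else 0)"
  using sph_coeff_finite_sum[of "sph_idx n" m l "\<lambda>p. c (fst p) (snd p)"] assms
  by (auto simp: sph_partial_sum_idx[abs_def] sph_idx_iff subset_iff)

lemma L2_norm_finite_sum:
  assumes "finite A" "A \<subseteq> {(l, m). nat \<bar>m\<bar> \<le> l}"
  shows "(L2_norm (\<lambda>x. \<Sum>p\<in>A. c p * sph_harm (fst p) (snd p) x))\<^sup>2 = (\<Sum>p\<in>A. (cmod (c p))\<^sup>2)"
proof -
  let ?g = "\<lambda>x. \<Sum>p\<in>A. c p * sph_harm (fst p) (snd p) x"
  have v: "nat \<bar>snd p\<bar> \<le> fst p" if "p \<in> A" for p using assms(2) that by auto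
  have g: "?g \<in> L2_sphere" using v by (intro L2_sum L2_scale sph_harm_L2)
  have "complex_of_real ((L2_norm ?g)\<^sup>2) = (\<integral>x. ?g x * cnj (?g x) \<partial>\<sigma>)"
    unfolding L2_norm_square integral_complex_of_real[symmetric] by (simp only: complex_norm_square)
  also have "\<dots> = (\<Sum>p\<in>A. cnj (c p) * sph_coeff ?g (fst p) (snd p))"
  proof -
    have "(\<integral>x. ?g x * cnj (?g x) \<partial>\<sigma>) = (\<integral>x. (\<Sum>p\<in>A. cnj (c p) * (?g x * cnj (sph_harm (fst p) (snd p) x))) \<partial>\<sigma>)"
      by (intro Bochner_Integration.integral_cong) (auto simp: sum_distrib_left cnj_sum mult_ac)
    also have "\<dots> = (\<Sum>p\<in>A. \<integral>x. cnj (c p) * (?g x * cnj (sph_harm (fst p) (snd p) x)) \<partial>\<sigma>)"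
      by (rule Bochner_Integration.integral_sum) (intro integrable_mult_right sph_coeff_integrable g v)
    finally show ?thesis by (simp add: sph_coeff_def)
  qed
  also have "\<dots> = (\<Sum>p\<in>A. complex_of_real ((cmod (c p))\<^sup>2))"
  proof (rule sum.cong[OF refl])
    fix p assume p: "p \<in> A"
    then have "(fst p, snd p) \<in> A" by simp
    then have "sph_coeff ?g (fst p) (snd p) = c p"
      using sph_coeff_finite_sum[OF assms v[OF p], of c] by simp
    then show "cnj (c p) * sph_coeff ?g (fst p) (snd p) = complex_of_real ((cmod (c p))\<^sup>2)"
      by (simp only: complex_norm_square mult.commute)
  qed
  also have "\<dots> = complex_of_real (\<Sum>p\<in>A. (cmod (c p))\<^sup>2)" by simp
  finally show ?thesis by (simp only: of_real_eq_iff)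
qed

text \<open>
  The energy in degree \<open>l\<close> of a family of coefficients that need not yet belong to a function.
\<close>

definition coeff_power :: "(nat \<Rightarrow> int \<Rightarrow> complex) \<Rightarrow> nat \<Rightarrow> real" where
  "coeff_power c l = (\<Sum>m = - int l..int l. (cmod (c l m))\<^sup>2)"

lemma coeff_power_nonneg: "0 \<le> coeff_power c l"
  by (simp add: coeff_power_def sum_nonneg)

lemma sph_power_coeff: "sph_power f = coeff_power (sph_coeff f)"
  by (auto simp: sph_power_def coeff_power_def)

lemma L2_norm_partial_sum_diff:
  assumes "n \<le> k"
  shows "(L2_norm (\<lambda>x. sph_partial_sum c k x - sph_partial_sum c n x))\<^sup>2 = (\<Sum>l\<in>{n<..k}. coeff_power c l)"
proof -
  let ?A = "Sigma {n<..k} (\<lambda>l. {- int l..int l})"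
  have u: "sph_idx k = sph_idx n \<union> ?A" "sph_idx n \<inter> ?A = {}" using assms by (auto simp: sph_idx_def)
  have "(\<lambda>x. sph_partial_sum c k x - sph_partial_sum c n x) = (\<lambda>x. \<Sum>p\<in>?A. c (fst p) (snd p) * sph_harm (fst p) (snd p) x)"
    by (rule ext) (simp only: sph_partial_sum_idx u(1), subst sum.union_disjoint, auto simp: sph_idx_def)
  moreover have "(L2_norm (\<lambda>x. \<Sum>p\<in>?A. c (fst p) (snd p) * sph_harm (fst p) (snd p) x))\<^sup>2 = (\<Sum>p\<in>?A. (cmod (c (fst p) (snd p)))\<^sup>2)"
    by (rule L2_norm_finite_sum[of ?A "\<lambda>p. c (fst p) (snd p)"]) auto
  ultimately have "(L2_norm (\<lambda>x. sph_partial_sum c k x - sph_partial_sum c n x))\<^sup>2 = (\<Sum>p\<in>?A. (cmod (c (fst p) (snd p)))\<^sup>2)"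
    by simp
  also have "\<dots> = (\<Sum>l\<in>{n<..k}. coeff_power c l)"
    unfolding coeff_power_def by (subst sum.Sigma) (auto simp: case_prod_beta')
  finally show ?thesis .
qed

lemma L2_norm_partial_sum: "(L2_norm (sph_partial_sum c n))\<^sup>2 = (\<Sum>l\<le>n. coeff_power c l)"
proof -
  have "(L2_norm (sph_partial_sum c n))\<^sup>2 = (\<Sum>p\<in>sph_idx n. (cmod (c (fst p) (snd p)))\<^sup>2)"
    unfolding sph_partial_sum_idx[abs_def]
    by (rule L2_norm_finite_sum[of "sph_idx n" "\<lambda>p. c (fst p) (snd p)"]) (auto simp: sph_idx_iff)
  also have "\<dots> = (\<Sum>l\<le>n. coeff_power c l)"
    unfolding coeff_power_def sph_idx_def by (subst sum.Sigma) (auto simp: case_prod_beta')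
  finally show ?thesis .
qed

lemma coeff_tail_bound:
  assumes dom: "\<And>l. coeff_power c l \<le> A l" and A: "summable A" and nk: "n \<le> k"
  shows "(L2_norm (\<lambda>x. sph_partial_sum c k x - sph_partial_sum c n x))\<^sup>2 \<le> (\<Sum>l. A (l + Suc n))"
proof -
  have A0: "0 \<le> A l" for l using coeff_power_nonneg dom order_trans by blast
  have "(\<Sum>l\<in>{n<..k}. coeff_power c l) \<le> (\<Sum>l\<in>{n<..k}. A l)" by (intro sum_mono dom)
  also have "\<dots> = (\<Sum>l<k - n. A (l + Suc n))"
    by (rule sum.reindex_bij_witness[where i="\<lambda>l. l + Suc n" and j="\<lambda>l. l - Suc n"]) (use nk in auto)
  also have "\<dots> \<le> (\<Sum>l. A (l + Suc n))"
    by (rule sum_le_suminf) (use A A0 in \<open>auto simp: summable_iff_shift simp del: add_Suc_right\<close>)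
  finally show ?thesis unfolding L2_norm_partial_sum_diff[OF nk] .
qed

text \<open>
  The rate is \<open>1/4\<close> because the tails bound squared norms: the norms themselves then decay like
  \<open>2\<^bsup>-k\<^esup>\<close> and are summable.
\<close>

lemma exists_fast_subsequence:
  fixes A :: "nat \<Rightarrow> real"
  assumes "summable A"
  obtains r where "strict_mono r" "\<And>k. (\<Sum>l. A (l + Suc (r k))) \<le> (1 / 4) ^ k"
proof -
  have "(\<lambda>n. \<Sum>l. A (l + Suc n)) \<longlonglongrightarrow> 0"
    using LIMSEQ_Suc[OF suminf_exist_split2[OF assms]] .
  then have "\<forall>\<^sub>F n in sequentially. (\<Sum>l. A (l + Suc n)) < (1 / 4) ^ k" for k
    by (rule order_tendstoD) simp
  then have "\<exists>N. \<forall>n\<ge>N. (\<Sum>l. A (l + Suc n)) < (1 / 4) ^ k" for k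
    by (simp add: eventually_sequentially)
  then obtain N where N: "\<And>k n. N k \<le> n \<Longrightarrow> (\<Sum>l. A (l + Suc n)) < (1 / 4) ^ k" by metis
  define r where "r k = (\<Sum>i\<le>k. Suc (N i))" for k
  have "strict_mono r" by (rule strict_mono_Suc_iff[THEN iffD2]) (simp add: r_def)
  moreover have "N k \<le> r k" for k
  proof -
    have "Suc (N k) \<le> r k" unfolding r_def by (rule member_le_sum) auto
    then show ?thesis by simp
  qed
  ultimately show thesis using N by (intro that[of r]) (auto intro: less_imp_le)
qed

text \<open>
  Completeness of \<open>L\<^sup>2\<close> with an explicit limit. The subsequence \<open>r\<close> depends only
  on the dominating sequence \<open>A\<close>, so for coefficients that depend on time but are dominated
  uniformly the same \<open>r\<close> works at all times, and the pointwise limit inherits joint measurability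
  from the partial sums.

  Along \<open>r\<close>, the \<open>L\<^sup>1\<close>-norms of the increments are summable, whence the partial
  sums converge almost everywhere; Fatou's lemma transfers the bound on the \<open>L\<^sup>2\<close>-tails to
  the limit.
\<close>

lemma Riesz_Fischer:
  assumes dom: "\<And>l. coeff_power c l \<le> A l" and A: "summable A"
    and r: "strict_mono r" and tail: "\<And>k. (\<Sum>l. A (l + Suc (r k))) \<le> (1 / 4) ^ k"
  shows "sph_sums c (\<lambda>x. lim (\<lambda>k. sph_partial_sum c (r k) x))"
proof -
  let ?S = "sph_partial_sum c"
  define g where "g x = lim (\<lambda>k. ?S (r k) x)" for x
  have Sm [measurable]: "?S n \<in> borel_measurable \<sigma>" for n using L2D[OF sph_partial_sum_L2] by auto
  have gm [measurable]: "g \<in> borel_measurable \<sigma>" unfolding g_def by measurable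
  define D where "D k x = ?S (r (Suc k)) x - ?S (r k) x" for k x
  have DL2: "D k \<in> L2_sphere" for k unfolding D_def by (intro L2_diff sph_partial_sum_L2)
  then have Dm [measurable]: "D k \<in> borel_measurable \<sigma>" for k using L2D by auto
  define C where "C = L2_norm (\<lambda>_. 1)"
  have Dint: "(\<integral>x. cmod (D k x) \<partial>\<sigma>) \<le> C * (1 / 2) ^ k" for k
  proof -
    have "r k \<le> r (Suc k)" using strict_monoD[OF r, of k "Suc k"] by simp
    from coeff_tail_bound[OF dom A this] tail[of k] have "(L2_norm (D k))\<^sup>2 \<le> (1 / 4) ^ k"
      unfolding D_def by linarith
    also have "\<dots> = ((1 / 2) ^ k)\<^sup>2" by (simp add: power2_eq_square power_mult_distrib[symmetric])
    finally have "L2_norm (D k) \<le> (1 / 2) ^ k" by (rule power2_le_imp_le) simp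
    then have "L2_norm (D k) * C \<le> (1 / 2) ^ k * C" by (rule mult_right_mono) (simp add: C_def L2_norm_nonneg)
    then show ?thesis using L2_Cauchy_Schwarz_abs[OF DL2 L2_const[of 1], of k] by (simp add: C_def mult.commute)
  qed
  have "AE x in \<sigma>. (\<Sum>k. ennreal (cmod (D k x))) \<noteq> \<infinity>"
  proof (rule nn_integral_PInf_AE)
    have "(\<integral>\<^sup>+x. (\<Sum>k. ennreal (cmod (D k x))) \<partial>\<sigma>) = (\<Sum>k. \<integral>\<^sup>+x. ennreal (cmod (D k x)) \<partial>\<sigma>)"
      by (rule nn_integral_suminf) auto
    also have "\<dots> \<le> (\<Sum>k. ennreal (C * (1 / 2) ^ k))"
    proof (intro suminf_le)
      fix k
      have "(\<integral>\<^sup>+x. ennreal (cmod (D k x)) \<partial>\<sigma>) = ennreal (\<integral>x. cmod (D k x) \<partial>\<sigma>)"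
        by (rule nn_integral_eq_integral) (use L2_integrable[OF DL2] in auto)
      then show "(\<integral>\<^sup>+x. ennreal (cmod (D k x)) \<partial>\<sigma>) \<le> ennreal (C * (1 / 2) ^ k)"
        using Dint[of k] by (simp add: ennreal_leI)
    qed auto
    also have "\<dots> = ennreal (\<Sum>k. C * (1 / 2) ^ k)"
      by (rule suminf_ennreal2) (auto simp: C_def L2_norm_nonneg intro!: summable_mult)
    finally show "(\<integral>\<^sup>+x. (\<Sum>k. ennreal (cmod (D k x))) \<partial>\<sigma>) \<noteq> \<infinity>" by (auto simp: top_unique)
  qed simp
  then have lim: "AE x in \<sigma>. (\<lambda>k. ?S (r k) x) \<longlonglongrightarrow> g x"
  proof eventually_elim
    case (elim x)
    then have "summable (\<lambda>k. cmod (D k x))" by (intro summable_suminf_not_top) auto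
    then have "summable (\<lambda>k. D k x)" by (rule summable_norm_cancel)
    then have "convergent (\<lambda>n. \<Sum>k<n. D k x)" by (simp add: summable_iff_convergent)
    moreover have "(\<lambda>n. \<Sum>k<n. D k x) = (\<lambda>n. ?S (r n) x - ?S (r 0) x)"
      unfolding D_def by (rule ext) (rule sum_lessThan_telescope)
    ultimately have "convergent (\<lambda>n. ?S (r n) x - ?S (r 0) x)" by simp
    then have "convergent (\<lambda>n. ?S (r n) x)" by (simp add: convergent_diff_const_right_iff)
    then show ?case unfolding g_def by (simp add: convergent_LIMSEQ_iff)
  qed
  have fatou: "(\<integral>\<^sup>+x. ennreal ((cmod (g x - ?S n x))\<^sup>2) \<partial>\<sigma>) \<le> ennreal (\<Sum>l. A (l + Suc n))" for n
  proof -
    have "(\<integral>\<^sup>+x. ennreal ((cmod (g x - ?S n x))\<^sup>2) \<partial>\<sigma>) = (\<integral>\<^sup>+x. liminf (\<lambda>k. ennreal ((cmod (?S (r k) x - ?S n x))\<^sup>2)) \<partial>\<sigma>)"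
    proof (rule nn_integral_cong_AE)
      show "AE x in \<sigma>. ennreal ((cmod (g x - ?S n x))\<^sup>2) = liminf (\<lambda>k. ennreal ((cmod (?S (r k) x - ?S n x))\<^sup>2))"
        using lim
      proof eventually_elim
        case (elim x)
        have "(\<lambda>k. ennreal ((cmod (?S (r k) x - ?S n x))\<^sup>2)) \<longlonglongrightarrow> ennreal ((cmod (g x - ?S n x))\<^sup>2)"
          by (intro tendsto_ennrealI tendsto_intros elim)
        from lim_imp_Liminf[OF _ this] show ?case by simp
      qed
    qed
    also have "\<dots> \<le> liminf (\<lambda>k. \<integral>\<^sup>+x. ennreal ((cmod (?S (r k) x - ?S n x))\<^sup>2) \<partial>\<sigma>)"
      by (rule nn_integral_liminf) auto
    also have "\<dots> \<le> limsup (\<lambda>k. \<integral>\<^sup>+x. ennreal ((cmod (?S (r k) x - ?S n x))\<^sup>2) \<partial>\<sigma>)"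
      by (rule Liminf_le_Limsup) simp
    also have "\<dots> \<le> ennreal (\<Sum>l. A (l + Suc n))"
    proof (rule Limsup_bounded)
      show "\<forall>\<^sub>F k in sequentially. (\<integral>\<^sup>+x. ennreal ((cmod (?S (r k) x - ?S n x))\<^sup>2) \<partial>\<sigma>) \<le> ennreal (\<Sum>l. A (l + Suc n))"
        unfolding eventually_sequentially
      proof (intro exI allI impI)
        fix k assume "n \<le> k"
        then have "n \<le> r k" using seq_suble[OF r, of k] by simp
        from coeff_tail_bound[OF dom A this]
        show "(\<integral>\<^sup>+x. ennreal ((cmod (?S (r k) x - ?S n x))\<^sup>2) \<partial>\<sigma>) \<le> ennreal (\<Sum>l. A (l + Suc n))"
          unfolding L2_norm_nn[OF L2_diff[OF sph_partial_sum_L2 sph_partial_sum_L2], symmetric] by (rule ennreal_leI)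
      qed
    qed
    finally show ?thesis .
  qed
  have gS: "(\<lambda>x. g x - ?S n x) \<in> L2_sphere" for n
  proof -
    have "integrable \<sigma> (\<lambda>x. (cmod (g x - ?S n x))\<^sup>2)"
      by (rule integrableI_bounded) (use fatou[of n] in \<open>auto simp: le_less_trans\<close>)
    then show ?thesis by (simp add: L2_sphere_def)
  qed
  have gL2: "g \<in> L2_sphere" using L2_add[OF gS[of 0] sph_partial_sum_L2[of c 0]] by simp
  have A0: "0 \<le> A l" for l using coeff_power_nonneg dom order_trans by blast
  have T0: "0 \<le> (\<Sum>l. A (l + Suc n))" for n
    by (rule suminf_nonneg) (use A A0 in \<open>auto simp: summable_iff_shift simp del: add_Suc_right\<close>)
  have b: "L2_norm (\<lambda>x. g x - ?S n x) \<le> sqrt (\<Sum>l. A (l + Suc n))" for n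
  proof (rule real_le_rsqrt)
    have "ennreal ((L2_norm (\<lambda>x. g x - ?S n x))\<^sup>2) \<le> ennreal (\<Sum>l. A (l + Suc n))"
      unfolding L2_norm_nn[OF gS] by (rule fatou)
    then show "(L2_norm (\<lambda>x. g x - ?S n x))\<^sup>2 \<le> (\<Sum>l. A (l + Suc n))"
      using T0[of n] by (simp only: ennreal_le_iff)
  qed
  have "(\<lambda>n. sqrt (\<Sum>l. A (l + Suc n))) \<longlonglongrightarrow> sqrt 0"
    by (intro tendsto_real_sqrt LIMSEQ_Suc[OF suminf_exist_split2[OF A]])
  then have lim0: "(\<lambda>n. sqrt (\<Sum>l. A (l + Suc n))) \<longlonglongrightarrow> 0" by simp
  have "(\<lambda>n. L2_norm (\<lambda>x. g x - ?S n x)) \<longlonglongrightarrow> 0"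
    by (rule tendsto_sandwich[OF always_eventually always_eventually tendsto_const lim0]) (use b L2_norm_nonneg in auto)
  then show ?thesis using gL2 unfolding sph_sums_def g_def by simp
qed

lemma sph_sums_exists:
  assumes "summable (coeff_power c)" obtains g where "sph_sums c g"
proof -
  obtain r where "strict_mono r" "\<And>k. (\<Sum>l. coeff_power c (l + Suc (r k))) \<le> (1 / 4) ^ k"
    using exists_fast_subsequence[OF assms] by blast
  from that[OF Riesz_Fischer[OF order_refl assms this]] show thesis .
qed

lemma sph_sums_coeff:
  assumes g: "sph_sums c g" and m: "nat \<bar>m\<bar> \<le> l" shows "sph_coeff g l m = c l m"
proof -
  have gL: "g \<in> L2_sphere" and lim: "(\<lambda>n. L2_norm (\<lambda>x. g x - sph_partial_sum c n x)) \<longlonglongrightarrow> 0"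
    using g by (auto simp: sph_sums_def)
  have "cmod (sph_coeff g l m - c l m) \<le> L2_norm (\<lambda>x. g x - sph_partial_sum c n x)" if "l \<le> n" for n
    using sph_coeff_bound[OF L2_diff[OF gL sph_partial_sum_L2] m, of c n] that
    unfolding sph_coeff_diff[OF gL sph_partial_sum_L2 m] sph_coeff_partial_sum[OF m] by simp
  then have "cmod (sph_coeff g l m - c l m) \<le> 0"
    by (intro LIMSEQ_le_const[OF lim]) blast
  then show ?thesis by simp
qed

lemma sph_sums_norm:
  assumes g: "sph_sums c g" shows "coeff_power c sums (L2_norm g)\<^sup>2"
proof -
  have gL: "g \<in> L2_sphere" and lim: "(\<lambda>n. L2_norm (\<lambda>x. g x - sph_partial_sum c n x)) \<longlonglongrightarrow> 0"
    using g by (auto simp: sph_sums_def)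
  have b: "norm (L2_norm (sph_partial_sum c n) - L2_norm g) \<le> L2_norm (\<lambda>x. g x - sph_partial_sum c n x)" for n
    using L2_norm_le_diff[OF gL sph_partial_sum_L2, of c n] L2_norm_le_diff[OF sph_partial_sum_L2 gL, of c n]
    unfolding L2_norm_minus_commute[of "sph_partial_sum c n" g] by simp
  have "(\<lambda>n. L2_norm (sph_partial_sum c n) - L2_norm g) \<longlonglongrightarrow> 0"
    by (rule Lim_null_comparison[OF _ lim]) (use b in \<open>simp add: always_eventually\<close>)
  then have "(\<lambda>n. L2_norm (sph_partial_sum c n)) \<longlonglongrightarrow> L2_norm g" by (simp add: LIM_zero_iff)
  then have "(\<lambda>n. (L2_norm (sph_partial_sum c n))\<^sup>2) \<longlonglongrightarrow> (L2_norm g)\<^sup>2" by (intro tendsto_intros)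
  then show ?thesis unfolding L2_norm_partial_sum by (simp add: sums_def_le)
qed

lemma sph_sums_cong_AE:
  assumes "sph_sums c g" "h \<in> borel_measurable \<sigma>" "AE x in \<sigma>. g x = h x"
  shows "sph_sums c h"
proof -
  have gL: "g \<in> L2_sphere" using assms by (simp add: sph_sums_def)
  have "L2_norm (\<lambda>x. g x - sph_partial_sum c n x) = L2_norm (\<lambda>x. h x - sph_partial_sum c n x)" for n
    by (rule L2_norm_cong_AE) (use assms L2D[OF gL] L2D[OF sph_partial_sum_L2[of c n]] in auto)
  then show ?thesis using assms L2_cong_AE[OF gL assms(2,3)] by (simp add: sph_sums_def)
qed

lemma L2_eq_AE_if_coeffs_eq:
  assumes "f \<in> L2_sphere" "g \<in> L2_sphere" "\<And>l m. nat \<bar>m\<bar> \<le> l \<Longrightarrow> sph_coeff f l m = sph_coeff g l m"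
  shows "AE x in \<sigma>. f x = g x"
proof -
  have "AE x in \<sigma>. f x - g x = 0"
    by (rule sph_harm_complete[OF L2_integrable[OF L2_diff[OF assms(1,2)]]]) (use assms sph_coeff_diff in auto)
  then show ?thesis by simp
qed

text \<open>
  Pairing \<open>f\<close> with its own partial sum gives the squared norm of that sum, which is at most the
  product of the norms.
\<close>

lemma Bessel: assumes "f \<in> L2_sphere" shows "summable (sph_power f)"
proof (rule bounded_imp_summable)
  fix n
  let ?S = "sph_partial_sum (sph_coeff f) n"
  have "complex_of_real (\<Sum>l\<le>n. sph_power f l) = (\<integral>x. f x * cnj (?S x) \<partial>\<sigma>)"
  proof -
    have "(\<integral>x. f x * cnj (?S x) \<partial>\<sigma>) = (\<integral>x. (\<Sum>p\<in>sph_idx n. cnj (sph_coeff f (fst p) (snd p)) * (f x * cnj (sph_harm (fst p) (snd p) x))) \<partial>\<sigma>)"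
      by (intro Bochner_Integration.integral_cong) (auto simp: sph_partial_sum_idx sum_distrib_left cnj_sum mult_ac)
    also have "\<dots> = (\<Sum>p\<in>sph_idx n. \<integral>x. cnj (sph_coeff f (fst p) (snd p)) * (f x * cnj (sph_harm (fst p) (snd p) x)) \<partial>\<sigma>)"
    proof (rule Bochner_Integration.integral_sum)
      fix p assume "p \<in> sph_idx n"
      then have "nat \<bar>snd p\<bar> \<le> fst p" by (cases p) (simp add: sph_idx_iff)
      then show "integrable \<sigma> (\<lambda>x. cnj (sph_coeff f (fst p) (snd p)) * (f x * cnj (sph_harm (fst p) (snd p) x)))"
        by (intro integrable_mult_right sph_coeff_integrable assms)
    qed
    also have "\<dots> = (\<Sum>p\<in>sph_idx n. of_real ((cmod (sph_coeff f (fst p) (snd p)))\<^sup>2))"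
      by (simp only: integral_mult_right_zero sph_coeff_def[symmetric] complex_norm_square mult.commute)
    also have "\<dots> = complex_of_real (\<Sum>l\<le>n. sph_power f l)"
      unfolding sph_power_def sph_idx_def by (subst sum.Sigma) (auto simp: case_prod_beta')
    finally show ?thesis ..
  qed
  also have "cmod \<dots> \<le> L2_norm f * L2_norm (\<lambda>x. cnj (?S x))"
    by (rule L2_Cauchy_Schwarz[OF assms L2_cnj[OF sph_partial_sum_L2]])
  also have "L2_norm (\<lambda>x. cnj (?S x)) = L2_norm ?S" by (simp add: L2_norm_def)
  finally have "(L2_norm ?S)\<^sup>2 \<le> L2_norm f * L2_norm ?S"
    unfolding L2_norm_partial_sum sph_power_coeff[symmetric] norm_of_real by linarith
  then have "L2_norm ?S \<le> L2_norm f"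
    using L2_norm_nonneg[of ?S] L2_norm_nonneg[of f] by (cases "L2_norm ?S = 0") (auto simp: power2_eq_square)
  then have "(L2_norm ?S)\<^sup>2 \<le> (L2_norm f)\<^sup>2" by (rule power_mono) (rule L2_norm_nonneg)
  then show "(\<Sum>l\<le>n. sph_power f l) \<le> (L2_norm f)\<^sup>2"
    unfolding L2_norm_partial_sum sph_power_coeff[symmetric] .
qed (simp add: sph_power_coeff coeff_power_nonneg)

lemma sph_sums_self: assumes f: "f \<in> L2_sphere" shows "sph_sums (sph_coeff f) f"
proof -
  obtain g where g: "sph_sums (sph_coeff f) g"
    using sph_sums_exists[of "sph_coeff f"] Bessel[OF f] unfolding sph_power_coeff by blast
  have "AE x in \<sigma>. g x = f x"
    by (rule L2_eq_AE_if_coeffs_eq) (use g f sph_sums_coeff[OF g] in \<open>auto simp: sph_sums_def\<close>)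
  from sph_sums_cong_AE[OF g L2D(1)[OF f] this] show ?thesis .
qed

lemma Parseval: "f \<in> L2_sphere \<Longrightarrow> sph_power f sums (L2_norm f)\<^sup>2"
  using sph_sums_norm[OF sph_sums_self] unfolding sph_power_coeff .

lemma sph_sums_suminf: "summable (coeff_power c) \<Longrightarrow> sph_sums c (sph_suminf c)"
  unfolding sph_suminf_def by (metis sph_sums_exists someI)

section \<open>Levy measures and their tails\<close>

locale levy_measure =
  fixes \<nu> :: "real measure"
  assumes levy: "subordinator_levy_measure \<nu>"
begin

lemma sets_levy [measurable_cong]: "sets \<nu> = sets borel"
  using levy by (simp add: subordinator_levy_measure_def)

lemma AE_levy_pos: "AE y in \<nu>. 0 < y"
proof (rule AE_I)
  show "{x \<in> space \<nu>. \<not> 0 < x} \<subseteq> {..0}" by auto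
  show "emeasure \<nu> {..0} = 0" using levy by (simp add: subordinator_levy_measure_def)
qed simp

text \<open>
  Markov's inequality for the integrable function \<open>min 1 t\<close>.
\<close>

lemma emeasure_levy_tail: assumes "0 < t" shows "emeasure \<nu> {t<..} < \<infinity>"
proof -
  have "emeasure \<nu> {t<..} * ennreal (min 1 t) = (\<integral>\<^sup>+y. ennreal (min 1 t) * indicator {t<..} y \<partial>\<nu>)"
    by (simp add: nn_integral_cmult mult.commute)
  also have "\<dots> \<le> (\<integral>\<^sup>+y. ennreal (min 1 y) \<partial>\<nu>)"
    by (rule nn_integral_mono) (auto simp: indicator_def intro!: ennreal_leI)
  also have "\<dots> < \<infinity>" using levy by (simp add: subordinator_levy_measure_def)
  finally show ?thesis using assms by (auto simp: ennreal_mult_less_top)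
qed

lemma sigma_finite_levy: "sigma_finite_measure \<nu>"
proof
  let ?A = "insert {..0} (range (\<lambda>n. {1 / real (Suc n)<..}))"
  have "y \<in> \<Union> ?A" for y
  proof (cases "y \<le> 0")
    case False
    then obtain n where "1 / real (Suc n) < y" using nat_approx_posE[of y] by auto
    then show ?thesis by auto
  qed auto
  then have "\<Union> ?A = space \<nu>" using sets_eq_imp_space_eq[OF sets_levy] by auto
  moreover have "emeasure \<nu> a \<noteq> \<infinity>" if "a \<in> ?A" for a
  proof -
    have "emeasure \<nu> {1 / real (Suc n)<..} \<noteq> \<infinity>" for n
      using emeasure_levy_tail[of "1 / real (Suc n)"] by simp
    then show ?thesis using that levy by (auto simp: subordinator_levy_measure_def simp del: of_nat_Suc)
  qed
  moreover have "?A \<subseteq> sets \<nu>" by auto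
  moreover have "countable ?A" by simp
  ultimately show "\<exists>A. countable A \<and> A \<subseteq> sets \<nu> \<and> \<Union> A = space \<nu> \<and> (\<forall>a\<in>A. emeasure \<nu> a \<noteq> \<infinity>)" by blast
qed

sublocale nu: sigma_finite_measure \<nu> by (rule sigma_finite_levy)

lemma levy_tail_nonneg: "0 \<le> levy_tail \<nu> t"
  by (simp add: levy_tail_def)

lemma ennreal_levy_tail: "0 < t \<Longrightarrow> ennreal (levy_tail \<nu> t) = emeasure \<nu> {t<..}"
  unfolding levy_tail_def using emeasure_levy_tail[of t] by (simp add: emeasure_eq_ennreal_measure)

lemma emeasure_tail_integral: "emeasure \<nu> {t<..} = (\<integral>\<^sup>+y. (if t < y then 1 else 0) \<partial>\<nu>)"
proof -
  have "emeasure \<nu> {t<..} = (\<integral>\<^sup>+y. indicator {t<..} y \<partial>\<nu>)" by simp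
  also have "\<dots> = (\<integral>\<^sup>+y. (if t < y then 1 else 0) \<partial>\<nu>)"
    by (intro nn_integral_cong) (auto simp: indicator_def)
  finally show ?thesis .
qed

lemma measurable_levy_tail [measurable]: "levy_tail \<nu> \<in> borel_measurable borel"
proof -
  have "(\<lambda>t. enn2real (\<integral>\<^sup>+y. (if t < y then 1 else 0) \<partial>\<nu>)) \<in> borel_measurable (borel :: real measure)"
    by measurable
  then show ?thesis by (simp add: levy_tail_def[abs_def] measure_def emeasure_tail_integral)
qed

lemma integrable_min_levy: "integrable \<nu> (\<lambda>y. min 1 y)"
proof (rule integrableI_bounded)
  have "(\<integral>\<^sup>+y. ennreal (norm (min 1 y)) \<partial>\<nu>) = (\<integral>\<^sup>+y. ennreal (min 1 y) \<partial>\<nu>)"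
    using AE_levy_pos by (intro nn_integral_cong_AE) auto
  then show "(\<integral>\<^sup>+y. ennreal (norm (min 1 y)) \<partial>\<nu>) < \<infinity>"
    using levy by (simp add: subordinator_levy_measure_def)
qed simp

lemma one_minus_exp_bound: fixes q y :: real assumes "0 \<le> q" "0 < y" shows "0 \<le> 1 - exp (- q * y)" "1 - exp (- q * y) \<le> max 1 q * min 1 y"
proof -
  have "0 \<le> q * y" using assms by (intro mult_nonneg_nonneg) auto
  then show "0 \<le> 1 - exp (- q * y)" by simp
  have "1 - exp (- q * y) \<le> q * y" using exp_ge_add_one_self[of "- q * y"] by linarith
  also have "\<dots> \<le> max 1 q * y" using assms by (intro mult_right_mono) auto
  finally have 1: "1 - exp (- q * y) \<le> max 1 q * y" .
  have "1 - exp (- q * y) \<le> 1" by simp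
  also have "\<dots> \<le> max 1 q" by simp
  finally show "1 - exp (- q * y) \<le> max 1 q * min 1 y" using 1 by (cases "y \<le> 1") auto
qed

lemma integrable_laplace_exponent: assumes "0 \<le> q" shows "integrable \<nu> (\<lambda>y. 1 - exp (- q * y))"
proof (rule Bochner_Integration.integrable_bound[of \<nu> "\<lambda>y. max 1 q * min 1 y"])
  show "AE y in \<nu>. norm (1 - exp (- q * y)) \<le> norm (max 1 q * min 1 y)"
    using AE_levy_pos
  proof eventually_elim
    case (elim y)
    then show ?case using one_minus_exp_bound[OF assms elim] by simp
  qed
qed (use integrable_min_levy in auto)

lemma laplace_exponent_nn:
  assumes "0 \<le> q" shows "ennreal (laplace_exponent \<nu> q) = (\<integral>\<^sup>+y. ennreal (1 - exp (- q * y)) \<partial>\<nu>)"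
  unfolding laplace_exponent_def
  by (rule nn_integral_eq_integral[symmetric, OF integrable_laplace_exponent[OF assms]])
     (use AE_levy_pos assms in \<open>auto elim: eventually_mono\<close>)

lemma laplace_exponent_nonneg: assumes "0 \<le> q" shows "0 \<le> laplace_exponent \<nu> q"
  unfolding laplace_exponent_def
  by (rule integral_nonneg_AE) (use AE_levy_pos assms in \<open>auto elim: eventually_mono\<close>)

text \<open>
  The mass of \<open>\<nu>\<close> is infinite and \<open>1 - e\<^bsup>-ny\<^esup>\<close> tends to
  \<open>1\<close> on \<open>(0,\<infinity>)\<close>, so by Fatou's lemma a bound for the exponents would bound
  the mass.
\<close>

lemma laplace_exponent_unbounded: "\<exists>n::nat. C < laplace_exponent \<nu> (real n)"
proof (rule ccontr)
  assume "\<not> ?thesis"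
  then have le: "laplace_exponent \<nu> (real n) \<le> C" for n by (simp add: not_less)
  have "emeasure \<nu> {0<..} = (\<integral>\<^sup>+y. liminf (\<lambda>n. ennreal (1 - exp (- real n * y))) \<partial>\<nu>)"
  proof -
    have "emeasure \<nu> {0<..} = (\<integral>\<^sup>+y. indicator {0<..} y \<partial>\<nu>)" by simp
    also have "\<dots> = (\<integral>\<^sup>+y. liminf (\<lambda>n. ennreal (1 - exp (- real n * y))) \<partial>\<nu>)"
    proof (rule nn_integral_cong_AE)
      show "AE y in \<nu>. indicator {0<..} y = liminf (\<lambda>n. ennreal (1 - exp (- real n * y)))"
        using AE_levy_pos
      proof eventually_elim
        case (elim y)
        have e: "(\<lambda>n. exp (- real n * y)) = (\<lambda>n. exp (- y) ^ n)"
          by (simp add: exp_of_nat_mult[symmetric])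
        have "(\<lambda>n. exp (- real n * y)) \<longlonglongrightarrow> 0"
          unfolding e using elim by (intro LIMSEQ_power_zero) simp
        then have "(\<lambda>n. ennreal (1 - exp (- real n * y))) \<longlonglongrightarrow> ennreal (1 - 0)"
          by (intro tendsto_ennrealI tendsto_intros)
        from lim_imp_Liminf[OF _ this] elim show ?case by simp
      qed
    qed
    finally show ?thesis .
  qed
  also have "\<dots> \<le> liminf (\<lambda>n. \<integral>\<^sup>+y. ennreal (1 - exp (- real n * y)) \<partial>\<nu>)"
    by (rule nn_integral_liminf) auto
  also have "\<dots> \<le> limsup (\<lambda>n. \<integral>\<^sup>+y. ennreal (1 - exp (- real n * y)) \<partial>\<nu>)"
    by (rule Liminf_le_Limsup) simp
  also have "\<dots> \<le> ennreal C"
    unfolding laplace_exponent_nn[OF of_nat_0_le_iff, symmetric]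
    by (rule Limsup_bounded) (use le in \<open>simp add: ennreal_leI\<close>)
  finally show False using levy by (simp add: subordinator_levy_measure_def top_unique)
qed

lemma laplace_exponent_pos: assumes "0 < q" shows "0 < laplace_exponent \<nu> q"
proof (rule ccontr)
  assume "\<not> ?thesis"
  then have "laplace_exponent \<nu> q = 0" using laplace_exponent_nonneg[of q] assms by simp
  then have "AE y in \<nu>. 1 - exp (- q * y) = 0"
    unfolding laplace_exponent_def
    by (subst (asm) integral_nonneg_eq_0_iff_AE)
       (use integrable_laplace_exponent[of q] AE_levy_pos assms in \<open>auto elim: eventually_mono\<close>)
  with AE_levy_pos have "AE y in \<nu>. False" by eventually_elim (use assms in auto)
  then have "emeasure \<nu> (space \<nu>) = 0" by (simp add: AE_iff_null null_sets_def)
  moreover have "emeasure \<nu> {0<..} \<le> emeasure \<nu> (space \<nu>)" by (rule emeasure_space)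
  ultimately show False using levy by (simp add: subordinator_levy_measure_def)
qed

lemma nn_integral_exp_interval:
  assumes "0 < q" "0 < y"
  shows "(\<integral>\<^sup>+t. ennreal (exp (- q * t)) * indicator {0..y} t \<partial>lborel) = ennreal ((1 - exp (- q * y)) / q)"
proof -
  have "(\<integral>\<^sup>+t. ennreal (exp (- q * t)) * indicator {0..y} t \<partial>lborel) = ennreal (- exp (- q * y) / q - - exp (- q * 0) / q)"
    by (rule nn_integral_FTC_Icc) (use assms in \<open>auto intro!: derivative_eq_intros\<close>)
  then show ?thesis by (simp add: field_simps diff_divide_distrib)
qed

text \<open>
  Tonelli's theorem:
  \<open>\<integral> e\<^bsup>-qt\<^esup> \<nu>(t,\<infinity>) dt = \<integral> (1 - e\<^bsup>-qy\<^esup>) / q \<nu>(dy)\<close>.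
\<close>

lemma laplace_tail_nn:
  assumes q: "0 < q"
  shows "(\<integral>\<^sup>+t. ennreal (indicator {0..} t * (exp (- q * t) * levy_tail \<nu> t)) \<partial>lborel) = ennreal (laplace_exponent \<nu> q / q)"
proof -
  interpret pair_sigma_finite lborel \<nu> ..
  have "(\<integral>\<^sup>+t. ennreal (indicator {0..} t * (exp (- q * t) * levy_tail \<nu> t)) \<partial>lborel)
      = (\<integral>\<^sup>+t. (\<integral>\<^sup>+y. ennreal (exp (- q * t)) * (if 0 < t \<and> t < y then 1 else 0) \<partial>\<nu>) \<partial>lborel)"
  proof (rule nn_integral_cong_AE)
    \<comment> \<open>At \<open>t = 0\<close> the tail is infinite while \<open>levy_tail\<close> takes the default value \<open>0\<close>.\<close>
    have "AE t in lborel. t \<noteq> (0::real)" by (rule AE_lborel_singleton)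
    then show "AE t in lborel. ennreal (indicator {0..} t * (exp (- q * t) * levy_tail \<nu> t))
        = (\<integral>\<^sup>+y. ennreal (exp (- q * t)) * (if 0 < t \<and> t < y then 1 else 0) \<partial>\<nu>)"
    proof eventually_elim
      case (elim t)
      show ?case
      proof (cases "0 < t")
        case True
        then show ?thesis
          by (simp add: ennreal_mult levy_tail_nonneg ennreal_levy_tail emeasure_tail_integral nn_integral_cmult)
      qed (use elim in auto)
    qed
  qed
  also have "\<dots> = (\<integral>\<^sup>+y. (\<integral>\<^sup>+t. ennreal (exp (- q * t)) * (if 0 < t \<and> t < y then 1 else 0) \<partial>lborel) \<partial>\<nu>)"
    by (rule Fubini'[symmetric]) measurable
  also have "\<dots> = (\<integral>\<^sup>+y. ennreal (1 - exp (- q * y)) * ennreal (1 / q) \<partial>\<nu>)"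
  proof (rule nn_integral_cong_AE)
    show "AE y in \<nu>. (\<integral>\<^sup>+t. ennreal (exp (- q * t)) * (if 0 < t \<and> t < y then 1 else 0) \<partial>lborel) = ennreal (1 - exp (- q * y)) * ennreal (1 / q)"
      using AE_levy_pos
    proof eventually_elim
      case (elim y)
      have "(\<integral>\<^sup>+t. ennreal (exp (- q * t)) * (if 0 < t \<and> t < y then 1 else 0) \<partial>lborel)
         = (\<integral>\<^sup>+t. ennreal (exp (- q * t)) * indicator {0..y} t \<partial>lborel)"
      proof (rule nn_integral_cong_AE)
        have "AE t in lborel. t \<noteq> 0" "AE t in lborel. t \<noteq> y" by (rule AE_lborel_singleton)+
        then show "AE t in lborel. ennreal (exp (- q * t)) * (if 0 < t \<and> t < y then 1 else 0) = ennreal (exp (- q * t)) * indicator {0..y} t"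
          by eventually_elim (auto simp: indicator_def)
      qed
      also have "\<dots> = ennreal (1 - exp (- q * y)) * ennreal (1 / q)"
        unfolding nn_integral_exp_interval[OF q elim] using q elim by (simp add: ennreal_mult[symmetric])
      finally show ?case .
    qed
  qed
  also have "\<dots> = ennreal (laplace_exponent \<nu> q) * ennreal (1 / q)"
    using q by (simp add: nn_integral_multc laplace_exponent_nn)
  also have "\<dots> = ennreal (laplace_exponent \<nu> q / q)"
    using q laplace_exponent_nonneg[of q] by (simp add: ennreal_mult[symmetric])
  finally show ?thesis .
qed

text \<open>
  The tail extended by \<open>0\<close> to negative times, so that convolutions on the half line become
  integrals over the whole line.
\<close>

definition tail_kernel :: "real \<Rightarrow> complex" where
  "tail_kernel t = of_real (indicator {0..} t * levy_tail \<nu> t)"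

lemma measurable_tail_kernel [measurable]: "tail_kernel \<in> borel_measurable borel"
  unfolding tail_kernel_def by measurable

lemma laplace_tail_kernel:
  assumes q: "0 < q"
  shows "integrable lborel (\<lambda>t. exp (- q * t) *\<^sub>R tail_kernel t)"
    and "(\<integral>t. exp (- q * t) *\<^sub>R tail_kernel t \<partial>lborel) = of_real (laplace_exponent \<nu> q / q)"
proof -
  let ?f = "\<lambda>t. indicator {0..} t * (exp (- q * t) * levy_tail \<nu> t)"
  have 0: "0 \<le> ?f t" for t using levy_tail_nonneg by simp
  have i: "integrable lborel ?f"
    by (rule integrableI_nonneg) (use laplace_tail_nn[OF q] 0 in auto)
  have "ennreal (\<integral>t. ?f t \<partial>lborel) = ennreal (laplace_exponent \<nu> q / q)"
    unfolding laplace_tail_nn[OF q, symmetric] by (rule nn_integral_eq_integral[symmetric, OF i]) (use 0 in simp)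
  then have v: "(\<integral>t. ?f t \<partial>lborel) = laplace_exponent \<nu> q / q"
    using q laplace_exponent_nonneg[of q] by (subst (asm) ennreal_inj) (auto intro!: integral_nonneg_AE simp: levy_tail_nonneg)
  have e: "(\<lambda>t. exp (- q * t) *\<^sub>R tail_kernel t) = (\<lambda>t. of_real (?f t))"
    by (auto simp: tail_kernel_def scaleR_conv_of_real)
  show "integrable lborel (\<lambda>t. exp (- q * t) *\<^sub>R tail_kernel t)"
    unfolding e using i by (simp only: integrable_of_real)
  show "(\<integral>t. exp (- q * t) *\<^sub>R tail_kernel t \<partial>lborel) = of_real (laplace_exponent \<nu> q / q)"
    unfolding e integral_complex_of_real v ..
qed

lemma tail_kernel_integrable: "integrable lborel (\<lambda>t. indicator {..T} t *\<^sub>R tail_kernel t)"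
proof (rule Bochner_Integration.integrable_bound)
  show "integrable lborel (\<lambda>t. exp \<bar>T\<bar> *\<^sub>R (exp (- 1 * t) *\<^sub>R tail_kernel t))"
    by (intro integrable_scaleR_right laplace_tail_kernel) simp
  show "AE t in lborel. norm (indicator {..T} t *\<^sub>R tail_kernel t) \<le> norm (exp \<bar>T\<bar> *\<^sub>R (exp (- 1 * t) *\<^sub>R tail_kernel t))"
  proof (rule AE_I2)
    fix t :: real
    have "1 \<le> exp \<bar>T\<bar> * exp (- t)" if "t \<le> T" using that by (simp add: exp_add[symmetric])
    from mult_right_mono[OF this, of "norm (tail_kernel t)"]
    show "norm (indicator {..T} t *\<^sub>R tail_kernel t) \<le> norm (exp \<bar>T\<bar> *\<^sub>R (exp (- 1 * t) *\<^sub>R tail_kernel t))"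
      by (auto simp: indicator_def)
  qed
qed simp

end

section \<open>The scalar Volterra equation\<close>

lemma lborel_integral_translate:
  fixes f :: "real \<Rightarrow> 'a::{banach, second_countable_topology}"
  shows "(\<integral>r. f (r - a) \<partial>lborel) = (\<integral>r. f r \<partial>lborel)"
  using lborel_integral_real_affine[of 1 "\<lambda>r. f (r - a)" a] by simp

lemma lborel_integrable_translate:
  fixes f :: "real \<Rightarrow> 'a::{banach, second_countable_topology}"
  shows "integrable lborel f \<Longrightarrow> integrable lborel (\<lambda>r. f (r - a))"
  using lborel_integrable_real_affine[of f 1 "- a"] by simp

lemma lborel_integral_reflect:
  fixes f :: "real \<Rightarrow> 'a::{banach, second_countable_topology}"
  shows "(\<integral>r. f (a - r) \<partial>lborel) = (\<integral>r. f r \<partial>lborel)"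
  using lborel_integral_real_affine[of "-1" "\<lambda>r. f (a - r)" a] by simp

lemma lborel_integrable_reflect:
  fixes f :: "real \<Rightarrow> 'a::{banach, second_countable_topology}"
  shows "integrable lborel f \<Longrightarrow> integrable lborel (\<lambda>r. f (a - r))"
  using lborel_integrable_real_affine[of f "-1" "a"] by simp

text \<open>
  A complex measure on \<open>[0,\<infinity>)\<close>, namely the image under \<open>X\<close> of the measure
  with density \<open>b\<close> with respect to \<open>N\<close>. Only its Laplace transform is assumed to
  converge; its total variation may be infinite, although it is finite on bounded sets.
\<close>

locale weighted_shift = sigma_finite_measure N
  for N :: "'n measure" +
  fixes X :: "'n \<Rightarrow> real" and b :: "'n \<Rightarrow> complex"
  assumes X_measurable [measurable]: "X \<in> borel_measurable N"
    and b_measurable [measurable]: "b \<in> borel_measurable N"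
    and X_nonneg: "\<And>n. n \<in> space N \<Longrightarrow> 0 \<le> X n"
    and laplace_integrable: "\<And>q. 0 < q \<Longrightarrow> integrable N (\<lambda>n. exp (- q * X n) *\<^sub>R b n)"
begin

sublocale pair: pair_sigma_finite N lborel ..

lemma integrable_weight: "integrable N (\<lambda>n. indicator {..T} (X n) *\<^sub>R b n)"
proof (rule Bochner_Integration.integrable_bound)
  show "integrable N (\<lambda>n. exp \<bar>T\<bar> *\<^sub>R (exp (- 1 * X n) *\<^sub>R b n))"
    by (intro integrable_scaleR_right laplace_integrable) simp
  show "AE n in N. norm (indicator {..T} (X n) *\<^sub>R b n) \<le> norm (exp \<bar>T\<bar> *\<^sub>R (exp (- 1 * X n) *\<^sub>R b n))"
  proof (rule AE_I2)
    fix n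
    have "1 \<le> exp \<bar>T\<bar> * exp (- X n)" if "X n \<le> T" using that by (simp add: exp_add[symmetric])
    from mult_right_mono[OF this, of "norm (b n)"]
    show "norm (indicator {..T} (X n) *\<^sub>R b n) \<le> norm (exp \<bar>T\<bar> *\<^sub>R (exp (- 1 * X n) *\<^sub>R b n))"
      by (auto simp: indicator_def)
  qed
qed simp

text \<open>
  Convolution of the complex measure with a function.
\<close>

definition wconv :: "(real \<Rightarrow> complex) \<Rightarrow> real \<Rightarrow> complex" where
  "wconv k r = (\<integral>n. b n * k (r - X n) \<partial>N)"

lemma measurable_wconv [measurable]:
  assumes [measurable]: "k \<in> borel_measurable borel" shows "wconv k \<in> borel_measurable borel"
proof -
  have "(\<lambda>r. \<integral>n. b n * k (r - X n) \<partial>N) \<in> borel_measurable (borel :: real measure)"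
    by (rule borel_measurable_lebesgue_integral) measurable
  then show ?thesis by (simp add: wconv_def[abs_def])
qed

lemma wconv_neg:
  assumes "\<And>t. t < 0 \<Longrightarrow> k t = 0" "r < 0" shows "wconv k r = 0"
proof -
  have "wconv k r = (\<integral>n. 0 \<partial>N)"
    unfolding wconv_def by (rule Bochner_Integration.integral_cong) (use assms X_nonneg in force)+
  then show ?thesis by simp
qed

lemma laplace_wconv:
  assumes k [measurable]: "k \<in> borel_measurable borel" and q: "0 < q"
    and int: "integrable lborel (\<lambda>t. exp (- q * t) *\<^sub>R k t)"
  shows "integrable lborel (\<lambda>r. exp (- q * r) *\<^sub>R wconv k r)"
    and "(\<integral>r. exp (- q * r) *\<^sub>R wconv k r \<partial>lborel) = (\<integral>n. exp (- q * X n) *\<^sub>R b n \<partial>N) * (\<integral>t. exp (- q * t) *\<^sub>R k t \<partial>lborel)"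
proof -
  define e where "e t = exp (- q * t) *\<^sub>R k t" for t
  have [measurable]: "e \<in> borel_measurable borel" unfolding e_def by measurable
  define F where "F n r = (exp (- q * X n) *\<^sub>R b n) * e (r - X n)" for n r
  have F: "F n r = exp (- q * r) *\<^sub>R (b n * k (r - X n))" for n r
  proof -
    have "exp (- q * X n) * exp (- q * (r - X n)) = exp (- q * r)"
      by (simp add: exp_add[symmetric] algebra_simps)
    then show ?thesis unfolding F_def e_def by (simp add: mult.commute)
  qed
  have Fm: "case_prod F \<in> borel_measurable (N \<Otimes>\<^sub>M lborel)" unfolding F_def by measurable
  have intF: "integrable (N \<Otimes>\<^sub>M lborel) (case_prod F)"
  proof (rule pair.Fubini_integrable[OF Fm])
    have "(\<lambda>n. \<integral>r. norm (case_prod F (n, r)) \<partial>lborel) = (\<lambda>n. norm (exp (- q * X n) *\<^sub>R b n) * (\<integral>t. norm (e t) \<partial>lborel))"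
      unfolding F_def case_prod_conv norm_mult using lborel_integral_translate[of "\<lambda>t. norm (e t)"] by simp
    then show "integrable N (\<lambda>n. \<integral>r. norm (case_prod F (n, r)) \<partial>lborel)"
      using integrable_norm[OF laplace_integrable[OF q]] by simp
    show "AE n in N. integrable lborel (\<lambda>r. case_prod F (n, r))"
      unfolding F_def case_prod_conv using lborel_integrable_translate[OF int]
      by (intro AE_I2 integrable_mult_right) (simp add: e_def)
  qed
  have r: "(\<integral>n. F n r \<partial>N) = exp (- q * r) *\<^sub>R wconv k r" for r
    unfolding F wconv_def by simp
  show "integrable lborel (\<lambda>r. exp (- q * r) *\<^sub>R wconv k r)"
    unfolding r[symmetric] by (rule pair.integrable_snd[OF intF])
  have "(\<integral>r. exp (- q * r) *\<^sub>R wconv k r \<partial>lborel) = (\<integral>n. \<integral>r. F n r \<partial>lborel \<partial>N)"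
    unfolding r[symmetric] by (rule pair.Fubini_integral[OF intF])
  also have "\<dots> = (\<integral>n. (exp (- q * X n) *\<^sub>R b n) * (\<integral>t. e t \<partial>lborel) \<partial>N)"
    unfolding F_def using lborel_integral_translate[of e] by simp
  also have "\<dots> = (\<integral>n. exp (- q * X n) *\<^sub>R b n \<partial>N) * (\<integral>t. e t \<partial>lborel)" by (rule integral_mult_left_zero)
  finally show "(\<integral>r. exp (- q * r) *\<^sub>R wconv k r \<partial>lborel) = (\<integral>n. exp (- q * X n) *\<^sub>R b n \<partial>N) * (\<integral>t. exp (- q * t) *\<^sub>R k t \<partial>lborel)"
    by (simp add: e_def)
qed

text \<open>
  Associativity of convolution by Fubini's theorem. As the measure is finite only on bounded sets, the bound on
  the inner integrals has to be uniform up to time \<open>T\<close>; beyond \<open>T\<close> the integrand is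
  \<open>0\<close>.
\<close>

lemma wconv_assoc:
  assumes k [measurable]: "k \<in> borel_measurable borel" and d [measurable]: "d \<in> borel_measurable borel"
    and k0: "\<And>t. t < 0 \<Longrightarrow> k t = 0" and d0: "\<And>t. t < 0 \<Longrightarrow> d t = 0"
    and int: "\<And>r. 0 \<le> r \<Longrightarrow> r \<le> T \<Longrightarrow> integrable lborel (\<lambda>\<tau>. k (r - \<tau>) * d \<tau>)"
    and bound: "\<And>r. 0 \<le> r \<Longrightarrow> r \<le> T \<Longrightarrow> (\<integral>\<tau>. norm (k (r - \<tau>) * d \<tau>) \<partial>lborel) \<le> B"
  shows "integrable lborel (\<lambda>\<tau>. wconv k (T - \<tau>) * d \<tau>)"
    and "(\<integral>\<tau>. wconv k (T - \<tau>) * d \<tau> \<partial>lborel) = (\<integral>n. b n * (\<integral>\<tau>. k (T - X n - \<tau>) * d \<tau> \<partial>lborel) \<partial>N)"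
proof -
  define F where "F n \<tau> = b n * (k (T - X n - \<tau>) * d \<tau>)" for n \<tau>
  have z: "k (r - \<tau>) * d \<tau> = 0" if "r < 0" for r \<tau>
    using k0[of "r - \<tau>"] d0[of \<tau>] that by (cases "\<tau> < 0") auto
  have Fm: "case_prod F \<in> borel_measurable (N \<Otimes>\<^sub>M lborel)" unfolding F_def by measurable
  have intF: "integrable (N \<Otimes>\<^sub>M lborel) (case_prod F)"
  proof (rule pair.Fubini_integrable[OF Fm])
    show "integrable N (\<lambda>n. \<integral>r. norm (case_prod F (n, r)) \<partial>lborel)"
    proof (rule Bochner_Integration.integrable_bound[where f="\<lambda>n. B *\<^sub>R (indicator {..T} (X n) *\<^sub>R b n)"])
      show "integrable N (\<lambda>n. B *\<^sub>R (indicator {..T} (X n) *\<^sub>R b n))"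
        by (intro integrable_scaleR_right integrable_weight)
      show "(\<lambda>n. \<integral>r. norm (case_prod F (n, r)) \<partial>lborel) \<in> borel_measurable N"
        using Fm by (intro lborel.borel_measurable_lebesgue_integral) simp
      show "AE n in N. norm (\<integral>r. norm (case_prod F (n, r)) \<partial>lborel) \<le> norm (B *\<^sub>R (indicator {..T} (X n) *\<^sub>R b n))"
      proof (rule AE_I2)
        fix n assume n: "n \<in> space N"
        have eq: "(\<integral>r. norm (case_prod F (n, r)) \<partial>lborel) = norm (b n) * (\<integral>\<tau>. norm (k (T - X n - \<tau>) * d \<tau>) \<partial>lborel)"
          unfolding F_def case_prod_conv by (simp add: norm_mult[of "b n"])
        show "norm (\<integral>r. norm (case_prod F (n, r)) \<partial>lborel) \<le> norm (B *\<^sub>R (indicator {..T} (X n) *\<^sub>R b n))"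
        proof (cases "X n \<le> T")
          case True
          have "(\<integral>\<tau>. norm (k (T - X n - \<tau>) * d \<tau>) \<partial>lborel) \<le> \<bar>B\<bar>"
            using bound[of "T - X n"] True X_nonneg[OF n] by simp
          then have "norm (b n) * (\<integral>\<tau>. norm (k (T - X n - \<tau>) * d \<tau>) \<partial>lborel) \<le> norm (b n) * \<bar>B\<bar>"
            by (rule mult_left_mono) simp
          moreover have "0 \<le> norm (b n) * (\<integral>\<tau>. norm (k (T - X n - \<tau>) * d \<tau>) \<partial>lborel)"
            by (intro mult_nonneg_nonneg integral_nonneg_AE) auto
          ultimately show ?thesis unfolding eq using True by (simp add: mult.commute)
        next
          case False
          then have "norm (k (T - X n - \<tau>) * d \<tau>) = 0" for \<tau> using z[of "T - X n" \<tau>] by simp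
          then have "(\<integral>\<tau>. norm (k (T - X n - \<tau>) * d \<tau>) \<partial>lborel) = 0" by (simp only:) simp
          then show ?thesis unfolding eq by simp
        qed
      qed
    qed
    show "AE n in N. integrable lborel (\<lambda>r. case_prod F (n, r))"
    proof (rule AE_I2)
      fix n assume n: "n \<in> space N"
      show "integrable lborel (\<lambda>r. case_prod F (n, r))"
      proof (cases "X n \<le> T")
        case True
        then show ?thesis unfolding F_def case_prod_conv
          using int[of "T - X n"] X_nonneg[OF n] by (intro integrable_mult_right) simp
      next
        case False
        then have "k (T - X n - r) * d r = 0" for r using z[of "T - X n" r] by simp
        then show ?thesis unfolding F_def case_prod_conv by (simp only:) simp
      qed
    qed
  qed
  have r: "(\<integral>n. F n \<tau> \<partial>N) = wconv k (T - \<tau>) * d \<tau>" for \<tau>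
  proof -
    have "F n \<tau> = b n * k (T - \<tau> - X n) * d \<tau>" for n by (simp add: F_def algebra_simps)
    then show ?thesis by (simp add: wconv_def)
  qed
  show "integrable lborel (\<lambda>\<tau>. wconv k (T - \<tau>) * d \<tau>)"
    unfolding r[symmetric] by (rule pair.integrable_snd[OF intF])
  have "(\<integral>\<tau>. wconv k (T - \<tau>) * d \<tau> \<partial>lborel) = (\<integral>n. \<integral>\<tau>. F n \<tau> \<partial>lborel \<partial>N)"
    unfolding r[symmetric] by (rule pair.Fubini_integral[OF intF])
  then show "(\<integral>\<tau>. wconv k (T - \<tau>) * d \<tau> \<partial>lborel) = (\<integral>n. b n * (\<integral>\<tau>. k (T - X n - \<tau>) * d \<tau> \<partial>lborel) \<partial>N)"
    by (simp add: F_def)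
qed

end

abbreviation heaviside :: "real \<Rightarrow> complex" where "heaviside \<equiv> indicator {0..}"

lemma laplace_exp:
  fixes w :: complex assumes w: "0 < Re w"
  shows "integrable lborel (\<lambda>t. indicator {0..} t *\<^sub>R exp (- w * of_real t))"
    and "(\<integral>t. indicator {0..} t *\<^sub>R exp (- w * of_real t) \<partial>lborel) = 1 / w"
proof -
  let ?f = "\<lambda>t. exp (- w * complex_of_real t)"
  have fm: "?f \<in> borel_measurable borel" by (intro borel_measurable_continuous_onI continuous_intros)
  show i: "integrable lborel (\<lambda>t. indicator {0..} t *\<^sub>R ?f t)"
  proof (rule integrableI_bounded)
    have "(\<integral>\<^sup>+t. ennreal (norm (indicator {0..} t *\<^sub>R ?f t)) \<partial>lborel)
        = (\<integral>\<^sup>+t. ennreal (exp (- Re w * t)) * indicator {0..} t \<partial>lborel)"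
      by (intro nn_integral_cong) (auto simp: indicator_def)
    also have "\<dots> = ennreal (0 - - exp (- Re w * 0) / Re w)"
    proof (rule nn_integral_FTC_atLeast)
      show "((\<lambda>x. - exp (- Re w * x) / Re w) has_real_derivative exp (- Re w * x)) (at x)" for x
        using w by (auto intro!: derivative_eq_intros)
      have "filterlim (\<lambda>x. - Re w * x) at_bot at_top"
        using w filterlim_tendsto_neg_mult_at_bot[OF tendsto_const, of "- Re w" "\<lambda>x. x" at_top] by (simp add: filterlim_ident)
      then have "((\<lambda>x. exp (- Re w * x)) \<longlongrightarrow> 0) at_top" by (rule filterlim_compose[OF exp_at_bot])
      then have "((\<lambda>x. - exp (- Re w * x) / Re w) \<longlongrightarrow> - 0 / Re w) at_top" by (intro tendsto_intros) (use w in auto)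
      then show "((\<lambda>x. - exp (- Re w * x) / Re w) \<longlongrightarrow> 0) at_top" by simp
    qed auto
    finally show "(\<integral>\<^sup>+t. ennreal (norm (indicator {0..} t *\<^sub>R ?f t)) \<partial>lborel) < \<infinity>" by simp
  qed (use fm in simp)
  have w0: "w \<noteq> 0" using w by auto
  have part: "(\<integral>t. indicator {0..real n} t *\<^sub>R ?f t \<partial>lborel) = - ?f (real n) / w - (- ?f 0 / w)" for n
  proof (rule integral_FTC_Icc)
    show "((\<lambda>t. - ?f t / w) has_vector_derivative ?f x) (at x within {0..real n})" for x
    proof -
      have "((\<lambda>t. - exp (- w * t) / w) has_field_derivative exp (- w * of_real x)) (at (of_real x))"
        using w0 by (auto intro!: derivative_eq_intros)
      then show ?thesis by (auto intro: has_vector_derivative_real_field has_vector_derivative_at_within)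
    qed
  qed (auto intro!: continuous_intros)
  have "(\<lambda>n. \<integral>t. indicator {0..real n} t *\<^sub>R ?f t \<partial>lborel) \<longlonglongrightarrow> (\<integral>t. indicator {0..} t *\<^sub>R ?f t \<partial>lborel)"
  proof (rule integral_dominated_convergence[where w="\<lambda>t. norm (indicator {0..} t *\<^sub>R ?f t)"])
    show "AE t in lborel. (\<lambda>n. indicator {0..real n} t *\<^sub>R ?f t) \<longlonglongrightarrow> indicator {0..} t *\<^sub>R ?f t"
    proof (rule AE_I2)
      fix t :: real
      obtain m :: nat where "t \<le> real m" using real_arch_simple by blast
      then have "\<forall>\<^sub>F n in sequentially. indicator {0..real n} t *\<^sub>R ?f t = indicator {0..} t *\<^sub>R ?f t"
        unfolding eventually_sequentially by (intro exI[of _ m]) (auto simp: indicator_def)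
      then show "(\<lambda>n. indicator {0..real n} t *\<^sub>R ?f t) \<longlonglongrightarrow> indicator {0..} t *\<^sub>R ?f t"
        by (rule tendsto_eventually)
    qed
  qed (use fm integrable_norm[OF i] in \<open>auto simp: indicator_def\<close>)
  moreover have "(\<lambda>n. - ?f (real n) / w - (- ?f 0 / w)) \<longlonglongrightarrow> - 0 / w - (- ?f 0 / w)"
  proof (intro tendsto_intros w0)
    have e: "(\<lambda>n. ?f (real n)) = (\<lambda>n. exp (- w) ^ n)" by (simp add: exp_of_nat_mult[symmetric] mult.commute)
    show "(\<lambda>n. ?f (real n)) \<longlonglongrightarrow> 0" unfolding e by (rule LIMSEQ_power_zero) (use w in simp)
  qed
  ultimately show "(\<integral>t. indicator {0..} t *\<^sub>R ?f t \<partial>lborel) = 1 / w"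
    unfolding part using LIMSEQ_unique by fastforce
qed

lemma laplace_heaviside:
  fixes q :: real assumes q: "0 < q"
  shows "integrable lborel (\<lambda>t. exp (- q * t) *\<^sub>R heaviside t)"
    and "(\<integral>t. exp (- q * t) *\<^sub>R heaviside t \<partial>lborel) = of_real (1 / q)"
proof -
  have e: "(\<lambda>t. exp (- q * t) *\<^sub>R heaviside t) = (\<lambda>t. indicator {0..} t *\<^sub>R exp (- of_real q * of_real t))"
  proof
    fix t
    have "exp (- complex_of_real q * of_real t) = of_real (exp (- q * t))"
      by (simp add: exp_of_real[symmetric])
    then show "exp (- q * t) *\<^sub>R heaviside t = indicator {0..} t *\<^sub>R exp (- of_real q * of_real t)"
      by (simp only:) (simp add: indicator_def scaleR_conv_of_real)
  qed
  show "integrable lborel (\<lambda>t. exp (- q * t) *\<^sub>R heaviside t)"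
    "(\<integral>t. exp (- q * t) *\<^sub>R heaviside t \<partial>lborel) = of_real (1 / q)"
    unfolding e using laplace_exp[of "of_real q"] q by auto
qed

text \<open>
  The complex measure whose Laplace transform is the resolvent \<open>1 / (\<Phi>(q) - z)\<close>. The scalar
  equation depends on nothing else, so the underlying process is left out of this part.
\<close>

locale resolvent = levy_measure \<nu> + weighted_shift N X b
  for \<nu> :: "real measure" and N :: "'n measure" and X b +
  fixes z :: complex
  assumes z: "Re z \<le> 0"
    and laplace_weight: "\<And>q. 0 < q \<Longrightarrow> (\<integral>n. exp (- q * X n) *\<^sub>R b n \<partial>N) = 1 / (of_real (laplace_exponent \<nu> q) - z)"
begin

definition relax :: "real \<Rightarrow> complex" where
  "relax t = 1 + z * wconv heaviside t"

lemma measurable_heaviside [measurable]: "heaviside \<in> borel_measurable borel"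
  by measurable

lemma measurable_relax [measurable]: "relax \<in> borel_measurable borel"
  unfolding relax_def by measurable

text \<open>
  Both sides have the Laplace transform \<open>\<Phi>(q) / (q (\<Phi>(q) - z))\<close>, since
  \<open>1/q + z / (q (\<Phi>(q) - z)) = \<Phi>(q) / (q (\<Phi>(q) - z))\<close>.
\<close>

lemma wconv_tail_kernel: "AE t in lborel. 0 \<le> t \<longrightarrow> wconv tail_kernel t = relax t"
proof -
  let ?g = "\<lambda>t. wconv tail_kernel t - heaviside t - z * wconv heaviside t"
  have eq: "exp (- q * t) *\<^sub>R ?g t = exp (- q * t) *\<^sub>R wconv tail_kernel t - exp (- q * t) *\<^sub>R heaviside t
      - z * (exp (- q * t) *\<^sub>R wconv heaviside t)" for q t :: real
    by (simp add: scaleR_diff_right)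
  have neg: "?g t = 0" if "t < 0" for t
    using that wconv_neg[of tail_kernel t] wconv_neg[of heaviside t] by (simp add: tail_kernel_def)
  have set: "indicator {0..} t *\<^sub>R exp (- q * t) *\<^sub>R ?g t
      = exp (- q * t) *\<^sub>R wconv tail_kernel t - exp (- q * t) *\<^sub>R heaviside t
      - z * (exp (- q * t) *\<^sub>R wconv heaviside t)" for q t :: real
    unfolding eq[symmetric] using neg[of t] by (cases "t < 0") (auto simp: indicator_def)
  have "AE t in lborel. 0 \<le> t \<longrightarrow> ?g t = 0"
  proof (rule Lerch)
    show "?g \<in> borel_measurable borel" by measurable
    fix n :: nat assume n: "1 \<le> n"
    then have q: "0 < real n" by simp
    note i = laplace_wconv[OF measurable_tail_kernel q laplace_tail_kernel(1)[OF q]]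
      laplace_wconv[OF measurable_heaviside q laplace_heaviside(1)[OF q]]
    show "set_integrable lborel {0..} (\<lambda>t. exp (- real n * t) *\<^sub>R ?g t)"
      unfolding set_integrable_def set
      by (intro Bochner_Integration.integrable_diff integrable_mult_right i laplace_heaviside q)
    let ?P = "laplace_exponent \<nu> (real n)"
    have nz: "of_real ?P - z \<noteq> 0"
    proof
      assume "of_real ?P - z = 0"
      then have "Re z = ?P" by (simp add: complex_eq_iff)
      then show False using z laplace_exponent_pos[OF q] by simp
    qed
    have "(LINT t:{0..}|lborel. exp (- real n * t) *\<^sub>R ?g t)
        = 1 / (of_real ?P - z) * of_real (?P / real n) - of_real (1 / real n) - z * (1 / (of_real ?P - z) * of_real (1 / real n))"
      unfolding set_lebesgue_integral_def set
      by (simp only: Bochner_Integration.integral_diff integral_mult_right_zero integrable_mult_right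
          Bochner_Integration.integrable_diff i laplace_heaviside[OF q] laplace_tail_kernel[OF q] laplace_weight[OF q])
    also have "\<dots> = 0" using nz q by (simp add: field_simps)
    finally show "(LINT t:{0..}|lborel. exp (- real n * t) *\<^sub>R ?g t) = 0" .
  qed
  then show ?thesis by eventually_elim (auto simp: relax_def diff_eq_eq add.commute)
qed

lemma heaviside_shift_integrable:
  assumes "d \<in> borel_measurable borel" "integrable lborel (\<lambda>t. indicator {..T} t *\<^sub>R d t)" "r \<le> T"
  shows "integrable lborel (\<lambda>\<tau>. heaviside (r - \<tau>) * d \<tau>)"
    and "(\<integral>\<tau>. norm (heaviside (r - \<tau>) * d \<tau>) \<partial>lborel) \<le> (\<integral>\<tau>. norm (indicator {..T} \<tau> *\<^sub>R d \<tau>) \<partial>lborel)"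
proof -
  have b: "norm (heaviside (r - \<tau>) * d \<tau>) \<le> norm (indicator {..T} \<tau> *\<^sub>R d \<tau>)" for \<tau>
    using assms(3) by (auto simp: indicator_def)
  show i: "integrable lborel (\<lambda>\<tau>. heaviside (r - \<tau>) * d \<tau>)"
    by (rule Bochner_Integration.integrable_bound[OF assms(2)]) (use b assms(1) in auto)
  show "(\<integral>\<tau>. norm (heaviside (r - \<tau>) * d \<tau>) \<partial>lborel) \<le> (\<integral>\<tau>. norm (indicator {..T} \<tau> *\<^sub>R d \<tau>) \<partial>lborel)"
    by (rule integral_mono) (use b integrable_norm[OF assms(2)] integrable_norm[OF i] in auto)
qed

text \<open>
  Convolving the tail with \<open>wconv heaviside\<close> is the same as convolving
  \<open>wconv tail_kernel\<close>, which is \<open>relax\<close>, with the constant \<open>1\<close>.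
\<close>

lemma relax_equation:
  assumes t: "0 \<le> t"
  shows "(\<integral>\<tau>. tail_kernel (t - \<tau>) * (z * wconv heaviside \<tau>) \<partial>lborel) = z * (\<integral>\<tau>. indicator {0..t} \<tau> *\<^sub>R relax \<tau> \<partial>lborel)"
proof -
  let ?h = tail_kernel
  have k0: "?h s = 0" "heaviside s = 0" if "s < 0" for s using that by (auto simp: tail_kernel_def)
  let ?B = "\<integral>\<tau>. norm (indicator {..t} \<tau> *\<^sub>R ?h \<tau>) \<partial>lborel"
  note I = heaviside_shift_integrable[OF measurable_tail_kernel tail_kernel_integrable[of t]]
  have I': "integrable lborel (\<lambda>\<tau>. ?h (r - \<tau>) * heaviside \<tau>)"
    "(\<integral>\<tau>. norm (?h (r - \<tau>) * heaviside \<tau>) \<partial>lborel) \<le> ?B" if "r \<le> t" for r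
  proof -
    show "integrable lborel (\<lambda>\<tau>. ?h (r - \<tau>) * heaviside \<tau>)"
      using lborel_integrable_reflect[OF I(1)[OF that], of r] by (simp add: mult.commute)
    show "(\<integral>\<tau>. norm (?h (r - \<tau>) * heaviside \<tau>) \<partial>lborel) \<le> ?B"
      using I(2)[OF that] lborel_integral_reflect[of "\<lambda>\<tau>. norm (heaviside (r - \<tau>) * ?h \<tau>)" r] by (simp add: mult.commute)
  qed
  have swap: "(\<integral>\<tau>. ?h (r - \<tau>) * heaviside \<tau> \<partial>lborel) = (\<integral>\<tau>. heaviside (r - \<tau>) * ?h \<tau> \<partial>lborel)" for r
    using lborel_integral_reflect[of "\<lambda>\<tau>. heaviside (r - \<tau>) * ?h \<tau>" r] by (simp add: mult.commute)
  have "(\<integral>\<tau>. ?h (t - \<tau>) * (z * wconv heaviside \<tau>) \<partial>lborel) = z * (\<integral>\<tau>. wconv heaviside \<tau> * ?h (t - \<tau>) \<partial>lborel)"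
    by (simp add: mult_ac)
  also have "(\<integral>\<tau>. wconv heaviside \<tau> * ?h (t - \<tau>) \<partial>lborel) = (\<integral>\<tau>. wconv heaviside (t - \<tau>) * ?h \<tau> \<partial>lborel)"
    using lborel_integral_reflect[of "\<lambda>\<tau>. wconv heaviside (t - \<tau>) * ?h \<tau>" t] by simp
  also have "\<dots> = (\<integral>n. b n * (\<integral>\<tau>. heaviside (t - X n - \<tau>) * ?h \<tau> \<partial>lborel) \<partial>N)"
    by (rule wconv_assoc(2)[where B="?B"]) (use k0 I in auto)
  also have "\<dots> = (\<integral>n. b n * (\<integral>\<tau>. ?h (t - X n - \<tau>) * heaviside \<tau> \<partial>lborel) \<partial>N)"
    unfolding swap ..
  also have "\<dots> = (\<integral>\<tau>. wconv ?h (t - \<tau>) * heaviside \<tau> \<partial>lborel)"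
    by (rule wconv_assoc(2)[where B="?B", symmetric]) (use k0 I' in auto)
  also have "\<dots> = (\<integral>\<tau>. wconv ?h \<tau> * heaviside (t - \<tau>) \<partial>lborel)"
    using lborel_integral_reflect[of "\<lambda>\<tau>. wconv ?h (t - \<tau>) * heaviside \<tau>" t] by simp
  also have "\<dots> = (\<integral>\<tau>. indicator {0..t} \<tau> *\<^sub>R relax \<tau> \<partial>lborel)"
  proof (rule integral_cong_AE)
    show "AE \<tau> in lborel. wconv ?h \<tau> * heaviside (t - \<tau>) = indicator {0..t} \<tau> *\<^sub>R relax \<tau>"
      using wconv_tail_kernel
    proof eventually_elim
      case (elim \<tau>)
      then show ?case using wconv_neg[of ?h \<tau>] k0 by (cases "0 \<le> \<tau>") (auto simp: indicator_def)
    qed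
  qed auto
  finally show ?thesis .
qed

text \<open>
  The resolvent identity expresses \<open>1\<close> on the half line as
  \<open>wconv tail_kernel - z wconv heaviside\<close>. Convolved with \<open>d\<close>, the right-hand side
  becomes the resolvent measure applied to the difference of the two sides of the equation for \<open>d\<close>,
  that is, \<open>0\<close>.
\<close>

lemma homogeneous_Volterra:
  assumes d [measurable]: "d \<in> borel_measurable borel" and d0: "\<And>t. t < 0 \<Longrightarrow> d t = 0"
    and bnd: "\<And>\<tau>. \<tau> \<le> T \<Longrightarrow> norm (d \<tau>) \<le> B"
    and eq: "\<And>r. 0 \<le> r \<Longrightarrow> r \<le> T \<Longrightarrow> (\<integral>\<tau>. tail_kernel (r - \<tau>) * d \<tau> \<partial>lborel) = z * (\<integral>\<tau>. heaviside (r - \<tau>) * d \<tau> \<partial>lborel)"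
  shows "(\<integral>\<tau>. heaviside (T - \<tau>) * d \<tau> \<partial>lborel) = 0"
proof -
  let ?h = tail_kernel
  have k0: "?h s = 0" "heaviside s = 0" if "s < 0" for s using that by (auto simp: tail_kernel_def)
  have B: "norm (d \<tau>) \<le> \<bar>B\<bar>" if "\<tau> \<le> T" for \<tau> using bnd[OF that] by simp
  have di: "integrable lborel (\<lambda>t. indicator {..T} t *\<^sub>R d t)"
  proof (rule Bochner_Integration.integrable_bound[where f="\<lambda>t. indicator {0..T} t *\<^sub>R B"])
    have "set_integrable lborel {0..T} (\<lambda>_. B)" by (rule borel_integrable_atLeastAtMost') (intro continuous_intros)
    then show "integrable lborel (\<lambda>t. indicator {0..T} t *\<^sub>R B)" by (simp add: set_integrable_def)
    show "AE t in lborel. norm (indicator {..T} t *\<^sub>R d t) \<le> norm (indicator {0..T} t *\<^sub>R B)"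
      by (rule AE_I2) (use B d0 in \<open>auto simp: indicator_def not_le\<close>)
  qed simp
  note IH = heaviside_shift_integrable[OF d di]
  have bh: "norm (?h (r - \<tau>) * d \<tau>) \<le> norm (\<bar>B\<bar> *\<^sub>R (indicator {..T} (r - \<tau>) *\<^sub>R ?h (r - \<tau>)))" if "r \<le> T" for r \<tau>
  proof (cases "0 \<le> \<tau> \<and> \<tau> \<le> r")
    case True
    then have "norm (d \<tau>) \<le> \<bar>B\<bar>" using B that by simp
    from mult_left_mono[OF this, of "norm (?h (r - \<tau>))"] show ?thesis
      using True that by (simp add: norm_mult mult.commute)
  next
    case False
    then show ?thesis using d0[of \<tau>] k0[of "r - \<tau>"] by (cases "\<tau> < 0") auto
  qed
  have hi: "integrable lborel (\<lambda>\<tau>. \<bar>B\<bar> *\<^sub>R (indicator {..T} (r - \<tau>) *\<^sub>R ?h (r - \<tau>)))" for r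
    by (intro integrable_scaleR_right lborel_integrable_reflect tail_kernel_integrable)
  have I: "integrable lborel (\<lambda>\<tau>. ?h (r - \<tau>) * d \<tau>)" if "r \<le> T" for r
    by (rule Bochner_Integration.integrable_bound[OF hi[of r]]) (use bh[OF that] in auto)
  have I2: "(\<integral>\<tau>. norm (?h (r - \<tau>) * d \<tau>) \<partial>lborel) \<le> (\<integral>\<tau>. norm (\<bar>B\<bar> *\<^sub>R (indicator {..T} \<tau> *\<^sub>R ?h \<tau>)) \<partial>lborel)" if "r \<le> T" for r
  proof -
    have "(\<integral>\<tau>. norm (?h (r - \<tau>) * d \<tau>) \<partial>lborel) \<le> (\<integral>\<tau>. norm (\<bar>B\<bar> *\<^sub>R (indicator {..T} (r - \<tau>) *\<^sub>R ?h (r - \<tau>))) \<partial>lborel)"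
      by (rule integral_mono) (use bh[OF that] I[OF that] hi[of r] in \<open>auto simp del: norm_scaleR\<close>)
    also have "\<dots> = (\<integral>\<tau>. norm (\<bar>B\<bar> *\<^sub>R (indicator {..T} \<tau> *\<^sub>R ?h \<tau>)) \<partial>lborel)"
      by (rule lborel_integral_reflect)
    finally show ?thesis .
  qed
  have A1: "integrable lborel (\<lambda>\<tau>. wconv ?h (T - \<tau>) * d \<tau>)"
    "(\<integral>\<tau>. wconv ?h (T - \<tau>) * d \<tau> \<partial>lborel) = (\<integral>n. b n * (\<integral>\<tau>. ?h (T - X n - \<tau>) * d \<tau> \<partial>lborel) \<partial>N)"
    by (rule wconv_assoc[OF measurable_tail_kernel d k0(1) d0 I I2]; assumption)+
  have A2: "integrable lborel (\<lambda>\<tau>. wconv heaviside (T - \<tau>) * d \<tau>)"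
    "(\<integral>\<tau>. wconv heaviside (T - \<tau>) * d \<tau> \<partial>lborel) = (\<integral>n. b n * (\<integral>\<tau>. heaviside (T - X n - \<tau>) * d \<tau> \<partial>lborel) \<partial>N)"
    by (rule wconv_assoc[OF measurable_heaviside d k0(2) d0 IH]; assumption)+
  have neg: "(\<integral>\<tau>. ?h (r - \<tau>) * d \<tau> \<partial>lborel) = 0" "(\<integral>\<tau>. heaviside (r - \<tau>) * d \<tau> \<partial>lborel) = 0" if "r < 0" for r
  proof -
    have "?h (r - \<tau>) * d \<tau> = 0" "heaviside (r - \<tau>) * d \<tau> = 0" for \<tau>
      using d0[of \<tau>] k0[of "r - \<tau>"] that by (cases "\<tau> < 0"; simp)+
    then show "(\<integral>\<tau>. ?h (r - \<tau>) * d \<tau> \<partial>lborel) = 0" "(\<integral>\<tau>. heaviside (r - \<tau>) * d \<tau> \<partial>lborel) = 0"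
      by (simp_all only:) simp_all
  qed
  have "(\<integral>\<tau>. heaviside (T - \<tau>) * d \<tau> \<partial>lborel) = (\<integral>\<tau>. wconv ?h (T - \<tau>) * d \<tau> - z * (wconv heaviside (T - \<tau>) * d \<tau>) \<partial>lborel)"
  proof (rule integral_cong_AE)
    have "AE \<tau> in lborel. 0 \<le> T - \<tau> \<longrightarrow> wconv ?h (T - \<tau>) = relax (T - \<tau>)"
    proof -
      have "Measurable.pred borel (\<lambda>\<tau>. 0 \<le> \<tau> \<longrightarrow> wconv ?h \<tau> = relax \<tau>)" by measurable
      from AE_borel_affine[OF _ this wconv_tail_kernel, of "-1" T] show ?thesis by simp
    qed
    then show "AE \<tau> in lborel. heaviside (T - \<tau>) * d \<tau> = wconv ?h (T - \<tau>) * d \<tau> - z * (wconv heaviside (T - \<tau>) * d \<tau>)"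
    proof eventually_elim
      case (elim \<tau>)
      show ?case
      proof (cases "\<tau> \<le> T")
        case True
        then show ?thesis using elim by (simp add: relax_def algebra_simps)
      next
        case False
        then show ?thesis using wconv_neg[of ?h "T - \<tau>"] wconv_neg[of heaviside "T - \<tau>"] k0 by simp
      qed
    qed
  qed auto
  also have "\<dots> = (\<integral>\<tau>. wconv ?h (T - \<tau>) * d \<tau> \<partial>lborel) - z * (\<integral>\<tau>. wconv heaviside (T - \<tau>) * d \<tau> \<partial>lborel)"
    using A1(1) A2(1) by simp
  also have "\<dots> = (\<integral>n. b n * (\<integral>\<tau>. ?h (T - X n - \<tau>) * d \<tau> \<partial>lborel) \<partial>N) - (\<integral>n. b n * (z * (\<integral>\<tau>. heaviside (T - X n - \<tau>) * d \<tau> \<partial>lborel)) \<partial>N)"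
    unfolding A1(2) A2(2) by (simp add: mult.left_commute[of _ z])
  also have "(\<integral>n. b n * (\<integral>\<tau>. ?h (T - X n - \<tau>) * d \<tau> \<partial>lborel) \<partial>N) = (\<integral>n. b n * (z * (\<integral>\<tau>. heaviside (T - X n - \<tau>) * d \<tau> \<partial>lborel)) \<partial>N)"
  proof (rule Bochner_Integration.integral_cong[OF refl])
    fix n assume n: "n \<in> space N"
    show "b n * (\<integral>\<tau>. ?h (T - X n - \<tau>) * d \<tau> \<partial>lborel) = b n * (z * (\<integral>\<tau>. heaviside (T - X n - \<tau>) * d \<tau> \<partial>lborel))"
    proof (cases "X n \<le> T")
      case True
      then show ?thesis using eq[of "T - X n"] X_nonneg[OF n] by simp
    next
      case False
      then show ?thesis using neg[of "T - X n"] by simp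
    qed
  qed
  finally show ?thesis by simp
qed

text \<open>
  A measure without atoms has a continuous distribution function.
\<close>

lemma continuous_relax:
  assumes "\<And>t. 0 \<le> t \<Longrightarrow> AE n in N. X n \<noteq> t"
  shows "continuous_on {0..} relax" "relax 0 = 1"
proof -
  show "relax 0 = 1"
  proof -
    have "wconv heaviside 0 = (\<integral>n. 0 \<partial>N)" unfolding wconv_def
    proof (rule integral_cong_AE)
      show "AE n in N. b n * heaviside (0 - X n) = 0"
        using assms[OF order_refl] AE_space
      proof eventually_elim
        case (elim n)
        then show ?case using X_nonneg[of n] by (simp add: indicator_def)
      qed
    qed auto
    then show ?thesis by (simp add: relax_def)
  qed
  have "continuous_on {0..} (wconv heaviside)"
    unfolding continuous_on_sequentially
  proof (intro allI ballI impI)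
    fix x :: "nat \<Rightarrow> real" and t assume t: "t \<in> {0..}" and x: "(\<forall>n. x n \<in> {0..}) \<and> x \<longlonglongrightarrow> t"
    then have lim: "x \<longlonglongrightarrow> t" by simp
    from convergent_imp_Bseq[OF convergentI[OF lim]] obtain T where T: "\<And>i. \<bar>x i\<bar> \<le> T"
      unfolding Bseq_def by auto
    have "(\<lambda>i. \<integral>n. b n * heaviside (x i - X n) \<partial>N) \<longlonglongrightarrow> (\<integral>n. b n * heaviside (t - X n) \<partial>N)"
    proof (rule integral_dominated_convergence[where w="\<lambda>n. norm (indicator {..T} (X n) *\<^sub>R b n)"])
      show "AE n in N. (\<lambda>i. b n * heaviside (x i - X n)) \<longlonglongrightarrow> b n * heaviside (t - X n)"
      proof -
        have "AE n in N. X n \<noteq> t" using assms[of t] t by simp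
        then show ?thesis
      proof eventually_elim
        case (elim n)
        have "\<forall>\<^sub>F i in sequentially. heaviside (x i - X n) = heaviside (t - X n)"
        proof (cases "X n < t")
          case True
          from order_tendstoD(1)[OF lim True] show ?thesis by eventually_elim (use True in auto)
        next
          case False
          then have "t < X n" using elim by simp
          from order_tendstoD(2)[OF lim this] show ?thesis by eventually_elim (use \<open>t < X n\<close> in auto)
        qed
        then have "(\<lambda>i. heaviside (x i - X n)) \<longlonglongrightarrow> heaviside (t - X n)" by (rule tendsto_eventually)
        then show ?case by (intro tendsto_intros)
      qed
      qed
      show "AE n in N. norm (b n * heaviside (x i - X n)) \<le> norm (indicator {..T} (X n) *\<^sub>R b n)" for i
        by (rule AE_I2) (use T[of i] in \<open>auto simp: indicator_def\<close>)
    qed (use integrable_norm[OF integrable_weight] in auto)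
    then show "(wconv heaviside \<circ> x) \<longlonglongrightarrow> wconv heaviside t" by (simp add: wconv_def o_def)
  qed
  then show "continuous_on {0..} relax" unfolding relax_def by (intro continuous_intros)
qed

end

section \<open>The inverse subordinator\<close>

locale subordinator_inverse = levy_measure \<nu> for \<nu> :: "real measure" +
  fixes M :: "'w measure" and S :: "real \<Rightarrow> 'w \<Rightarrow> real"
  assumes sub: "subordinator M S"
    and laplace_S: "\<And>t q. 0 \<le> t \<Longrightarrow> 0 \<le> q \<Longrightarrow> (\<integral>\<omega>. exp (- q * S t \<omega>) \<partial>M) = exp (- t * laplace_exponent \<nu> q)"
begin

lemma prob_space_M: "prob_space M"
  using sub by (simp add: subordinator_def levy_process_def)

sublocale prob: prob_space M by (rule prob_space_M)

lemma S_measurable [measurable]: "0 \<le> t \<Longrightarrow> S t \<in> borel_measurable M"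
  using sub by (simp add: subordinator_def levy_process_def)

lemma S_0: "\<omega> \<in> space M \<Longrightarrow> S 0 \<omega> = 0"
  using sub by (simp add: subordinator_def levy_process_def)

lemma S_mono: "\<omega> \<in> space M \<Longrightarrow> 0 \<le> s \<Longrightarrow> s \<le> t \<Longrightarrow> S s \<omega> \<le> S t \<omega>"
  using sub by (auto simp: subordinator_def mono_on_def)

lemma S_nonneg: "\<omega> \<in> space M \<Longrightarrow> 0 \<le> t \<Longrightarrow> 0 \<le> S t \<omega>"
  using S_mono[of \<omega> 0 t] S_0 by simp

lemma S_right_continuous: "\<omega> \<in> space M \<Longrightarrow> 0 \<le> t \<Longrightarrow> ((\<lambda>s. S s \<omega>) \<longlongrightarrow> S t \<omega>) (at_right t)"
  using sub by (simp add: subordinator_def levy_process_def)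

lemma S_stationary: "0 \<le> s \<Longrightarrow> 0 \<le> t \<Longrightarrow> distr M borel (\<lambda>\<omega>. S (s + t) \<omega> - S s \<omega>) = distr M borel (S t)"
  using sub by (simp add: subordinator_def levy_process_def)

lemma integrable_exp_S: assumes "0 \<le> t" "0 \<le> q" shows "integrable M (\<lambda>\<omega>. exp (- q * S t \<omega>))"
proof (rule prob.integrable_const_bound[where B=1])
  show "AE \<omega> in M. norm (exp (- q * S t \<omega>)) \<le> 1"
    by (rule AE_I2) (use assms S_nonneg in auto)
qed (use assms in measurable)

text \<open>
  \<open>P(S(t) = 0) \<le> E e\<^bsup>-n S(t)\<^esup> = e\<^bsup>-t \<Phi>(n)\<^esup>\<close> for all
  \<open>n\<close>, and the exponent is unbounded.
\<close>

lemma AE_S_pos: assumes t: "0 < t" shows "AE \<omega> in M. 0 < S t \<omega>"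
proof -
  let ?A = "{\<omega> \<in> space M. S t \<omega> \<le> 0}"
  have [measurable]: "S t \<in> borel_measurable M" using t by simp
  have A [measurable]: "?A \<in> sets M" by measurable
  have iA: "integrable M (indicat_real ?A)"
    by (rule integrable_real_indicator[OF A]) (simp add: prob.emeasure_eq_measure)
  have le: "measure M ?A \<le> exp (- t * laplace_exponent \<nu> (real n))" for n
  proof -
    have "measure M ?A = (\<integral>\<omega>. indicator ?A \<omega> \<partial>M)" by simp
    also have "\<dots> \<le> (\<integral>\<omega>. exp (- real n * S t \<omega>) \<partial>M)"
    proof (rule integral_mono)
      fix \<omega> assume "\<omega> \<in> space M"
      then have "S t \<omega> = 0" if "\<omega> \<in> ?A" using S_nonneg[of \<omega> t] t that by simp
      then show "indicator ?A \<omega> \<le> exp (- real n * S t \<omega>)" by (cases "\<omega> \<in> ?A") auto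
    qed (use integrable_exp_S[of t "real n"] t iA in auto)
    finally show ?thesis using laplace_S[of t "real n"] t by simp
  qed
  have "measure M ?A = 0"
  proof (rule ccontr)
    assume "measure M ?A \<noteq> 0"
    then have p: "0 < measure M ?A" by (simp add: zero_less_measure_iff)
    obtain n where n: "- ln (measure M ?A) / t < laplace_exponent \<nu> (real n)"
      using laplace_exponent_unbounded by blast
    then have "- t * laplace_exponent \<nu> (real n) < ln (measure M ?A)" using t by (simp add: field_simps)
    then have "exp (- t * laplace_exponent \<nu> (real n)) < measure M ?A" using p by (metis exp_less_mono exp_ln)
    then show False using le[of n] by simp
  qed
  then show ?thesis
    by (intro AE_I[where N="?A"]) (auto simp: prob.emeasure_eq_measure not_less)
qed

text \<open>
  \<open>P(\<forall>n. S(n) \<le> k) e\<^bsup>-k\<^esup> \<le> E e\<^bsup>-S(n)\<^esup> = e\<^bsup>-n \<Phi>(1)\<^esup>\<close>,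
  which tends to \<open>0\<close>. Almost surely, therefore, the infimum that defines the inverse process is
  over a nonempty set.
\<close>

lemma AE_S_unbounded: "AE \<omega> in M. \<forall>t. \<exists>n::nat. t < S (real n) \<omega>"
proof -
  have "AE \<omega> in M. \<exists>n::nat. real k < S (real n) \<omega>" for k :: nat
  proof -
    let ?A = "{\<omega> \<in> space M. \<forall>n::nat. S (real n) \<omega> \<le> real k}"
    have A [measurable]: "?A \<in> sets M" by measurable
    have iA: "integrable M (indicat_real ?A)"
      by (rule integrable_real_indicator[OF A]) (simp add: prob.emeasure_eq_measure)
    have le: "measure M ?A * exp (- real k) \<le> exp (- laplace_exponent \<nu> 1) ^ n" for n
    proof -
      have "measure M ?A * exp (- real k) = (\<integral>\<omega>. indicator ?A \<omega> * exp (- real k) \<partial>M)" by simp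
      also have "\<dots> \<le> (\<integral>\<omega>. exp (- 1 * S (real n) \<omega>) \<partial>M)"
      proof (rule integral_mono)
        show "indicator ?A \<omega> * exp (- real k) \<le> exp (- 1 * S (real n) \<omega>)" for \<omega>
          by (cases "\<omega> \<in> ?A") auto
      qed (use integrable_exp_S[of "real n" 1] iA in auto)
      also have "\<dots> = exp (- laplace_exponent \<nu> 1) ^ n"
        using laplace_S[of "real n" 1] by (simp add: exp_of_nat_mult[symmetric])
      finally show ?thesis .
    qed
    have "(\<lambda>n. exp (- laplace_exponent \<nu> 1) ^ n) \<longlonglongrightarrow> 0"
      by (rule LIMSEQ_power_zero) (use laplace_exponent_pos[of 1] in simp)
    then have "measure M ?A * exp (- real k) \<le> 0"
      by (rule LIMSEQ_le_const) (use le in blast)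
    then have "measure M ?A = 0" by (simp add: mult_le_0_iff measure_le_0_iff)
    then show ?thesis
      by (intro AE_I[where N="?A"]) (auto simp: prob.emeasure_eq_measure not_less)
  qed
  then have "AE \<omega> in M. \<forall>k::nat. \<exists>n::nat. real k < S (real n) \<omega>" by (simp add: AE_all_countable)
  then show ?thesis
  proof eventually_elim
    case (elim \<omega>)
    show ?case
    proof
      fix t
      obtain k :: nat where "t \<le> real k" using real_arch_simple by blast
      then show "\<exists>n::nat. t < S (real n) \<omega>" using elim by (meson le_less_trans)
    qed
  qed
qed

text \<open>
  Stationarity carries positivity over to increments. Doing so for all rational pairs costs only a null set, and
  monotonicity interpolates.
\<close>

lemma AE_S_strict: "AE \<omega> in M. \<forall>s t. 0 \<le> s \<longrightarrow> s < t \<longrightarrow> S s \<omega> < S t \<omega>"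
proof -
  have step: "AE \<omega> in M. S s \<omega> < S t \<omega>" if "0 \<le> s" "s < t" for s t
  proof -
    have [measurable]: "S (t - s) \<in> borel_measurable M" "S s \<in> borel_measurable M" "S t \<in> borel_measurable M"
      using that by auto
    have "AE x in distr M borel (S (t - s)). 0 < x"
      by (subst AE_distr_iff) (use AE_S_pos[of "t - s"] that in auto)
    moreover have "distr M borel (\<lambda>\<omega>. S t \<omega> - S s \<omega>) = distr M borel (S (t - s))"
      using S_stationary[of s "t - s"] that by simp
    ultimately have "AE x in distr M borel (\<lambda>\<omega>. S t \<omega> - S s \<omega>). 0 < x" by (simp only:)
    then show ?thesis by (subst (asm) AE_distr_iff) auto
  qed
  have "AE \<omega> in M. \<forall>p\<in>\<rat>. \<forall>r\<in>\<rat>. 0 \<le> p \<and> p < r \<longrightarrow> S p \<omega> < S r \<omega>"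
    by (intro AE_ball_countable[THEN iffD2] ballI countable_rat AE_impI) (use step in auto)
  with AE_space show ?thesis
  proof eventually_elim
    case (elim \<omega>)
    show ?case
    proof (intro allI impI)
      fix s t :: real assume st: "0 \<le> s" "s < t"
      obtain p where p: "p \<in> \<rat>" "s < p" "p < t" using Rats_dense_in_real[OF st(2)] by blast
      obtain r where r: "r \<in> \<rat>" "p < r" "r < t" using Rats_dense_in_real[OF p(3)] by blast
      have "S s \<omega> \<le> S p \<omega>" using S_mono[OF elim(1), of s p] st p by simp
      also have "\<dots> < S r \<omega>" using elim(2) p r st by auto
      also have "\<dots> \<le> S t \<omega>" using S_mono[OF elim(1), of r t] st p r by simp
      finally show "S s \<omega> < S t \<omega>" .
    qed
  qed
qed

abbreviation T :: "real measure" where "T \<equiv> restrict_space lborel {0..}"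
abbreviation \<Omega> :: "(real \<times> 'w) measure" where "\<Omega> \<equiv> T \<Otimes>\<^sub>M M"

text \<open>
  For a monotone right-continuous path, \<open>S(s) < a\<close> holds exactly if \<open>S(q) < a\<close> for
  some rational \<open>q > s\<close>.
\<close>

lemma measurable_S_joint: "(\<lambda>p. S (fst p) (snd p)) \<in> borel_measurable \<Omega>"
proof (rule borel_measurableI_less)
  fix a
  have sp: "space \<Omega> = {0..} \<times> space M" by (simp add: space_pair_measure space_restrict_space)
  have "{p \<in> space \<Omega>. S (fst p) (snd p) < a} = (\<Union>q\<in>{q \<in> \<rat>. 0 \<le> q}. {0..<q} \<times> {\<omega> \<in> space M. S q \<omega> < a})"
  proof (intro equalityI subsetI)
    fix p assume "p \<in> {p \<in> space \<Omega>. S (fst p) (snd p) < a}"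
    then have p: "0 \<le> fst p" "snd p \<in> space M" "S (fst p) (snd p) < a" by (auto simp: sp)
    from order_tendstoD(2)[OF S_right_continuous[OF p(2,1)] p(3)]
    obtain y where y: "fst p < y" "\<And>s. fst p < s \<Longrightarrow> s < y \<Longrightarrow> S s (snd p) < a"
      unfolding eventually_at_right_field by blast
    obtain q where "q \<in> \<rat>" "fst p < q" "q < y" using Rats_dense_in_real[OF y(1)] by blast
    then show "p \<in> (\<Union>q\<in>{q \<in> \<rat>. 0 \<le> q}. {0..<q} \<times> {\<omega> \<in> space M. S q \<omega> < a})"
      using p y(2)[of q] by (intro UN_I[of q]) (auto simp: mem_Times_iff)
  next
    fix p assume "p \<in> (\<Union>q\<in>{q \<in> \<rat>. 0 \<le> q}. {0..<q} \<times> {\<omega> \<in> space M. S q \<omega> < a})"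
    then obtain q where q: "0 \<le> fst p" "fst p < q" "snd p \<in> space M" "S q (snd p) < a" by (auto simp: mem_Times_iff)
    then have "S (fst p) (snd p) < a" using S_mono[of "snd p" "fst p" q] by simp
    then show "p \<in> {p \<in> space \<Omega>. S (fst p) (snd p) < a}" using q by (simp add: sp mem_Times_iff)
  qed
  moreover have "(\<Union>q\<in>{q \<in> \<rat>. 0 \<le> q}. {0..<q} \<times> {\<omega> \<in> space M. S q \<omega> < a}) \<in> sets \<Omega>"
  proof (rule sets.countable_UN'')
    show "countable {q :: real. q \<in> \<rat> \<and> 0 \<le> q}" by (rule countable_subset[OF _ countable_rat]) auto
    show "{0..<q} \<times> {\<omega> \<in> space M. S q \<omega> < a} \<in> sets \<Omega>" if "q \<in> {q \<in> \<rat>. 0 \<le> q}" for q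
    proof (rule pair_measureI)
      show "{0..<q} \<in> sets T" by (auto simp: sets_restrict_space_iff)
      show "{\<omega> \<in> space M. S q \<omega> < a} \<in> sets M" using S_measurable[of q] that by simp
    qed
  qed
  ultimately show "{p \<in> space \<Omega>. S (fst p) (snd p) < a} \<in> sets \<Omega>" by simp
qed

sublocale T: sigma_finite_measure T
  by (rule sigma_finite_measure_restrict_space) (auto intro: sigma_finite_lborel)

sublocale TM: pair_sigma_finite T M ..

text \<open>
  The resolvent measure is realised on the product of time and probability space, with the value of the process
  as position and \<open>e\<^bsup>zs\<^esup>\<close> as weight.
\<close>

definition X :: "real \<times> 'w \<Rightarrow> real" where "X p = S (fst p) (snd p)"
definition b :: "complex \<Rightarrow> real \<times> 'w \<Rightarrow> complex" where "b z p = exp (z * of_real (fst p))"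

lemma X_measurable [measurable]: "X \<in> borel_measurable \<Omega>"
  unfolding X_def[abs_def] by (rule measurable_S_joint)

lemma exp_measurable_T: "(\<lambda>s. exp (z * complex_of_real s)) \<in> borel_measurable T"
proof -
  have "(\<lambda>s. exp (z * complex_of_real s)) \<in> borel_measurable lborel"
    using borel_measurable_continuous_onI[of "\<lambda>s. exp (z * complex_of_real s)"] by (simp add: continuous_intros)
  then show ?thesis by (rule measurable_restrict_space1)
qed

lemma b_measurable [measurable]: "b z \<in> borel_measurable \<Omega>"
  unfolding b_def[abs_def] by (rule measurable_compose[OF measurable_fst exp_measurable_T])

lemma sp_TM: "p \<in> space \<Omega> \<longleftrightarrow> 0 \<le> fst p \<and> snd p \<in> space M"
  by (auto simp: space_pair_measure space_restrict_space mem_Times_iff)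

text \<open>
  Integrating over the paths first leaves \<open>\<integral> e\<^bsup>-s (\<Phi>(q) - z)\<^esup> ds\<close>. The
  case \<open>q = 0\<close> with \<open>Re z < 0\<close> enters the decay estimate below.
\<close>

lemma
  assumes q: "0 \<le> q" and z: "Re z < laplace_exponent \<nu> q"
  shows integrable_resolvent_weight: "integrable \<Omega> (\<lambda>p. exp (- q * X p) *\<^sub>R b z p)"
    and integral_resolvent_weight: "(\<integral>p. exp (- q * X p) *\<^sub>R b z p \<partial>\<Omega>) = 1 / (of_real (laplace_exponent \<nu> q) - z)"
proof -
  let ?P = "laplace_exponent \<nu> q"
  let ?w = "of_real ?P - z"
  have w: "0 < Re ?w" using z by simp
  have ew: "exp (- s * ?P) *\<^sub>R exp (z * complex_of_real s) = exp (- ?w * of_real s)" for s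
    by (simp add: scaleR_conv_of_real exp_of_real[symmetric] exp_add[symmetric] algebra_simps)
  have s: "(\<integral>\<omega>. exp (- q * S s \<omega>) \<partial>M) = exp (- s * ?P)" if "0 \<le> s" for s
    using laplace_S[OF that q] .
  have m: "(\<lambda>p. exp (- q * X p) *\<^sub>R b z p) \<in> borel_measurable \<Omega>" by measurable
  have spT: "space T = {0..}" by (simp add: space_restrict_space)
  have iT: "integrable T (\<lambda>s. exp (- ?w * complex_of_real s))"
    by (subst integrable_restrict_space) (use laplace_exp(1)[OF w] in auto)
  show i: "integrable \<Omega> (\<lambda>p. exp (- q * X p) *\<^sub>R b z p)"
  proof (rule TM.Fubini_integrable[OF m])
    show "integrable T (\<lambda>x. \<integral>y. norm (exp (- q * X (x, y)) *\<^sub>R b z (x, y)) \<partial>M)"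
    proof (rule Bochner_Integration.integrable_cong[THEN iffD1, OF refl _ integrable_norm[OF iT]])
      fix x assume "x \<in> space T"
      then have x: "0 \<le> x" by (simp add: spT)
      have "(\<integral>y. norm (exp (- q * X (x, y)) *\<^sub>R b z (x, y)) \<partial>M) = (\<integral>y. exp (- q * S x y) * cmod (exp (z * of_real x)) \<partial>M)"
        by (simp add: X_def b_def del: norm_exp_eq_Re)
      also have "\<dots> = exp (- x * ?P) * cmod (exp (z * of_real x))" unfolding s[OF x, symmetric] by (rule integral_mult_left_zero)
      also have "\<dots> = norm (exp (- x * ?P) *\<^sub>R exp (z * complex_of_real x))" by simp
      finally show "norm (exp (- ?w * complex_of_real x)) = (\<integral>y. norm (exp (- q * X (x, y)) *\<^sub>R b z (x, y)) \<partial>M)"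
        unfolding ew by simp
    qed
    show "AE x in T. integrable M (\<lambda>y. exp (- q * X (x, y)) *\<^sub>R b z (x, y))"
    proof (rule AE_I2)
      fix x assume "x \<in> space T"
      then have x: "0 \<le> x" by (simp add: spT)
      show "integrable M (\<lambda>y. exp (- q * X (x, y)) *\<^sub>R b z (x, y))"
        unfolding X_def b_def fst_conv snd_conv by (intro integrable_scaleR_left integrable_exp_S x q)
    qed
  qed
  have "(\<integral>p. exp (- q * X p) *\<^sub>R b z p \<partial>\<Omega>) = (\<integral>x. \<integral>y. exp (- q * X (x, y)) *\<^sub>R b z (x, y) \<partial>M \<partial>T)"
    by (rule TM.integral_fst'[OF i, symmetric])
  also have "\<dots> = (\<integral>x. exp (- ?w * complex_of_real x) \<partial>T)"
  proof (rule Bochner_Integration.integral_cong[OF refl])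
    fix x assume "x \<in> space T"
    then have x: "0 \<le> x" by (simp add: spT)
    have "(\<integral>y. exp (- q * X (x, y)) *\<^sub>R b z (x, y) \<partial>M) = (\<integral>y. exp (- q * S x y) \<partial>M) *\<^sub>R exp (z * of_real x)"
      unfolding X_def b_def fst_conv snd_conv by (rule integral_scaleR_left) (intro impI integrable_exp_S x q)
    then show "(\<integral>y. exp (- q * X (x, y)) *\<^sub>R b z (x, y) \<partial>M) = exp (- ?w * complex_of_real x)"
      unfolding s[OF x] ew .
  qed
  also have "\<dots> = 1 / ?w"
    by (subst integral_restrict_space) (use laplace_exp(2)[OF w] in auto)
  finally show "(\<integral>p. exp (- q * X p) *\<^sub>R b z p \<partial>\<Omega>) = 1 / ?w" .
qed

lemma resolvent: assumes "Re z \<le> 0" shows "resolvent \<nu> \<Omega> X (b z) z"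
proof -
  interpret P: sigma_finite_measure \<Omega> by (rule TM.P.sigma_finite_measure_axioms)
  show ?thesis
  proof
    show "0 \<le> X p" if "p \<in> space \<Omega>" for p
      using that S_nonneg by (simp add: X_def sp_TM)
    fix q :: real assume "0 < q"
    then have "0 \<le> q" "Re z < laplace_exponent \<nu> q" using laplace_exponent_pos[of q] assms by auto
    from integrable_resolvent_weight[OF this] integral_resolvent_weight[OF this]
    show "integrable \<Omega> (\<lambda>n. exp (- q * X n) *\<^sub>R b z n)"
      "(\<integral>n. exp (- q * X n) *\<^sub>R b z n \<partial>\<Omega>) = 1 / (of_real (laplace_exponent \<nu> q) - z)" .
  qed (use assms in auto)
qed

text \<open>
  A strictly increasing path takes the value \<open>t\<close> at most once; so the resolvent measure has no
  atoms.
\<close>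

lemma AE_X_neq: assumes "0 \<le> t" shows "AE p in \<Omega>. X p \<noteq> t"
proof -
  have m: "{p \<in> space \<Omega>. X p \<noteq> t} \<in> sets \<Omega>" by measurable
  have "AE \<omega> in M. AE s in T. X (s, \<omega>) \<noteq> t"
    using AE_S_strict
  proof eventually_elim
    case (elim \<omega>)
    have inc: "S r \<omega> < S r' \<omega>" if "0 \<le> r" "r < r'" for r r' using elim that by blast
    show ?case
    proof (cases "\<exists>s0\<ge>0. S s0 \<omega> = t")
      case True
      then obtain s0 where s0: "0 \<le> s0" "S s0 \<omega> = t" by blast
      have "AE s in lborel. s \<noteq> s0" by (rule AE_lborel_singleton)
      then have "AE s in lborel. s \<in> {0..} \<longrightarrow> X (s, \<omega>) \<noteq> t"
      proof eventually_elim
        case (elim s)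
        then show ?case using inc[of s s0] inc[of s0 s] s0
          by (cases s s0 rule: linorder_cases) (auto simp: X_def)
      qed
      then show ?thesis by (subst AE_restrict_space_iff) auto
    next
      case False
      then show ?thesis by (intro AE_I2) (auto simp: X_def space_restrict_space)
    qed
  qed
  then have "AE s in T. AE \<omega> in M. X (s, \<omega>) \<noteq> t"
    using TM.AE_commute[of "\<lambda>s \<omega>. X (s, \<omega>) \<noteq> t"] m by (simp add: case_prod_beta')
  then show ?thesis using TM.AE_pair_measure[OF m] by simp
qed

text \<open>
  The infimum is over a nonempty set since the path is unbounded, and monotonicity of the path gives the two
  comparisons.
\<close>

lemma AE_inverse_process:
  "AE \<omega> in M. \<forall>t\<ge>0. 0 \<le> inverse_process S t \<omega> \<and> (\<forall>s>inverse_process S t \<omega>. t < S s \<omega>)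
     \<and> (\<forall>s. 0 \<le> s \<longrightarrow> s < inverse_process S t \<omega> \<longrightarrow> S s \<omega> \<le> t)"
  using AE_S_unbounded AE_space
proof eventually_elim
  case (elim \<omega>)
  show ?case
  proof (intro allI impI)
    fix t :: real assume t: "0 \<le> t"
    let ?A = "{s. 0 < s \<and> t < S s \<omega>}"
    let ?L = "inverse_process S t \<omega>"
    obtain n :: nat where n: "t < S (real n) \<omega>" using elim(1) by blast
    then have "0 < real n" using S_0[OF elim(2)] t by (cases "n = 0") auto
    then have ne: "?A \<noteq> {}" using n by blast
    have bdd: "bdd_below ?A" by (rule bdd_belowI[of _ 0]) auto
    have L0: "0 \<le> ?L" unfolding inverse_process_def by (rule cInf_greatest[OF ne]) auto
    moreover have "t < S s \<omega>" if gt: "?L < s" for s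
    proof -
      obtain r where r: "r \<in> ?A" "r < s" using cInf_lessD[OF ne gt[unfolded inverse_process_def]] by blast
      then show ?thesis using S_mono[OF elim(2), of r s] by auto
    qed
    moreover have "S s \<omega> \<le> t" if "0 \<le> s" "s < ?L" for s
    proof (rule ccontr)
      assume n: "\<not> S s \<omega> \<le> t"
      then have "s \<noteq> 0" using S_0[OF elim(2)] t by auto
      then have "s \<in> ?A" using n that by auto
      then have "?L \<le> s" unfolding inverse_process_def by (rule cInf_lower[OF _ bdd])
      then show False using that by simp
    qed
    ultimately show "0 \<le> ?L \<and> (\<forall>s>?L. t < S s \<omega>) \<and> (\<forall>s. 0 \<le> s \<longrightarrow> s < ?L \<longrightarrow> S s \<omega> \<le> t)" by blast
  qed
qed

lemma inverse_process_measurable [measurable]: "inverse_process S t \<in> borel_measurable M"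
proof (rule borel_measurableI_less)
  fix a
  let ?E = "\<lambda>\<omega>. {s. 0 < s \<and> t < S s \<omega>}"
  have ex: "(\<exists>s. 0 < s \<and> s < c \<and> t < S s \<omega>) \<longleftrightarrow> (\<exists>r\<in>{r \<in> \<rat>. 0 < r \<and> r < c}. t < S r \<omega>)" if "\<omega> \<in> space M" for \<omega> c
  proof
    assume "\<exists>s. 0 < s \<and> s < c \<and> t < S s \<omega>"
    then obtain s where s: "0 < s" "s < c" "t < S s \<omega>" by blast
    obtain r where "r \<in> \<rat>" "s < r" "r < c" using Rats_dense_in_real[OF s(2)] by blast
    then show "\<exists>r\<in>{r \<in> \<rat>. 0 < r \<and> r < c}. t < S r \<omega>"
      using s S_mono[OF that, of s r] by (intro bexI[of _ r]) auto
  qed auto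
  \<comment> \<open>The second set consists of the paths that never exceed \<open>t\<close>, where the infimum is over the empty set and has a default value.\<close>
  have "{\<omega> \<in> space M. inverse_process S t \<omega> < a}
      = {\<omega> \<in> space M. \<exists>r\<in>{r \<in> \<rat>. 0 < r \<and> r < a}. t < S r \<omega>} \<union> {\<omega> \<in> space M. (\<forall>n\<in>{n::nat. 0 < n}. \<not> t < S (real n) \<omega>) \<and> Inf {} < a}" (is "?L = ?R")
  proof (rule set_eqI)
    fix \<omega>
    show "\<omega> \<in> ?L \<longleftrightarrow> \<omega> \<in> ?R"
    proof (cases "\<omega> \<in> space M")
      case sp: True
      show ?thesis
      proof (cases "?E \<omega> = {}")
        case True
        then have "inverse_process S t \<omega> = Inf {}" by (simp only: inverse_process_def)
        moreover have "\<not> t < S s \<omega>" if "0 < s" for s using True that by blast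
        ultimately show ?thesis using sp by auto
      next
        case False
        then obtain s where s: "0 < s" "t < S s \<omega>" by blast
        obtain n :: nat where n: "s \<le> real n" using real_arch_simple by blast
        then have n': "0 < n" "t < S (real n) \<omega>" using s S_mono[OF sp, of s "real n"] by auto
        have bdd: "bdd_below (?E \<omega>)" by (rule bdd_belowI[of _ 0]) auto
        have "inverse_process S t \<omega> < a \<longleftrightarrow> (\<exists>s. 0 < s \<and> s < a \<and> t < S s \<omega>)"
          unfolding inverse_process_def cInf_less_iff[OF False bdd] by auto
        then show ?thesis using sp n' ex[OF sp, of a] by auto
      qed
    qed auto
  qed
  moreover have "?R \<in> sets M"
  proof (rule sets.Un)
    show "{\<omega> \<in> space M. \<exists>r\<in>{r \<in> \<rat>. 0 < r \<and> r < a}. t < S r \<omega>} \<in> sets M"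
    proof (rule sets.sets_Collect_countable_Ex')
      show "countable {r :: real. r \<in> \<rat> \<and> 0 < r \<and> r < a}" by (rule countable_subset[OF _ countable_rat]) auto
      show "{\<omega> \<in> space M. t < S r \<omega>} \<in> sets M" if "r \<in> {r \<in> \<rat>. 0 < r \<and> r < a}" for r
        using S_measurable[of r] that by simp
    qed
    show "{\<omega> \<in> space M. (\<forall>n\<in>{n::nat. 0 < n}. \<not> t < S (real n) \<omega>) \<and> Inf {} < a} \<in> sets M"
      by measurable
  qed
  ultimately show "{\<omega> \<in> space M. inverse_process S t \<omega> < a} \<in> sets M" by simp
qed

lemma integral_exp_interval:
  assumes "0 \<le> L"
  shows "z * (\<integral>s. indicator {0..L} s *\<^sub>R exp (z * complex_of_real s) \<partial>lborel) = exp (z * of_real L) - 1"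
proof -
  have A: "(\<integral>s. indicator {0..L} s *\<^sub>R (z * exp (z * complex_of_real s)) \<partial>lborel) = exp (z * of_real L) - exp (z * of_real 0)"
  proof (rule integral_FTC_Icc[OF assms])
    show "((\<lambda>s. exp (z * complex_of_real s)) has_vector_derivative z * exp (z * complex_of_real x)) (at x within {0..L})" for x
    proof -
      have "((\<lambda>w. exp (z * w)) has_field_derivative z * exp (z * of_real x)) (at (of_real x))"
        by (auto intro!: derivative_eq_intros)
      then show ?thesis by (auto intro: has_vector_derivative_real_field has_vector_derivative_at_within)
    qed
  qed (auto intro!: continuous_intros)
  have B: "indicator {0..L} s *\<^sub>R (z * exp (z * complex_of_real s)) = z * (indicator {0..L} s *\<^sub>R exp (z * complex_of_real s))" for s
    by (rule mult_scaleR_right[symmetric])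
  show ?thesis using A unfolding B integral_mult_right_zero by simp
qed

text \<open>
  \<open>e\<^bsup>z L(t)\<^esup> = 1 + z \<integral>\<^sub>0\<^bsup>L(t)\<^esup> e\<^bsup>zs\<^esup> ds\<close>,
  and the range of integration is \<open>S(s) \<le> t\<close> up to a point.
\<close>

lemma relaxation_eq:
  assumes z: "Re z \<le> 0" and t: "0 \<le> t"
  shows "relaxation M S t z = resolvent.relax \<Omega> X (b z) z t"
proof -
  interpret R: resolvent \<nu> \<Omega> X "b z" z by (rule resolvent[OF z])
  define F where "F p = b z p * heaviside (t - X p)" for p
  have F: "F = (\<lambda>p. indicator {..t} (X p) *\<^sub>R b z p)" by (auto simp: F_def indicator_def)
  have iF: "integrable \<Omega> F" unfolding F by (rule R.integrable_weight)
  have iF': "integrable \<Omega> (case_prod (\<lambda>x y. F (x, y)))" using iF by (simp add: case_prod_beta')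
  have "R.wconv heaviside t = (\<integral>\<omega>. \<integral>s. F (s, \<omega>) \<partial>T \<partial>M)"
    unfolding R.wconv_def F_def[symmetric] using TM.integral_snd[OF iF'] by (simp add: case_prod_beta')
  moreover have iS: "integrable M (\<lambda>\<omega>. \<integral>s. F (s, \<omega>) \<partial>T)"
    using TM.integrable_snd[OF iF'] .
  ultimately have "R.relax t = (\<integral>\<omega>. 1 + z * (\<integral>s. F (s, \<omega>) \<partial>T) \<partial>M)"
    by (simp add: R.relax_def prob.prob_space)
  also have "\<dots> = (\<integral>\<omega>. exp (z * of_real (inverse_process S t \<omega>)) \<partial>M)"
  proof (rule integral_cong_AE)
    show "AE \<omega> in M. 1 + z * (\<integral>s. F (s, \<omega>) \<partial>T) = exp (z * of_real (inverse_process S t \<omega>))"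
      using AE_inverse_process AE_space
    proof eventually_elim
      case (elim \<omega>)
      let ?L = "inverse_process S t \<omega>"
      have L: "0 \<le> ?L" "\<And>s. ?L < s \<Longrightarrow> t < S s \<omega>" "\<And>s. 0 \<le> s \<Longrightarrow> s < ?L \<Longrightarrow> S s \<omega> \<le> t"
        using elim t by auto
      have "(\<integral>s. F (s, \<omega>) \<partial>T) = (\<integral>s. indicator {0..?L} s *\<^sub>R exp (z * complex_of_real s) \<partial>T)"
      proof (rule integral_cong_AE)
        show "(\<lambda>s. F (s, \<omega>)) \<in> borel_measurable T"
          by (rule measurable_compose[OF measurable_Pair2'[OF elim(2)] borel_measurable_integrable[OF iF]])
        have "(\<lambda>s. indicator {0..?L} s *\<^sub>R exp (z * complex_of_real s)) \<in> borel_measurable lborel"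
          using borel_measurable_continuous_onI[of "\<lambda>s. exp (z * complex_of_real s)"] by (simp add: continuous_intros)
        then show "(\<lambda>s. indicator {0..?L} s *\<^sub>R exp (z * complex_of_real s)) \<in> borel_measurable T"
          by (rule measurable_restrict_space1)
        have "AE s in lborel. s \<noteq> ?L" by (rule AE_lborel_singleton)
        then have "AE s in lborel. s \<in> {0..} \<longrightarrow> F (s, \<omega>) = indicator {0..?L} s *\<^sub>R exp (z * complex_of_real s)"
        proof eventually_elim
          case (elim s)
          then show ?case using L(2)[of s] L(3)[of s]
            by (cases s ?L rule: linorder_cases) (auto simp: F_def b_def X_def indicator_def)
        qed
        then show "AE s in T. F (s, \<omega>) = indicator {0..?L} s *\<^sub>R exp (z * complex_of_real s)"
          by (subst AE_restrict_space_iff) auto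
      qed
      also have "\<dots> = (\<integral>s. indicator {0..?L} s *\<^sub>R exp (z * complex_of_real s) \<partial>lborel)"
        by (subst integral_restrict_space) (auto intro!: Bochner_Integration.integral_cong simp: indicator_def)
      finally show ?case using integral_exp_interval[OF L(1), of z] by simp
    qed
    show "(\<lambda>\<omega>. 1 + z * (\<integral>s. F (s, \<omega>) \<partial>T)) \<in> borel_measurable M" using iS by auto
  qed measurable
  finally show ?thesis by (simp add: relaxation_def)
qed

lemma integrable_exp_inverse:
  assumes t: "0 \<le> t" and z: "Re z \<le> 0"
  shows "integrable M (\<lambda>\<omega>. exp (z * of_real (inverse_process S t \<omega>)))"
proof (rule prob.integrable_const_bound[where B=1])
  show "AE \<omega> in M. cmod (exp (z * of_real (inverse_process S t \<omega>))) \<le> 1"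
    using AE_inverse_process
  proof eventually_elim
    case (elim \<omega>)
    then have "0 \<le> inverse_process S t \<omega>" using t by blast
    then show ?case using z by (simp add: mult_nonpos_nonneg)
  qed
qed measurable

lemma norm_relaxation_le:
  assumes t: "0 \<le> t" and z: "Re z \<le> 0"
  shows "cmod (relaxation M S t z) \<le> Re (relaxation M S t (of_real (Re z)))" "cmod (relaxation M S t z) \<le> 1"
proof -
  have e: "cmod (exp (z * of_real (inverse_process S t \<omega>))) = Re (exp (of_real (Re z) * of_real (inverse_process S t \<omega>)))" for \<omega>
    by (simp add: Re_exp)
  have i: "integrable M (\<lambda>\<omega>. exp (of_real (Re z) * complex_of_real (inverse_process S t \<omega>)))"
    using integrable_exp_inverse[OF t, of "of_real (Re z)"] z by simp
  have "cmod (relaxation M S t z) \<le> (\<integral>\<omega>. cmod (exp (z * of_real (inverse_process S t \<omega>))) \<partial>M)"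
    unfolding relaxation_def by (rule integral_norm_bound)
  also have "\<dots> = Re (relaxation M S t (of_real (Re z)))"
    unfolding e relaxation_def by (rule integral_Re[OF i])
  finally show "cmod (relaxation M S t z) \<le> Re (relaxation M S t (of_real (Re z)))" .
  have "cmod (relaxation M S t z) \<le> (\<integral>\<omega>. cmod (exp (z * of_real (inverse_process S t \<omega>))) \<partial>M)"
    unfolding relaxation_def by (rule integral_norm_bound)
  also have "\<dots> \<le> 1"
  proof (rule prob.integral_le_const)
    show "integrable M (\<lambda>\<omega>. cmod (exp (z * of_real (inverse_process S t \<omega>))))"
      by (intro integrable_norm integrable_exp_inverse t z)
    show "AE \<omega> in M. cmod (exp (z * of_real (inverse_process S t \<omega>))) \<le> 1"
      using AE_inverse_process
    proof eventually_elim
      case (elim \<omega>)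
      then have "0 \<le> inverse_process S t \<omega>" using t by blast
      then show ?case using z by (simp add: mult_nonpos_nonneg)
    qed
  qed
  finally show "cmod (relaxation M S t z) \<le> 1" .
qed

text \<open>
  Taking absolute values reduces to \<open>z = -a\<close>, where
  \<open>E e\<^bsup>-a L(t)\<^esup> = 1 - a E \<integral> e\<^bsup>-as\<^esup> 1(S(s) \<le> t) ds\<close>. The
  indicator of \<open>y \<le> t\<close> dominates, for \<open>y \<ge> 0\<close>, the function
  \<open>(e\<^bsup>-y\<^esup> - e\<^bsup>-t\<^esup>) / (1 - e\<^bsup>-t\<^esup>)\<close>, and the integral of
  this minorant is known from the Laplace transforms of the resolvent measure at \<open>q = 1\<close> and
  \<open>q = 0\<close>.
\<close>

lemma relaxation_decay:
  assumes t: "0 < t" and z: "Re z < 0"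
  shows "cmod (relaxation M S t z) \<le> laplace_exponent \<nu> 1 / (1 - exp (- t)) / (- Re z)"
proof -
  define a where "a = - Re z"
  have a: "0 < a" using z by (simp add: a_def)
  let ?P = "laplace_exponent \<nu> 1" and ?z = "complex_of_real (- a)"
  have P: "0 < ?P" using laplace_exponent_pos[of 1] by simp
  have P0: "laplace_exponent \<nu> 0 = 0" by (simp add: laplace_exponent_def)
  have za: "Re ?z \<le> 0" "Re ?z < ?P" "Re ?z < laplace_exponent \<nu> 0" using a P P0 by auto
  interpret R: resolvent \<nu> \<Omega> X "b ?z" ?z by (rule resolvent[OF za(1)])
  have bz: "b ?z p = of_real (exp (- a * fst p))" for p by (simp add: b_def exp_of_real[symmetric])
  define g1 where "g1 p = indicator {..t} (X p) * exp (- a * fst p)" for p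
  define g2 where "g2 p = exp (- 1 * X p) * exp (- a * fst p)" for p
  define g3 where "g3 p = exp (- 0 * X p) * exp (- a * fst p)" for p
  have r1: "of_real (g1 p) = indicator {..t} (X p) *\<^sub>R b ?z p" for p unfolding bz g1_def by (simp add: scaleR_conv_of_real)
  have r2: "of_real (g2 p) = exp (- 1 * X p) *\<^sub>R b ?z p" for p unfolding bz g2_def by (simp add: scaleR_conv_of_real)
  have r3: "of_real (g3 p) = exp (- 0 * X p) *\<^sub>R b ?z p" for p unfolding bz g3_def by (simp add: scaleR_conv_of_real)
  have c1: "integrable \<Omega> (\<lambda>p. complex_of_real (g1 p))" unfolding r1 by (rule R.integrable_weight)
  have c2: "integrable \<Omega> (\<lambda>p. complex_of_real (g2 p))" unfolding r2 by (rule integrable_resolvent_weight) (use za in auto)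
  have c3: "integrable \<Omega> (\<lambda>p. complex_of_real (g3 p))" unfolding r3 by (rule integrable_resolvent_weight) (use za in auto)
  have i: "integrable \<Omega> g1" "integrable \<Omega> g2" "integrable \<Omega> g3"
    using integrable_Re[OF c1] integrable_Re[OF c2] integrable_Re[OF c3] by simp_all
  have v2: "(\<integral>p. g2 p \<partial>\<Omega>) = 1 / (?P + a)"
  proof -
    have "complex_of_real (\<integral>p. g2 p \<partial>\<Omega>) = 1 / (of_real ?P - ?z)"
      unfolding integral_complex_of_real[symmetric] r2 by (rule integral_resolvent_weight) (use za in auto)
    also have "\<dots> = of_real (1 / (?P + a))" by simp
    finally show ?thesis by (simp only: of_real_eq_iff)
  qed
  have v3: "(\<integral>p. g3 p \<partial>\<Omega>) = 1 / a"
  proof -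
    have "complex_of_real (\<integral>p. g3 p \<partial>\<Omega>) = 1 / (of_real (laplace_exponent \<nu> 0) - ?z)"
      unfolding integral_complex_of_real[symmetric] r3 by (rule integral_resolvent_weight) (use za in auto)
    also have "\<dots> = of_real (1 / a)" using P0 by simp
    finally show ?thesis by (simp only: of_real_eq_iff)
  qed
  have et: "0 < 1 - exp (- t)" using t by simp
  have "(1 / (?P + a) - exp (- t) / a) / (1 - exp (- t)) = (\<integral>p. (g2 p - exp (- t) * g3 p) / (1 - exp (- t)) \<partial>\<Omega>)"
    using i v2 v3 by simp
  also have "\<dots> \<le> (\<integral>p. g1 p \<partial>\<Omega>)"
  proof (rule integral_mono)
    fix p assume p: "p \<in> space \<Omega>"
    have "exp (- X p) - exp (- t) \<le> indicator {..t} (X p) * (1 - exp (- t))"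
      using R.X_nonneg[OF p] by (auto simp: indicator_def)
    then have "(exp (- X p) - exp (- t)) / (1 - exp (- t)) \<le> indicator {..t} (X p)"
      using et by (simp add: divide_le_eq)
    from mult_right_mono[OF this, of "exp (- a * fst p)"]
    show "(g2 p - exp (- t) * g3 p) / (1 - exp (- t)) \<le> g1 p"
      by (simp add: g1_def g2_def g3_def left_diff_distrib)
  qed (use i in auto)
  finally have low: "(1 / (?P + a) - exp (- t) / a) / (1 - exp (- t)) \<le> (\<integral>p. g1 p \<partial>\<Omega>)" .
  have w: "R.wconv heaviside t = of_real (\<integral>p. g1 p \<partial>\<Omega>)"
    unfolding R.wconv_def integral_complex_of_real[symmetric]
    by (rule Bochner_Integration.integral_cong) (auto simp: r1 indicator_def)
  have "cmod (relaxation M S t z) \<le> Re (relaxation M S t ?z)"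
    using norm_relaxation_le(1)[of t z] t z by (simp add: a_def)
  also have "\<dots> = 1 - a * (\<integral>p. g1 p \<partial>\<Omega>)"
    unfolding relaxation_eq[OF za(1) less_imp_le[OF t]] R.relax_def w by simp
  also have "\<dots> \<le> 1 - a * ((1 / (?P + a) - exp (- t) / a) / (1 - exp (- t)))"
    by (rule diff_left_mono[OF mult_left_mono[OF low less_imp_le[OF a]]])
  also have "\<dots> = ?P / (?P + a) / (1 - exp (- t))"
  proof -
    have "1 - a * ((1 / (p + a) - e / a) / (1 - e)) = p / (p + a) / (1 - e)" if "0 < p" "e < 1" for p e :: real
    proof -
      have "1 / (p + a) - e / a = (a - e * (p + a)) / ((p + a) * a)" "1 - e \<noteq> 0" "p + a \<noteq> 0"
        using that a by (auto simp: field_simps)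
      then show ?thesis using a by (simp add: divide_simps) (simp add: algebra_simps)
    qed
    from this[OF P, of "exp (- t)"] show ?thesis using et by simp
  qed
  also have "\<dots> \<le> ?P / a / (1 - exp (- t))"
    using et a P by (intro divide_right_mono divide_left_mono) auto
  finally show ?thesis by (simp add: a_def mult.commute)
qed

end

section \<open>The generator, and pairings of curves with test functions\<close>

text \<open>
  Tannery's theorem with limit \<open>0\<close>.
\<close>

lemma tendsto_suminf_zero:
  fixes a :: "nat \<Rightarrow> 'b \<Rightarrow> real"
  assumes lim: "\<And>l. ((\<lambda>s. a l s) \<longlongrightarrow> 0) F" and bound: "\<forall>\<^sub>F s in F. \<forall>l. \<bar>a l s\<bar> \<le> B l" and B: "summable B"
  shows "((\<lambda>s. \<Sum>l. a l s) \<longlongrightarrow> 0) F"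
proof (cases "F = bot")
  case False
  have "\<forall>\<^sub>F p in at_top \<times>\<^sub>F F. True \<and> (\<forall>l. \<bar>a l (snd p)\<bar> \<le> B l)"
    by (rule eventually_prodI) (use bound in auto)
  then have "\<forall>\<^sub>F (l, s) in at_top \<times>\<^sub>F F. norm (a l s) \<le> B l"
    by (rule eventually_mono) auto
  from tannerys_theorem[OF lim this B False] show ?thesis by simp
qed simp

text \<open>
  The pairing in the weak equation is bilinear whereas coefficients involve a conjugate; conjugation takes
  \<open>Y\<^sub>l\<^sub>m\<close> to a multiple of \<open>Y\<^sub>l\<^sub>,\<^sub>-\<^sub>m\<close>.
\<close>

lemma minus_harmonic_integral:
  assumes m: "nat \<bar>m\<bar> \<le> l"
  shows "(\<integral>x. v x * sph_harm l m x \<partial>\<sigma>) = (-1) ^ nat \<bar>m\<bar> * sph_coeff v l (- m)"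
proof -
  have "v x * sph_harm l m x = (-1) ^ nat \<bar>m\<bar> * (v x * cnj (sph_harm l (- m) x))" if "x \<in> sphere 0 1" for x
    using sph_harm_neg[of "- m" l x] m that by simp
  then have "(\<integral>x. v x * sph_harm l m x \<partial>\<sigma>) = (\<integral>x. (-1) ^ nat \<bar>m\<bar> * (v x * cnj (sph_harm l (- m) x)) \<partial>\<sigma>)"
    by (intro Bochner_Integration.integral_cong) auto
  then show ?thesis by (simp add: sph_coeff_def)
qed

lemma pairing_partial_sum:
  assumes v: "v \<in> L2_sphere"
  shows "(\<integral>x. v x * sph_partial_sum c n x \<partial>\<sigma>) = (\<Sum>(l, m)\<in>sph_idx n. c l m * ((-1) ^ nat \<bar>m\<bar> * sph_coeff v l (- m)))"
proof -
  have val: "nat \<bar>snd p\<bar> \<le> fst p" if "p \<in> sph_idx n" for p using that by (cases p) (simp add: sph_idx_iff)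
  have "(\<integral>x. v x * sph_partial_sum c n x \<partial>\<sigma>) = (\<integral>x. (\<Sum>p\<in>sph_idx n. c (fst p) (snd p) * (v x * sph_harm (fst p) (snd p) x)) \<partial>\<sigma>)"
    by (simp add: sph_partial_sum_idx sum_distrib_left mult_ac)
  also have "\<dots> = (\<Sum>p\<in>sph_idx n. \<integral>x. c (fst p) (snd p) * (v x * sph_harm (fst p) (snd p) x) \<partial>\<sigma>)"
    by (rule Bochner_Integration.integral_sum) (intro integrable_mult_right L2_prod_integrable v sph_harm_L2 val)
  also have "\<dots> = (\<Sum>(l, m)\<in>sph_idx n. c l m * ((-1) ^ nat \<bar>m\<bar> * sph_coeff v l (- m)))"
    by (rule sum.cong[OF refl]) (use minus_harmonic_integral val in \<open>auto simp: sph_idx_iff\<close>)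
  finally show ?thesis .
qed

text \<open>
  The reason why the test function in the weak equation is acted on by the generator with \<open>-\<mu>\<close>.
\<close>

lemma gen_eigenvalue_minus: "gen_eigenvalue (- \<mu>) l m = gen_eigenvalue \<mu> l (- m)"
  by (simp add: gen_eigenvalue_def)

lemma Re_gen_eigenvalue: "Re (gen_eigenvalue \<mu> l m) = - (real l * (real l + 1))"
  by (simp add: gen_eigenvalue_def)

lemma Re_gen_eigenvalue_le: "Re (gen_eigenvalue \<mu> l m) \<le> 0"
  unfolding Re_gen_eigenvalue by simp

lemma norm_gen_eigenvalue:
  assumes "nat \<bar>m\<bar> \<le> l" shows "cmod (gen_eigenvalue \<mu> l m) \<le> (\<bar>\<mu>\<bar> + 2) * (real l)\<^sup>2"
proof (cases "l = 0")
  case True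
  then show ?thesis using assms by (simp add: gen_eigenvalue_def)
next
  case False
  then have l: "1 \<le> real l" by simp
  have l2: "real l \<le> (real l)\<^sup>2" using l by (simp add: power2_eq_square)
  have m: "\<bar>real_of_int m\<bar> \<le> real l" using assms by linarith
  have "cmod (gen_eigenvalue \<mu> l m) \<le> cmod (\<i> * of_real \<mu> * of_int m) + cmod (of_nat l * (of_nat l + 1))"
    unfolding gen_eigenvalue_def by (rule norm_triangle_ineq4)
  also have "cmod (\<i> * of_real \<mu> * of_int m) = \<bar>\<mu>\<bar> * \<bar>real_of_int m\<bar>" by (simp add: norm_mult)
  also have "cmod (of_nat l * (of_nat l + 1)) = real l * (real l + 1)"
  proof -
    have "of_nat l * (of_nat l + 1) = complex_of_real (real l * (real l + 1))" by simp
    then show ?thesis by (simp only: norm_of_real) simp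
  qed
  also have "\<bar>\<mu>\<bar> * \<bar>real_of_int m\<bar> + real l * (real l + 1) \<le> \<bar>\<mu>\<bar> * (real l)\<^sup>2 + 2 * (real l)\<^sup>2"
  proof (rule add_mono)
    show "\<bar>\<mu>\<bar> * \<bar>real_of_int m\<bar> \<le> \<bar>\<mu>\<bar> * (real l)\<^sup>2" using order_trans[OF m l2] by (intro mult_left_mono) auto
    show "real l * (real l + 1) \<le> 2 * (real l)\<^sup>2" using l2 by (simp add: power2_eq_square algebra_simps)
  qed
  finally show ?thesis by (simp add: distrib_right)
qed

lemma coeff_power_mono:
  assumes "\<And>m. nat \<bar>m\<bar> \<le> l \<Longrightarrow> cmod (c l m) \<le> K * cmod (d l m)"
  shows "coeff_power c l \<le> K\<^sup>2 * coeff_power d l"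
  unfolding coeff_power_def sum_distrib_left
proof (rule sum_mono)
  fix m assume "m \<in> {- int l..int l}"
  then have "cmod (c l m) \<le> K * cmod (d l m)" by (intro assms) auto
  then have "(cmod (c l m))\<^sup>2 \<le> (K * cmod (d l m))\<^sup>2" by (rule power_mono) simp
  then show "(cmod (c l m))\<^sup>2 \<le> K\<^sup>2 * (cmod (d l m))\<^sup>2" by (simp add: power_mult_distrib)
qed

lemma coeff_power_diff_le: "coeff_power (\<lambda>l m. c l m - d l m) l \<le> 2 * coeff_power c l + 2 * coeff_power d l"
  unfolding coeff_power_def sum_distrib_left sum.distrib[symmetric]
proof (rule sum_mono)
  fix m
  have "(cmod (c l m - d l m))\<^sup>2 \<le> (cmod (c l m) + cmod (d l m))\<^sup>2"
    by (intro power_mono norm_triangle_ineq4) simp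
  then show "(cmod (c l m - d l m))\<^sup>2 \<le> 2 * (cmod (c l m))\<^sup>2 + 2 * (cmod (d l m))\<^sup>2"
    using sum_squares_bound[of "cmod (c l m)" "cmod (d l m)"] by (simp add: power2_sum)
qed

lemma sph_power_cong: "(\<And>m. nat \<bar>m\<bar> \<le> l \<Longrightarrow> sph_coeff g l m = c l m) \<Longrightarrow> sph_power g l = coeff_power c l"
  unfolding sph_power_def coeff_power_def by (intro sum.cong) auto

lemma sobolev_weight: "real l powr (2 * 2) = real l ^ 4"
  by (cases "l = 0") (simp_all add: powr_numeral)

lemma sobolev_2_iff: "h \<in> sobolev 2 \<longleftrightarrow> h \<in> L2_sphere \<and> summable (\<lambda>l. real l ^ 4 * sph_power h l)"
  by (simp add: sobolev_def sobolev_weight)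

text \<open>
  The eigenvalues grow at most like \<open>l\<^sup>2\<close>, so the series that defines the generator converges
  in \<open>L\<^sup>2\<close> on \<open>H\<^sup>2\<close>.
\<close>

lemma gen_op_sums:
  assumes h: "h \<in> sobolev 2"
  shows "sph_sums (\<lambda>l m. gen_eigenvalue \<mu> l m * sph_coeff h l m) (gen_op \<mu> h)"
  unfolding gen_op_def
proof (rule sph_sums_suminf)
  let ?c = "\<lambda>l m. gen_eigenvalue \<mu> l m * sph_coeff h l m"
  have s: "summable (\<lambda>l. (\<bar>\<mu>\<bar> + 2)\<^sup>2 * (real l ^ 4 * sph_power h l))"
    using h by (intro summable_mult) (simp add: sobolev_2_iff)
  show "summable (coeff_power ?c)"
  proof (rule summable_comparison_test'[OF s])
    fix l :: nat
    have "coeff_power ?c l \<le> ((\<bar>\<mu>\<bar> + 2) * (real l)\<^sup>2)\<^sup>2 * coeff_power (sph_coeff h) l"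
      by (rule coeff_power_mono) (auto simp: norm_mult intro!: mult_right_mono norm_gen_eigenvalue)
    also have "((\<bar>\<mu>\<bar> + 2) * (real l)\<^sup>2)\<^sup>2 = (\<bar>\<mu>\<bar> + 2)\<^sup>2 * real l ^ 4"
      by (simp add: power_mult_distrib power_mult[symmetric])
    finally show "norm (coeff_power ?c l) \<le> (\<bar>\<mu>\<bar> + 2)\<^sup>2 * (real l ^ 4 * sph_power h l)"
      by (simp add: sph_power_coeff coeff_power_nonneg mult.assoc)
  qed
qed

lemma sph_harm_sobolev:
  assumes m: "nat \<bar>m\<bar> \<le> l" shows "sph_harm l m \<in> sobolev 2"
  unfolding sobolev_2_iff
proof (intro conjI sph_harm_L2[OF m])
  have "sph_power (sph_harm l m) k = 0" if "k \<noteq> l" for k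
    unfolding sph_power_def sph_coeff_def using that
    by (intro sum.neutral ballI) (use sph_harm_orthonormal[OF m] in auto)
  then have "real k ^ 4 * sph_power (sph_harm l m) k = 0" if "k \<notin> {l}" for k using that by simp
  then show "summable (\<lambda>k. real k ^ 4 * sph_power (sph_harm l m) k)"
    by (intro summable_finite[of "{l}"]) auto
qed

lemma gen_op_sph_harm:
  assumes m: "nat \<bar>m\<bar> \<le> l"
  shows "AE x in \<sigma>. gen_op \<mu> (sph_harm l m) x = gen_eigenvalue \<mu> l m * sph_harm l m x"
proof (rule L2_eq_AE_if_coeffs_eq)
  note G = gen_op_sums[OF sph_harm_sobolev[OF m], of \<mu>]
  show "gen_op \<mu> (sph_harm l m) \<in> L2_sphere" using G by (simp add: sph_sums_def)
  show "(\<lambda>x. gen_eigenvalue \<mu> l m * sph_harm l m x) \<in> L2_sphere" by (intro L2_scale sph_harm_L2 m)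
  fix k j assume j: "nat \<bar>j\<bar> \<le> k"
  have "sph_coeff (\<lambda>x. gen_eigenvalue \<mu> l m * sph_harm l m x) k j = gen_eigenvalue \<mu> l m * sph_coeff (sph_harm l m) k j"
    by (simp add: sph_coeff_def mult.assoc)
  then show "sph_coeff (gen_op \<mu> (sph_harm l m)) k j = sph_coeff (\<lambda>x. gen_eigenvalue \<mu> l m * sph_harm l m x) k j"
    unfolding sph_sums_coeff[OF G j] using sph_harm_orthonormal[OF m j] by (auto simp: sph_coeff_def)
qed

lemma curve_pairing_continuous:
  assumes c: "continuous_curve L2_norm {0..} v" and v: "\<And>t. 0 \<le> t \<Longrightarrow> v t \<in> L2_sphere" and g: "g \<in> L2_sphere"
  shows "continuous_on {0..} (\<lambda>t. \<integral>x. v t x * g x \<partial>\<sigma>)"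
  unfolding continuous_on_def
proof
  fix t :: real assume t: "t \<in> {0..}"
  have lim: "((\<lambda>s. L2_norm (\<lambda>x. v s x - v t x) * L2_norm g) \<longlongrightarrow> 0) (at t within {0..})"
    using c t unfolding continuous_curve_def by (intro tendsto_mult_left_zero) blast
  have "((\<lambda>s. (\<integral>x. v s x * g x \<partial>\<sigma>) - (\<integral>x. v t x * g x \<partial>\<sigma>)) \<longlongrightarrow> 0) (at t within {0..})"
  proof (rule Lim_null_comparison[OF _ lim])
    have "norm ((\<integral>x. v s x * g x \<partial>\<sigma>) - (\<integral>x. v t x * g x \<partial>\<sigma>)) \<le> L2_norm (\<lambda>x. v s x - v t x) * L2_norm g" if "0 \<le> s" for s
    proof -
      have "(\<integral>x. v s x * g x \<partial>\<sigma>) - (\<integral>x. v t x * g x \<partial>\<sigma>) = (\<integral>x. (v s x - v t x) * g x \<partial>\<sigma>)"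
        using L2_prod_integrable[OF v[OF that] g] L2_prod_integrable[OF v g, of t] t by (simp add: left_diff_distrib)
      then show ?thesis using L2_Cauchy_Schwarz[OF L2_diff[OF v[OF that] v] g, of t] t by simp
    qed
    then show "\<forall>\<^sub>F s in at t within {0..}. norm ((\<integral>x. v s x * g x \<partial>\<sigma>) - (\<integral>x. v t x * g x \<partial>\<sigma>)) \<le> L2_norm (\<lambda>x. v s x - v t x) * L2_norm g"
      by (auto simp: eventually_at_filter)
  qed
  then show "((\<lambda>s. \<integral>x. v s x * g x \<partial>\<sigma>) \<longlongrightarrow> (\<integral>x. v t x * g x \<partial>\<sigma>)) (at t within {0..})"
    by (simp add: LIM_zero_iff)
qed

lemma curve_bounded:
  assumes c: "continuous_curve L2_norm {0..} v" and v: "\<And>t. 0 \<le> t \<Longrightarrow> v t \<in> L2_sphere" and g: "g \<in> L2_sphere"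
  obtains B where "\<And>t. 0 \<le> t \<Longrightarrow> t \<le> T \<Longrightarrow> L2_norm (\<lambda>x. v t x - g x) \<le> B"
proof -
  let ?N = "\<lambda>t. L2_norm (\<lambda>x. v t x - g x)"
  have "continuous_on {0..T} ?N"
    unfolding continuous_on_def
  proof
    fix t :: real assume t: "t \<in> {0..T}"
    have "((\<lambda>s. L2_norm (\<lambda>x. v s x - v t x)) \<longlongrightarrow> 0) (at t within {0..})"
      using c t unfolding continuous_curve_def by auto
    then have lim: "((\<lambda>s. L2_norm (\<lambda>x. v s x - v t x)) \<longlongrightarrow> 0) (at t within {0..T})"
      by (rule tendsto_within_subset) auto
    have "((\<lambda>s. ?N s - ?N t) \<longlongrightarrow> 0) (at t within {0..T})"
    proof (rule Lim_null_comparison[OF _ lim])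
      have "norm (?N s - ?N t) \<le> L2_norm (\<lambda>x. v s x - v t x)" if "0 \<le> s" for s
        using L2_norm_triangle_diff[OF v[OF that] v g, of t] L2_norm_triangle_diff[OF v v[OF that] g, of t] t
        unfolding L2_norm_minus_commute[of "v t" "v s"] by auto
      then show "\<forall>\<^sub>F s in at t within {0..T}. norm (?N s - ?N t) \<le> L2_norm (\<lambda>x. v s x - v t x)"
        by (auto simp: eventually_at_filter)
    qed
    then show "(?N \<longlongrightarrow> ?N t) (at t within {0..T})" by (simp add: LIM_zero_iff)
  qed
  then have "bounded (?N ` {0..T})" by (intro compact_imp_bounded compact_continuous_image) auto
  then obtain B where "\<forall>y\<in>?N ` {0..T}. norm y \<le> B" unfolding bounded_iff ..
  then show thesis by (intro that[of B]) (auto simp: abs_le_iff)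
qed

abbreviation initial_integral :: "(real \<Rightarrow> complex) \<Rightarrow> real \<Rightarrow> complex" where
  "initial_integral d s \<equiv> \<integral>\<tau>. indicator {0..s} \<tau> *\<^sub>R d \<tau> \<partial>lborel"

lemma integral_curve_FTC:
  fixes G :: "real \<Rightarrow> complex"
  assumes G: "continuous_on {0..} G" and t: "0 < t"
  shows "(initial_integral G has_vector_derivative G t) (at t)"
proof -
  have c: "continuous_on {0..s} G" for s by (rule continuous_on_subset[OF G]) auto
  have eq: "initial_integral G s = integral {0..s} G" for s
    using set_borel_integral_eq_integral(2)[OF borel_integrable_atLeastAtMost'[OF c]] by (simp add: set_lebesgue_integral_def)
  have "((\<lambda>s. integral {0..s} G) has_vector_derivative G t) (at t within {0..t + 1})"
    by (rule integral_has_vector_derivative[OF c]) (use t in auto)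
  then have "((\<lambda>s. integral {0..s} G) has_vector_derivative G t) (at t)"
    by (subst (asm) at_within_interior) (use t in auto)
  then show ?thesis unfolding eq .
qed

text \<open>
  Differentiation gives the claim for \<open>t > 0\<close>, and continuity for \<open>t = 0\<close>.
\<close>

lemma indicator_integral_zero_imp:
  fixes d :: "real \<Rightarrow> complex"
  assumes d: "continuous_on {0..} d" and z: "\<And>s. 0 \<le> s \<Longrightarrow> initial_integral d s = 0" and t: "0 \<le> t"
  shows "d t = 0"
proof -
  have pos: "d s = 0" if "0 < s" for s
  proof (rule vector_derivative_unique_at[OF integral_curve_FTC[OF d that]])
    have "((\<lambda>_. 0) has_vector_derivative 0) (at s)" by simp
    then show "(initial_integral d has_vector_derivative 0) (at s)"
      by (rule has_vector_derivative_transform_within_open[of _ _ _ "{0<..}"]) (use that z in auto)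
  qed
  show ?thesis
  proof (cases "t = 0")
    case True
    have "(d \<longlongrightarrow> d 0) (at_right 0)"
      using d unfolding continuous_on_def by (auto intro: tendsto_within_subset)
    moreover have "(d \<longlongrightarrow> 0) (at_right 0)"
      by (rule tendsto_eventually) (use pos in \<open>auto simp: eventually_at_filter\<close>)
    ultimately show ?thesis using True tendsto_unique[OF trivial_limit_at_right_real] by blast
  qed (use pos t in auto)
qed

lemma continuous_initial_integrable:
  fixes d :: "real \<Rightarrow> complex"
  assumes d: "continuous_on {0..} d"
  shows "integrable lborel (\<lambda>\<tau>. indicator {0..s} \<tau> *\<^sub>R d \<tau>)"
proof -
  have "continuous_on {0..s} d" by (rule continuous_on_subset[OF d]) auto
  from borel_integrable_atLeastAtMost'[OF this] show ?thesis by (simp add: set_integrable_def)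
qed

lemma continuous_initial_integral_bound:
  fixes d :: "real \<Rightarrow> complex"
  assumes d: "continuous_on {0..} d" and s: "0 \<le> s" and B: "\<And>\<tau>. 0 \<le> \<tau> \<Longrightarrow> \<tau> \<le> s \<Longrightarrow> norm (d \<tau>) \<le> B"
  shows "norm (initial_integral d s) \<le> B * s"
proof -
  note i = continuous_initial_integrable[OF d, of s]
  have "set_integrable lborel {0..s} (\<lambda>_. B)" by (rule borel_integrable_atLeastAtMost') (intro continuous_intros)
  then have i2: "integrable lborel (\<lambda>\<tau>. indicator {0..s} \<tau> *\<^sub>R B)" by (simp add: set_integrable_def)
  have "norm (initial_integral d s) \<le> (\<integral>\<tau>. norm (indicator {0..s} \<tau> *\<^sub>R d \<tau>) \<partial>lborel)"
    by (rule integral_norm_bound)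
  also have "\<dots> \<le> (\<integral>\<tau>. indicator {0..s} \<tau> *\<^sub>R B \<partial>lborel)"
  proof (rule integral_mono[OF integrable_norm[OF i] i2])
    show "norm (indicator {0..s} \<tau> *\<^sub>R d \<tau>) \<le> indicator {0..s} \<tau> *\<^sub>R B" for \<tau>
      using B[of \<tau>] by (auto simp: indicator_def)
  qed
  also have "\<dots> = B * s" using s by simp
  finally show ?thesis .
qed

context levy_measure
begin

abbreviation tail_conv :: "(real \<Rightarrow> complex) \<Rightarrow> real \<Rightarrow> complex" where
  "tail_conv k s \<equiv> \<integral>\<tau>. tail_kernel (s - \<tau>) * (heaviside \<tau> * k \<tau>) \<partial>lborel"

lemma conv_tail_kernel:
  "conv (levy_tail \<nu>) v s = (\<integral>\<tau>. tail_kernel (s - \<tau>) * (heaviside \<tau> * v \<tau>) \<partial>lborel)"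
  unfolding conv_def set_lebesgue_integral_def
  by (intro Bochner_Integration.integral_cong) (auto simp: tail_kernel_def indicator_def)

lemma tail_kernel_reflect_integrable: "integrable lborel (\<lambda>\<tau>. heaviside \<tau> * tail_kernel (s - \<tau>))"
proof (rule Bochner_Integration.integrable_bound)
  show "integrable lborel (\<lambda>\<tau>. indicator {..s} (s - \<tau>) *\<^sub>R tail_kernel (s - \<tau>))"
    by (rule lborel_integrable_reflect[OF tail_kernel_integrable])
qed (auto simp: indicator_def)

lemma tail_kernel_bounded_integrable:
  assumes [measurable]: "v \<in> borel_measurable borel" and b: "\<And>\<tau>. 0 \<le> \<tau> \<Longrightarrow> \<tau> \<le> s \<Longrightarrow> norm (v \<tau>) \<le> B"
  shows "integrable lborel (\<lambda>\<tau>. tail_kernel (s - \<tau>) * (heaviside \<tau> * v \<tau>))"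
    and "norm (\<integral>\<tau>. tail_kernel (s - \<tau>) * (heaviside \<tau> * v \<tau>) \<partial>lborel) \<le> B * (\<integral>\<tau>. norm (heaviside \<tau> * tail_kernel (s - \<tau>)) \<partial>lborel)"
proof -
  have bd: "norm (tail_kernel (s - \<tau>) * (heaviside \<tau> * v \<tau>)) \<le> B * norm (heaviside \<tau> * tail_kernel (s - \<tau>))" for \<tau>
  proof (cases "0 \<le> \<tau> \<and> \<tau> \<le> s")
    case True
    from mult_left_mono[OF b[of \<tau>], of "norm (tail_kernel (s - \<tau>))"] True show ?thesis by (simp add: norm_mult mult.commute)
  qed (auto simp: tail_kernel_def indicator_def)
  have i: "integrable lborel (\<lambda>\<tau>. B * norm (heaviside \<tau> * tail_kernel (s - \<tau>)))"
    by (intro integrable_mult_right integrable_norm tail_kernel_reflect_integrable)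
  show i2: "integrable lborel (\<lambda>\<tau>. tail_kernel (s - \<tau>) * (heaviside \<tau> * v \<tau>))"
    by (rule Bochner_Integration.integrable_bound[OF i]) (use bd in \<open>auto intro!: AE_I2 order_trans[OF bd abs_ge_self]\<close>)
  have "norm (\<integral>\<tau>. tail_kernel (s - \<tau>) * (heaviside \<tau> * v \<tau>) \<partial>lborel) \<le> (\<integral>\<tau>. norm (tail_kernel (s - \<tau>) * (heaviside \<tau> * v \<tau>)) \<partial>lborel)"
    by (rule integral_norm_bound)
  also have "\<dots> \<le> (\<integral>\<tau>. B * norm (heaviside \<tau> * tail_kernel (s - \<tau>)) \<partial>lborel)"
    by (rule integral_mono[OF integrable_norm[OF i2] i bd])
  finally show "norm (\<integral>\<tau>. tail_kernel (s - \<tau>) * (heaviside \<tau> * v \<tau>) \<partial>lborel) \<le> B * (\<integral>\<tau>. norm (heaviside \<tau> * tail_kernel (s - \<tau>)) \<partial>lborel)"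
    by simp
qed

lemma measurable_heaviside_mult:
  fixes k :: "real \<Rightarrow> complex"
  assumes "continuous_on {0..} k" shows "(\<lambda>\<tau>. heaviside \<tau> * k \<tau>) \<in> borel_measurable borel"
proof -
  have "(\<lambda>\<tau>. indicator {0..} \<tau> *\<^sub>R k \<tau>) \<in> borel_measurable borel"
    by (rule borel_measurable_continuous_on_indicator[OF _ assms]) simp
  moreover have "indicator {0..} \<tau> *\<^sub>R k \<tau> = heaviside \<tau> * k \<tau>" for \<tau> by (simp add: indicator_def)
  ultimately show ?thesis by simp
qed

lemma continuous_bounded_initial:
  fixes k :: "real \<Rightarrow> complex"
  assumes k: "continuous_on {0..} k"
  obtains B where "\<And>\<tau>. 0 \<le> \<tau> \<Longrightarrow> \<tau> \<le> s \<Longrightarrow> norm (k \<tau>) \<le> B"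
proof -
  have "bounded (k ` {0..s})"
    by (intro compact_imp_bounded compact_continuous_image continuous_on_subset[OF k]) auto
  then obtain B where "\<forall>y\<in>k ` {0..s}. norm y \<le> B" unfolding bounded_iff ..
  then show thesis by (intro that[of B]) auto
qed

lemma tail_kernel_continuous:
  fixes k :: "real \<Rightarrow> complex"
  assumes k: "continuous_on {0..} k"
  shows tail_kernel_continuous_integrable: "integrable lborel (\<lambda>\<tau>. tail_kernel (s - \<tau>) * (heaviside \<tau> * k \<tau>))"
    and tail_kernel_continuous_bound: "(\<And>\<tau>. 0 \<le> \<tau> \<Longrightarrow> \<tau> \<le> s \<Longrightarrow> norm (k \<tau>) \<le> B) \<Longrightarrow>
      norm (tail_conv k s) \<le> B * (\<integral>\<tau>. norm (heaviside \<tau> * tail_kernel (s - \<tau>)) \<partial>lborel)"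
proof -
  have hh: "heaviside \<tau> * (heaviside \<tau> * k \<tau>) = heaviside \<tau> * k \<tau>" for \<tau> by (simp add: indicator_def)
  note I = tail_kernel_bounded_integrable[OF measurable_heaviside_mult[OF k], of s, unfolded hh]
  obtain B where "\<And>\<tau>. 0 \<le> \<tau> \<Longrightarrow> \<tau> \<le> s \<Longrightarrow> norm (k \<tau>) \<le> B" using continuous_bounded_initial[OF k] by blast
  then show "integrable lborel (\<lambda>\<tau>. tail_kernel (s - \<tau>) * (heaviside \<tau> * k \<tau>))" by (intro I(1)[of B]) simp
  show "norm (tail_conv k s) \<le> B * (\<integral>\<tau>. norm (heaviside \<tau> * tail_kernel (s - \<tau>)) \<partial>lborel)"
    if "\<And>\<tau>. 0 \<le> \<tau> \<Longrightarrow> \<tau> \<le> s \<Longrightarrow> norm (k \<tau>) \<le> B" for B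
    by (rule I(2)) (use that in simp)
qed

text \<open>
  The kernel may be unbounded near \<open>0\<close> but is integrable there, so convolution with a bounded
  function starts from \<open>0\<close>. This determines constants of integration.
\<close>

lemma tail_mass_tendsto_0: "((\<lambda>s. \<integral>\<tau>. norm (heaviside \<tau> * tail_kernel (s - \<tau>)) \<partial>lborel) \<longlongrightarrow> 0) (at_right 0)"
proof -
  have eq: "(\<integral>\<tau>. norm (heaviside \<tau> * tail_kernel (s - \<tau>)) \<partial>lborel) = (\<integral>\<tau>. norm (indicator {..s} \<tau> *\<^sub>R tail_kernel \<tau>) \<partial>lborel)" for s
  proof -
    have "(\<integral>\<tau>. norm (heaviside \<tau> * tail_kernel (s - \<tau>)) \<partial>lborel) = (\<integral>\<tau>. norm (heaviside (s - \<tau>) * tail_kernel (s - (s - \<tau>))) \<partial>lborel)"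
      by (rule lborel_integral_reflect[symmetric])
    also have "\<dots> = (\<integral>\<tau>. norm (indicator {..s} \<tau> *\<^sub>R tail_kernel \<tau>) \<partial>lborel)"
      by (intro Bochner_Integration.integral_cong) (auto simp: indicator_def)
    finally show ?thesis .
  qed
  have "((\<lambda>s. \<integral>\<tau>. norm (indicator {..s} \<tau> *\<^sub>R tail_kernel \<tau>) \<partial>lborel) \<longlongrightarrow> (\<integral>\<tau>. 0 \<partial>(lborel :: real measure))) (at_right 0)"
  proof (rule tendsto_at_right_sequentially[of 0 1])
    fix x :: "nat \<Rightarrow> real" assume x: "\<And>n. 0 < x n" "\<And>n. x n < 1" "decseq x" "x \<longlonglongrightarrow> 0"
    show "(\<lambda>n. \<integral>\<tau>. norm (indicator {..x n} \<tau> *\<^sub>R tail_kernel \<tau>) \<partial>lborel) \<longlonglongrightarrow> (\<integral>\<tau>. 0 \<partial>(lborel :: real measure))"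
    proof (rule integral_dominated_convergence[where w="\<lambda>\<tau>. norm (indicator {..1} \<tau> *\<^sub>R tail_kernel \<tau>)"])
      have "AE \<tau> in lborel. \<tau> \<noteq> (0::real)" by (rule AE_lborel_singleton)
      then show "AE \<tau> in lborel. (\<lambda>n. norm (indicator {..x n} \<tau> *\<^sub>R tail_kernel \<tau>)) \<longlonglongrightarrow> 0"
      proof eventually_elim
        case (elim \<tau>)
        show ?case
        proof (cases "\<tau> < 0")
          case True
          then show ?thesis by (simp add: tail_kernel_def)
        next
          case False
          then have "0 < \<tau>" using elim by simp
          from order_tendstoD(2)[OF x(4) this]
          have "\<forall>\<^sub>F n in sequentially. norm (indicator {..x n} \<tau> *\<^sub>R tail_kernel \<tau>) = 0"
            by eventually_elim simp
          then show ?thesis by (rule tendsto_eventually)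
        qed
      qed
      show "AE \<tau> in lborel. norm (norm (indicator {..x n} \<tau> *\<^sub>R tail_kernel \<tau>)) \<le> norm (indicator {..1} \<tau> *\<^sub>R tail_kernel \<tau>)" for n
        by (rule AE_I2) (use x(2)[of n] in \<open>auto simp: indicator_def\<close>)
    qed (use integrable_norm[OF tail_kernel_integrable[of 1]] in auto)
  qed simp
  then show ?thesis unfolding eq by simp
qed

text \<open>
  Joint measurability is available for nonnegative times only; clamping makes Fubini's theorem on the whole line
  applicable.
\<close>

lemma measurable_clamp_time:
  fixes v :: "real \<Rightarrow> real^3 \<Rightarrow> complex"
  assumes "(\<lambda>(t, x). v t x) \<in> borel_measurable (restrict_space borel {0..} \<Otimes>\<^sub>M \<sigma>)"
  shows "(\<lambda>p. v (max 0 (fst p)) (snd p)) \<in> borel_measurable (lborel \<Otimes>\<^sub>M \<sigma>)"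
proof -
  have "(\<lambda>\<tau>::real. max 0 \<tau>) \<in> lborel \<rightarrow>\<^sub>M restrict_space borel {0..}"
    by (rule measurable_restrict_space2) auto
  then have "(\<lambda>p :: real \<times> (real^3). (max 0 (fst p), snd p)) \<in> lborel \<Otimes>\<^sub>M \<sigma> \<rightarrow>\<^sub>M restrict_space borel {0..} \<Otimes>\<^sub>M \<sigma>"
    by (intro measurable_Pair measurable_compose[OF measurable_fst] measurable_snd)
  from measurable_compose[OF this assms] show ?thesis by simp
qed

text \<open>
  Fubini's theorem: the kernel is locally integrable, and a continuous curve is bounded in
  \<open>L\<^sup>2\<close> on \<open>[0,s]\<close>.
\<close>

lemma conv_pairing:
  assumes vm: "(\<lambda>(t, x). v t x) \<in> borel_measurable (restrict_space borel {0..} \<Otimes>\<^sub>M \<sigma>)"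
    and v: "\<And>t. 0 \<le> t \<Longrightarrow> v t \<in> L2_sphere" and c: "continuous_curve L2_norm {0..} v"
    and f: "f \<in> L2_sphere" and h: "h \<in> L2_sphere"
  shows "(\<integral>x. h x * conv (levy_tail \<nu>) (\<lambda>\<tau>. v \<tau> x - f x) s \<partial>\<sigma>)
    = (\<integral>\<tau>. tail_kernel (s - \<tau>) * (heaviside \<tau> * (\<integral>x. (v \<tau> x - f x) * h x \<partial>\<sigma>)) \<partial>lborel)"
proof -
  interpret P: pair_sigma_finite lborel \<sigma> ..
  define g where "g \<tau> x = tail_kernel (s - \<tau>) * (heaviside \<tau> * ((v (max 0 \<tau>) x - f x) * h x))" for \<tau> x
  have g: "g \<tau> x = tail_kernel (s - \<tau>) * (heaviside \<tau> * ((v \<tau> x - f x) * h x))" for \<tau> x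
    unfolding g_def by (cases "0 \<le> \<tau>") (auto simp: max_def)
  have [measurable]: "f \<in> borel_measurable \<sigma>" "h \<in> borel_measurable \<sigma>" using f h L2D by auto
  note [measurable] = measurable_clamp_time[OF vm]
  have gm: "case_prod g \<in> borel_measurable (lborel \<Otimes>\<^sub>M \<sigma>)"
    unfolding g_def case_prod_beta' by measurable
  obtain B where B: "\<And>t. 0 \<le> t \<Longrightarrow> t \<le> s \<Longrightarrow> L2_norm (\<lambda>x. v t x - f x) \<le> B"
    using curve_bounded[OF c v f] by blast
  have gi: "integrable (lborel \<Otimes>\<^sub>M \<sigma>) (case_prod g)"
  proof (rule P.Fubini_integrable[OF gm])
    show "AE \<tau> in lborel. integrable \<sigma> (\<lambda>x. case_prod g (\<tau>, x))"
    proof (rule AE_I2)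
      fix \<tau> :: real
      show "integrable \<sigma> (\<lambda>x. case_prod g (\<tau>, x))"
        unfolding case_prod_conv g
        by (cases "0 \<le> \<tau>") (auto intro!: integrable_mult_right L2_prod_integrable L2_diff v f h)
    qed
    show "integrable lborel (\<lambda>\<tau>. \<integral>x. norm (case_prod g (\<tau>, x)) \<partial>\<sigma>)"
    proof (rule Bochner_Integration.integrable_bound)
      show "integrable lborel (\<lambda>\<tau>. (B * L2_norm h) * norm (heaviside \<tau> * tail_kernel (s - \<tau>)))"
        by (intro integrable_mult_right integrable_norm tail_kernel_reflect_integrable)
      show "(\<lambda>\<tau>. \<integral>x. norm (case_prod g (\<tau>, x)) \<partial>\<sigma>) \<in> borel_measurable lborel"
        using gm by (intro sphere.borel_measurable_lebesgue_integral) simp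
      show "AE \<tau> in lborel. norm (\<integral>x. norm (case_prod g (\<tau>, x)) \<partial>\<sigma>) \<le> norm ((B * L2_norm h) * norm (heaviside \<tau> * tail_kernel (s - \<tau>)))"
      proof (rule AE_I2)
        fix \<tau> :: real
        show "norm (\<integral>x. norm (case_prod g (\<tau>, x)) \<partial>\<sigma>) \<le> norm ((B * L2_norm h) * norm (heaviside \<tau> * tail_kernel (s - \<tau>)))"
        proof (cases "0 \<le> \<tau> \<and> \<tau> \<le> s")
          case True
          have e: "norm (case_prod g (\<tau>, x)) = norm (tail_kernel (s - \<tau>)) * (cmod (v \<tau> x - f x) * cmod (h x))" for x
            using True by (simp add: g norm_mult)
          have "(\<integral>x. cmod (v \<tau> x - f x) * cmod (h x) \<partial>\<sigma>) \<le> L2_norm (\<lambda>x. v \<tau> x - f x) * L2_norm h"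
            by (rule L2_Cauchy_Schwarz_abs[OF L2_diff[OF v f] h]) (use True in auto)
          also have "\<dots> \<le> B * L2_norm h" using B[of \<tau>] True by (intro mult_right_mono L2_norm_nonneg) auto
          finally have le: "(\<integral>x. cmod (v \<tau> x - f x) * cmod (h x) \<partial>\<sigma>) \<le> B * L2_norm h" .
          have "(\<integral>x. norm (case_prod g (\<tau>, x)) \<partial>\<sigma>) = norm (tail_kernel (s - \<tau>)) * (\<integral>x. cmod (v \<tau> x - f x) * cmod (h x) \<partial>\<sigma>)"
            unfolding e by (rule integral_mult_right_zero)
          also have "\<dots> \<le> norm (tail_kernel (s - \<tau>)) * (B * L2_norm h)"
            by (rule mult_left_mono[OF le]) simp
          finally have "(\<integral>x. norm (case_prod g (\<tau>, x)) \<partial>\<sigma>) \<le> (B * L2_norm h) * norm (heaviside \<tau> * tail_kernel (s - \<tau>))"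
            using True by (simp add: mult.commute)
          moreover have "0 \<le> (\<integral>x. norm (case_prod g (\<tau>, x)) \<partial>\<sigma>)" by (rule integral_nonneg_AE) auto
          ultimately show ?thesis unfolding real_norm_def by linarith
        next
          case False
          then have "g \<tau> x = 0" for x by (auto simp: g tail_kernel_def indicator_def)
          then show ?thesis by simp
        qed
      qed
    qed
  qed
  have "(\<integral>x. h x * conv (levy_tail \<nu>) (\<lambda>\<tau>. v \<tau> x - f x) s \<partial>\<sigma>) = (\<integral>x. (\<integral>\<tau>. g \<tau> x \<partial>lborel) \<partial>\<sigma>)"
    unfolding conv_tail_kernel g integral_mult_right_zero[symmetric] by (simp add: mult_ac)
  also have "\<dots> = (\<integral>\<tau>. (\<integral>x. g \<tau> x \<partial>\<sigma>) \<partial>lborel)" by (rule P.Fubini_integral[OF gi])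
  also have "\<dots> = (\<integral>\<tau>. tail_kernel (s - \<tau>) * (heaviside \<tau> * (\<integral>x. (v \<tau> x - f x) * h x \<partial>\<sigma>)) \<partial>lborel)"
    unfolding g integral_mult_right_zero ..
  finally show ?thesis .
qed

end

section \<open>Uniqueness\<close>

context subordinator_inverse
begin

abbreviation relax_coeff :: "real \<Rightarrow> real \<Rightarrow> nat \<Rightarrow> int \<Rightarrow> complex" where
  "relax_coeff \<mu> t l m \<equiv> relaxation M S t (gen_eigenvalue \<mu> l m)"

abbreviation relaxed :: "real \<Rightarrow> (real^3 \<Rightarrow> complex) \<Rightarrow> real \<Rightarrow> nat \<Rightarrow> int \<Rightarrow> complex" where
  "relaxed \<mu> f t \<equiv> \<lambda>l m. sph_coeff f l m * relax_coeff \<mu> t l m"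

lemma relaxation_continuous: assumes "Re z \<le> 0" shows "continuous_on {0..} (\<lambda>t. relaxation M S t z)"
proof -
  interpret R: resolvent \<nu> \<Omega> X "b z" z by (rule resolvent[OF assms])
  show ?thesis
    using R.continuous_relax(1)[OF AE_X_neq] relaxation_eq[OF assms]
      continuous_on_cong[OF refl, of "{0..}" "\<lambda>t. relaxation M S t z" R.relax] by simp
qed

lemma relaxation_zero: assumes "Re z \<le> 0" shows "relaxation M S 0 z = 1"
proof -
  interpret R: resolvent \<nu> \<Omega> X "b z" z by (rule resolvent[OF assms])
  show ?thesis using R.continuous_relax(2)[OF AE_X_neq] relaxation_eq[OF assms, of 0] by simp
qed

text \<open>
  The scalar equation for \<open>E exp (z L(t))\<close>, integrated in time.
\<close>

lemma relaxation_equation: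
  assumes z: "Re z \<le> 0" and s: "0 \<le> s"
  shows "(\<integral>\<tau>. tail_kernel (s - \<tau>) * (heaviside \<tau> * (relaxation M S \<tau> z - 1)) \<partial>lborel)
       = z * (\<integral>\<tau>. indicator {0..s} \<tau> *\<^sub>R relaxation M S \<tau> z \<partial>lborel)"
proof -
  interpret R: resolvent \<nu> \<Omega> X "b z" z by (rule resolvent[OF z])
  have v: "heaviside \<tau> * (relaxation M S \<tau> z - 1) = z * R.wconv heaviside \<tau>" for \<tau>
    using relaxation_eq[OF z, of \<tau>] R.wconv_neg[of heaviside \<tau>] by (cases "0 \<le> \<tau>") (auto simp: R.relax_def)
  have w: "indicator {0..s} \<tau> *\<^sub>R relaxation M S \<tau> z = indicator {0..s} \<tau> *\<^sub>R R.relax \<tau>" for \<tau>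
    using relaxation_eq[OF z, of \<tau>] by (auto simp: indicator_def)
  show ?thesis unfolding v w by (rule R.relax_equation[OF s])
qed

text \<open>
  All initial integrals of \<open>d\<close> vanish by the resolvent argument, hence so does the continuous
  function \<open>d\<close>.
\<close>

lemma homogeneous_equation:
  assumes z: "Re z \<le> 0" and d: "continuous_on {0..} d"
    and eq: "\<And>s. 0 \<le> s \<Longrightarrow> tail_conv d s = z * initial_integral d s"
    and t: "0 \<le> t"
  shows "d t = 0"
proof -
  interpret R: resolvent \<nu> \<Omega> X "b z" z by (rule resolvent[OF z])
  let ?d = "\<lambda>\<tau>. heaviside \<tau> * d \<tau>"
  have dm: "?d \<in> borel_measurable borel" by (rule measurable_heaviside_mult[OF d])
  have hv: "heaviside (s - \<tau>) * ?d \<tau> = indicator {0..s} \<tau> *\<^sub>R d \<tau>" for s \<tau> by (auto simp: indicator_def)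
  have int0: "initial_integral d s = 0" if s: "0 \<le> s" for s
  proof -
    obtain B where B: "\<And>\<tau>. 0 \<le> \<tau> \<Longrightarrow> \<tau> \<le> s \<Longrightarrow> norm (d \<tau>) \<le> B" using continuous_bounded_initial[OF d] by blast
    have "(\<integral>\<tau>. heaviside (s - \<tau>) * ?d \<tau> \<partial>lborel) = 0"
    proof (rule R.homogeneous_Volterra[OF dm, where B="\<bar>B\<bar>"])
      show "norm (?d \<tau>) \<le> \<bar>B\<bar>" if "\<tau> \<le> s" for \<tau>
      proof (cases "0 \<le> \<tau>")
        case True
        then have "norm (d \<tau>) \<le> B" using B that by auto
        then show ?thesis using True by simp
      qed simp
      show "(\<integral>\<tau>. tail_kernel (r - \<tau>) * ?d \<tau> \<partial>lborel) = z * (\<integral>\<tau>. heaviside (r - \<tau>) * ?d \<tau> \<partial>lborel)" if "0 \<le> r" for r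
        unfolding hv by (rule eq[OF that])
    qed simp
    then show ?thesis unfolding hv .
  qed
  show ?thesis by (rule indicator_integral_zero_imp[OF d int0 t])
qed

lemma tail_integral_at_0: "(\<integral>\<tau>. tail_kernel (0 - \<tau>) * (heaviside \<tau> * d \<tau>) \<partial>lborel) = 0"
proof -
  have "tail_kernel (0 - \<tau>) * (heaviside \<tau> * d \<tau>) = indicator {0} \<tau> *\<^sub>R (tail_kernel 0 * d 0)" for \<tau>
    by (auto simp: tail_kernel_def indicator_def)
  then show ?thesis by simp
qed

text \<open>
  Testing with a single harmonic singles out one coefficient, which satisfies a scalar equation in
  differentiated form. Integrating it requires the value at \<open>0+\<close>, where both sides tend to
  \<open>0\<close>; the difference of two solutions then solves the homogeneous scalar equation.
\<close>

lemma weak_solution_unique: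
  assumes v: "very_weak_solution \<nu> \<mu> f v" and u: "very_weak_solution \<nu> \<mu> f u" and f: "f \<in> L2_sphere" and t: "0 \<le> t"
  shows "AE x in \<sigma>. v t x = u t x"
proof (rule L2_eq_AE_if_coeffs_eq)
  note V = v[unfolded very_weak_solution_def] and U = u[unfolded very_weak_solution_def]
  have vL: "v s \<in> L2_sphere" and uL: "u s \<in> L2_sphere" if "0 \<le> s" for s using V U that by auto
  show "v t \<in> L2_sphere" "u t \<in> L2_sphere" using vL uL t by auto
  fix l :: nat and m :: int assume "nat \<bar>m\<bar> \<le> l"
  then have m: "nat \<bar>- m\<bar> \<le> l" by simp
  \<comment> \<open>Order \<open>-m\<close>, because the pairing is bilinear.\<close>
  define h where "h = sph_harm l (- m)"
  define z where "z = gen_eigenvalue \<mu> l m"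
  have z: "Re z \<le> 0" unfolding z_def by (rule Re_gen_eigenvalue_le)
  have hL: "h \<in> L2_sphere" and hS: "h \<in> sobolev 2" unfolding h_def using sph_harm_L2[OF m] sph_harm_sobolev[OF m] by auto
  define p where "p w s = (\<integral>x. w s x * h x \<partial>\<sigma>)" for w :: "real \<Rightarrow> real^3 \<Rightarrow> complex" and s
  define d where "d s = p v s - p u s" for s
  have pc: "continuous_on {0..} (p v)" "continuous_on {0..} (p u)"
    unfolding p_def[abs_def] using V U hL by (auto intro!: curve_pairing_continuous)
  then have dc: "continuous_on {0..} d" unfolding d_def by (intro continuous_intros)
  have gen: "(\<integral>x. w s x * gen_op (- \<mu>) h x \<partial>\<sigma>) = z * p w s" if "w s \<in> L2_sphere" for w s
  proof -
    have ae: "AE x in \<sigma>. gen_op (- \<mu>) h x = z * h x"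
      unfolding h_def z_def using gen_op_sph_harm[OF m, of "- \<mu>"] by (simp add: gen_eigenvalue_minus)
    have gm: "gen_op (- \<mu>) h \<in> borel_measurable \<sigma>"
      using gen_op_sums[OF hS, of "- \<mu>"] L2D by (auto simp: sph_sums_def)
    have "(\<integral>x. w s x * gen_op (- \<mu>) h x \<partial>\<sigma>) = (\<integral>x. z * (w s x * h x) \<partial>\<sigma>)"
    proof (rule integral_cong_AE)
      show "AE x in \<sigma>. w s x * gen_op (- \<mu>) h x = z * (w s x * h x)"
        using ae by eventually_elim simp
    qed (use gm L2D(1)[OF that] L2D(1)[OF hL] in auto)
    then show ?thesis by (simp add: p_def)
  qed
  define c where "c s = tail_conv d s" for s
  have pair: "(\<integral>x. h x * conv (levy_tail \<nu>) (\<lambda>\<tau>. w \<tau> x - f x) s \<partial>\<sigma>) = (\<integral>\<tau>. tail_kernel (s - \<tau>) * (heaviside \<tau> * (p w \<tau> - (\<integral>x. f x * h x \<partial>\<sigma>))) \<partial>lborel)"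
    if w: "very_weak_solution \<nu> \<mu> f w" for w s
  proof -
    note W = w[unfolded very_weak_solution_def]
    have e: "heaviside \<tau> * (\<integral>x. (w \<tau> x - f x) * h x \<partial>\<sigma>) = heaviside \<tau> * (p w \<tau> - (\<integral>x. f x * h x \<partial>\<sigma>))" for \<tau>
    proof (cases "0 \<le> \<tau>")
      case True
      then have "w \<tau> \<in> L2_sphere" using W by blast
      from Bochner_Integration.integral_diff[OF L2_prod_integrable[OF this hL] L2_prod_integrable[OF f hL]]
      show ?thesis by (simp add: p_def left_diff_distrib)
    qed simp
    have "(\<integral>x. h x * conv (levy_tail \<nu>) (\<lambda>\<tau>. w \<tau> x - f x) s \<partial>\<sigma>)
        = (\<integral>\<tau>. tail_kernel (s - \<tau>) * (heaviside \<tau> * (\<integral>x. (w \<tau> x - f x) * h x \<partial>\<sigma>)) \<partial>lborel)"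
      by (rule conv_pairing) (use W f hL in auto)
    then show ?thesis unfolding e .
  qed
  have cdiff: "(\<integral>x. h x * conv (levy_tail \<nu>) (\<lambda>\<tau>. v \<tau> x - f x) s \<partial>\<sigma>) - (\<integral>x. h x * conv (levy_tail \<nu>) (\<lambda>\<tau>. u \<tau> x - f x) s \<partial>\<sigma>) = c s" for s
  proof -
    let ?f = "\<integral>x. f x * h x \<partial>\<sigma>"
    have "continuous_on {0..} (\<lambda>\<tau>. p v \<tau> - ?f)" "continuous_on {0..} (\<lambda>\<tau>. p u \<tau> - ?f)"
      by (intro continuous_intros pc)+
    from Bochner_Integration.integral_diff[OF tail_kernel_continuous_integrable[OF this(1), of s] tail_kernel_continuous_integrable[OF this(2), of s], symmetric]
    show ?thesis unfolding pair[OF v] pair[OF u] c_def d_def by (simp add: right_diff_distrib[symmetric])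
  qed
  \<comment> \<open>The defect in the homogeneous scalar equation; the weak equation says that its derivative is \<open>0\<close>.\<close>
  define E where "E s = c s - z * initial_integral d s" for s
  have E': "(E has_vector_derivative 0) (at s)" if s: "0 < s" for s
  proof -
    have der: "((\<lambda>s. \<integral>x. h x * conv (levy_tail \<nu>) (\<lambda>\<tau>. w \<tau> x - f x) s \<partial>\<sigma>) has_vector_derivative z * p w s) (at s)"
      if w: "very_weak_solution \<nu> \<mu> f w" for w
    proof -
      note W = w[unfolded very_weak_solution_def]
      have "((\<lambda>s. \<integral>x. h x * conv (levy_tail \<nu>) (\<lambda>\<tau>. w \<tau> x - f x) s \<partial>\<sigma>) has_vector_derivative (\<integral>x. w s x * gen_op (- \<mu>) h x \<partial>\<sigma>)) (at s)"
        using W hS s by blast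
      moreover have "(\<integral>x. w s x * gen_op (- \<mu>) h x \<partial>\<sigma>) = z * p w s"
        by (rule gen) (use W s in auto)
      ultimately show ?thesis by simp
    qed
    have "(c has_vector_derivative z * d s) (at s)"
      using has_vector_derivative_diff[OF der[OF v] der[OF u]] unfolding cdiff by (simp add: d_def right_diff_distrib)
    from has_vector_derivative_diff[OF this has_vector_derivative_mult_right[OF integral_curve_FTC[OF dc s], of z]]
    show ?thesis unfolding E_def[abs_def] by simp
  qed
  obtain a where a: "\<And>s. 0 < s \<Longrightarrow> E s = a"
  proof -
    have "\<exists>a. \<forall>s\<in>{0<..}. E s = a"
    proof (rule has_derivative_zero_constant)
      show "(E has_derivative (\<lambda>h. 0)) (at s within {0<..})" if "s \<in> {0<..}" for s
        using has_vector_derivative_at_within[OF E', of s "{0<..}"] that by (simp add: has_vector_derivative_def)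
    qed simp
    then show thesis using that by auto
  qed
  obtain B where B: "\<And>\<tau>. 0 \<le> \<tau> \<Longrightarrow> \<tau> \<le> 1 \<Longrightarrow> norm (d \<tau>) \<le> B" using continuous_bounded_initial[OF dc] by blast
  have "(E \<longlongrightarrow> 0) (at_right 0)"
  proof -
    let ?K = "\<lambda>s. \<integral>\<tau>. norm (heaviside \<tau> * tail_kernel (s - \<tau>)) \<partial>lborel"
    have "(c \<longlongrightarrow> 0) (at_right 0)"
    proof (rule Lim_null_comparison)
      have "norm (c s) \<le> B * ?K s" if "s \<le> 1" for s
        unfolding c_def by (rule tail_kernel_continuous_bound[OF dc]) (use B that in auto)
      moreover have "\<forall>\<^sub>F s in at_right 0. s \<le> (1::real)"
        unfolding eventually_at_right_field by (intro exI[of _ 1]) auto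
      ultimately show "\<forall>\<^sub>F s in at_right 0. norm (c s) \<le> B * ?K s" by (auto elim: eventually_mono)
      show "((\<lambda>s. B * ?K s) \<longlongrightarrow> 0) (at_right 0)"
        using tendsto_mult_right_zero[OF tail_mass_tendsto_0] .
    qed
    moreover have "((\<lambda>s. z * initial_integral d s) \<longlongrightarrow> 0) (at_right 0)"
    proof (rule tendsto_mult_right_zero, rule Lim_null_comparison)
      have "norm (initial_integral d s) \<le> B * s" if "0 \<le> s" "s \<le> 1" for s
        by (rule continuous_initial_integral_bound[OF dc that(1)]) (use B that in auto)
      moreover have "\<forall>\<^sub>F s in at_right 0. 0 \<le> s \<and> s \<le> (1::real)"
        unfolding eventually_at_right_field by (intro exI[of _ 1]) auto
      ultimately show "\<forall>\<^sub>F s in at_right 0. norm (initial_integral d s) \<le> B * s" by (auto elim: eventually_mono)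
      have "((\<lambda>s. B * s) \<longlongrightarrow> B * 0) (at_right 0)" by (intro tendsto_intros)
      then show "((\<lambda>s. B * s) \<longlongrightarrow> 0) (at_right 0)" by simp
    qed
    ultimately have "((\<lambda>s. c s - z * initial_integral d s) \<longlongrightarrow> 0 - 0) (at_right 0)" by (rule tendsto_diff)
    then show ?thesis by (simp add: E_def[abs_def])
  qed
  moreover have "(E \<longlongrightarrow> a) (at_right 0)"
    by (rule tendsto_eventually) (use a in \<open>auto simp: eventually_at_filter\<close>)
  ultimately have a0: "a = 0" using tendsto_unique[OF trivial_limit_at_right_real] by blast
  have "d t = 0"
  proof (rule homogeneous_equation[OF z dc _ t])
    fix s :: real assume s: "0 \<le> s"
    show "tail_conv d s = z * initial_integral d s"
    proof (cases "s = 0")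
      case True
      have i: "indicator {0..0} \<tau> *\<^sub>R d \<tau> = indicator {0} \<tau> *\<^sub>R d 0" for \<tau> :: real by (auto simp: indicator_def)
      show ?thesis unfolding True i tail_integral_at_0 by simp
    next
      case False
      then have "E s = 0" using a[of s] a0 s by simp
      then show ?thesis by (simp add: E_def c_def)
    qed
  qed
  then have "p v t = p u t" by (simp add: d_def)
  then show "sph_coeff (v t) l m = sph_coeff (u t) l m"
    unfolding p_def h_def minus_harmonic_integral[OF m] by simp
qed

section \<open>The series solution and its regularity\<close>

lemma relax_coeff_le: "0 \<le> t \<Longrightarrow> cmod (relax_coeff \<mu> t l m) \<le> 1"
  by (rule norm_relaxation_le(2)) (simp_all add: Re_gen_eigenvalue_le)

lemma relaxed_coeff_power_le:
  "0 \<le> t \<Longrightarrow> coeff_power (relaxed \<mu> f t) l \<le> sph_power f l"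
  using coeff_power_mono[of l "relaxed \<mu> f t" 1 "sph_coeff f"] relax_coeff_le[of t \<mu> l]
  by (auto simp: sph_power_coeff norm_mult mult_left_le)

text \<open>
  Because \<open>|w| \<le> 1\<close>, the coefficients at all times are dominated by those of \<open>f\<close>,
  so that the limit can be taken along one subsequence. Partial sums are jointly measurable since the relaxation
  functions are continuous in time.
\<close>

lemma solution_exists:
  assumes f: "f \<in> L2_sphere"
  obtains u where "(\<lambda>(t, x). u t x) \<in> borel_measurable (restrict_space borel {0..} \<Otimes>\<^sub>M \<sigma>)"
    "\<And>t. 0 \<le> t \<Longrightarrow> sph_sums (relaxed \<mu> f t) (u t)"
proof -
  obtain r where r: "strict_mono r" "\<And>k. (\<Sum>l. sph_power f (l + Suc (r k))) \<le> (1 / 4) ^ k"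
    using exists_fast_subsequence[OF Bessel[OF f]] by blast
  let ?c = "\<lambda>t l m. sph_coeff f l m * relax_coeff \<mu> t l m"
  define u where "u t x = lim (\<lambda>k. sph_partial_sum (?c t) (r k) x)" for t x
  have "sph_sums (?c t) (u t)" if "0 \<le> t" for t
    unfolding u_def by (rule Riesz_Fischer[OF relaxed_coeff_power_le[OF that] Bessel[OF f] r])
  moreover have "(\<lambda>(t, x). u t x) \<in> borel_measurable (restrict_space borel {0..} \<Otimes>\<^sub>M \<sigma>)"
  proof -
    have "(\<lambda>p. sph_partial_sum (?c (fst p)) n (snd p)) \<in> borel_measurable (restrict_space borel {0..} \<Otimes>\<^sub>M \<sigma>)" for n
      unfolding sph_partial_sum_idx
    proof (intro borel_measurable_sum borel_measurable_times borel_measurable_const)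
      fix p assume "p \<in> sph_idx n"
      then have p: "nat \<bar>snd p\<bar> \<le> fst p" by (cases p) (simp add: sph_idx_iff)
      have "(\<lambda>t. relax_coeff \<mu> t (fst p) (snd p)) \<in> borel_measurable (restrict_space borel {0..})"
        by (intro borel_measurable_continuous_on_restrict relaxation_continuous Re_gen_eigenvalue_le)
      from measurable_compose[OF measurable_fst this]
      show "(\<lambda>x. relax_coeff \<mu> (fst x) (fst p) (snd p)) \<in> borel_measurable (restrict_space borel {0..} \<Otimes>\<^sub>M \<sigma>)" .
      from measurable_compose[OF measurable_snd L2D(1)[OF sph_harm_L2[OF p]]]
      show "(\<lambda>x. sph_harm (fst p) (snd p) (snd x)) \<in> borel_measurable (restrict_space borel {0..} \<Otimes>\<^sub>M \<sigma>)" .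
    qed
    then have "(\<lambda>p. lim (\<lambda>k. sph_partial_sum (?c (fst p)) (r k) (snd p))) \<in> borel_measurable (restrict_space borel {0..} \<Otimes>\<^sub>M \<sigma>)"
      by (intro borel_measurable_lim_metric)
    then show ?thesis by (simp add: u_def case_prod_beta')
  qed
  ultimately show thesis using that by blast
qed

lemma relaxed_solution_facts:
  assumes f: "f \<in> L2_sphere" and t: "0 \<le> t"
    and u: "sph_sums (relaxed \<mu> f t) g"
  shows "g \<in> L2_sphere" "nat \<bar>m\<bar> \<le> l \<Longrightarrow> sph_coeff g l m = sph_coeff f l m * relax_coeff \<mu> t l m"
    "L2_norm g \<le> L2_norm f"
proof -
  show "g \<in> L2_sphere" using u by (simp add: sph_sums_def)
  show "sph_coeff g l m = sph_coeff f l m * relax_coeff \<mu> t l m" if "nat \<bar>m\<bar> \<le> l"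
    by (rule sph_sums_coeff[OF u that])
  have "(L2_norm g)\<^sup>2 \<le> (L2_norm f)\<^sup>2"
    by (rule sums_le[OF relaxed_coeff_power_le[OF t] sph_sums_norm[OF u] Parseval[OF f]])
  then show "L2_norm g \<le> L2_norm f" by (rule power2_le_imp_le) (rule L2_norm_nonneg)
qed

text \<open>
  Weight \<open>1\<close> gives continuity in \<open>L\<^sup>2\<close>, and weight \<open>l\<^sup>4\<close>
  gives continuity in \<open>H\<^sup>2\<close>.
\<close>

lemma weighted_curve_tendsto:
  assumes f: "f \<in> L2_sphere" and t: "0 \<le> t" and A: "A \<subseteq> {0..}" and K: "summable K"
    and bound: "\<forall>\<^sub>F s in at t within A. \<forall>l. w l * coeff_power (\<lambda>l m. sph_coeff f l m * relax_coeff \<mu> s l m - sph_coeff f l m * relax_coeff \<mu> t l m) l \<le> K l"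
    and w: "\<And>l. 0 \<le> w l"
  shows "((\<lambda>s. \<Sum>l. w l * coeff_power (\<lambda>l m. sph_coeff f l m * relax_coeff \<mu> s l m - sph_coeff f l m * relax_coeff \<mu> t l m) l) \<longlongrightarrow> 0) (at t within A)"
proof (rule tendsto_suminf_zero[OF _ _ K])
  fix l
  have "((\<lambda>s. relax_coeff \<mu> s l m) \<longlongrightarrow> relax_coeff \<mu> t l m) (at t within A)" for m
    using relaxation_continuous[OF Re_gen_eigenvalue_le, of \<mu> l m] t A
    unfolding continuous_on_def by (auto intro: tendsto_within_subset)
  then have "((\<lambda>s. w l * coeff_power (\<lambda>l m. sph_coeff f l m * relax_coeff \<mu> s l m - sph_coeff f l m * relax_coeff \<mu> t l m) l)
      \<longlongrightarrow> w l * (\<Sum>m = - int l..int l. (cmod (sph_coeff f l m * relax_coeff \<mu> t l m - sph_coeff f l m * relax_coeff \<mu> t l m))\<^sup>2)) (at t within A)"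
    unfolding coeff_power_def by (intro tendsto_intros)
  then show "((\<lambda>s. w l * coeff_power (\<lambda>l m. sph_coeff f l m * relax_coeff \<mu> s l m - sph_coeff f l m * relax_coeff \<mu> t l m) l) \<longlongrightarrow> 0) (at t within A)"
    by simp
next
  show "\<forall>\<^sub>F s in at t within A. \<forall>l. \<bar>w l * coeff_power (\<lambda>l m. sph_coeff f l m * relax_coeff \<mu> s l m - sph_coeff f l m * relax_coeff \<mu> t l m) l\<bar> \<le> K l"
    using bound by eventually_elim (use w coeff_power_nonneg in simp)
qed

lemma solution_norm_continuous:
  assumes f: "f \<in> L2_sphere"
    and u: "\<And>t. 0 \<le> t \<Longrightarrow> sph_sums (relaxed \<mu> f t) (u t)"
  shows "continuous_curve L2_norm {0..} u"
  unfolding continuous_curve_def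
proof
  fix t :: real assume "t \<in> {0..}"
  then have t: "0 \<le> t" by simp
  let ?c = "\<lambda>s l m. sph_coeff f l m * relax_coeff \<mu> s l m - sph_coeff f l m * relax_coeff \<mu> t l m"
  have uL: "u s \<in> L2_sphere" if "0 \<le> s" for s using u[OF that] by (simp add: sph_sums_def)
  have p: "L2_norm (\<lambda>x. u s x - u t x) = sqrt (\<Sum>l. 1 * coeff_power (?c s) l)" if s: "0 \<le> s" for s
  proof -
    have "sph_power (\<lambda>x. u s x - u t x) l = coeff_power (?c s) l" for l
      using sph_coeff_diff[OF uL[OF s] uL[OF t]] sph_sums_coeff[OF u[OF s]] sph_sums_coeff[OF u[OF t]]
      by (intro sph_power_cong) simp
    then have pe: "sph_power (\<lambda>x. u s x - u t x) = coeff_power (?c s)" by (rule ext)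
    have "(\<Sum>l. coeff_power (?c s) l) = (L2_norm (\<lambda>x. u s x - u t x))\<^sup>2"
      using sums_unique[OF Parseval[OF L2_diff[OF uL[OF s] uL[OF t]]]] unfolding pe by simp
    then show ?thesis by (simp add: L2_norm_nonneg)
  qed
  have "((\<lambda>s. \<Sum>l. 1 * coeff_power (?c s) l) \<longlongrightarrow> 0) (at t within {0..})"
  proof (rule weighted_curve_tendsto[OF f t order_refl])
    show "summable (\<lambda>l. 4 * sph_power f l)" by (intro summable_mult Bessel f)
    have "1 * coeff_power (?c s) l \<le> 4 * sph_power f l" if "0 \<le> s" for s l
      using coeff_power_diff_le[of "relaxed \<mu> f s" "relaxed \<mu> f t" l]
        relaxed_coeff_power_le[OF that, of f \<mu> l] relaxed_coeff_power_le[OF t, of f \<mu> l] by simp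
    then show "\<forall>\<^sub>F s in at t within {0..}. \<forall>l. 1 * coeff_power (?c s) l \<le> 4 * sph_power f l"
      by (auto simp: eventually_at_filter)
  qed simp
  then have "((\<lambda>s. sqrt (\<Sum>l. 1 * coeff_power (?c s) l)) \<longlongrightarrow> sqrt 0) (at t within {0..})"
    by (intro tendsto_intros)
  then show "((\<lambda>s. L2_norm (\<lambda>x. u s x - u t x)) \<longlongrightarrow> 0) (at t within {0..})"
    unfolding real_sqrt_zero
    by (rule Lim_transform_eventually) (use p in \<open>auto simp: eventually_at_filter\<close>)
qed

text \<open>
  The factor in front of \<open>1 / (l(l+1))\<close> in the decay estimate for the relaxation functions.
\<close>

definition decay_const :: "real \<Rightarrow> real" where
  "decay_const t = laplace_exponent \<nu> 1 / (1 - exp (- t))"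

lemma decay_const_nonneg: "0 < t \<Longrightarrow> 0 \<le> decay_const t"
  unfolding decay_const_def using laplace_exponent_nonneg[of 1] by simp

lemma decay_const_antimono: assumes "0 < s" "s \<le> t" shows "decay_const t \<le> decay_const s"
  unfolding decay_const_def
  using assms laplace_exponent_nonneg[of 1] by (intro divide_left_mono) (auto intro!: mult_pos_pos)

text \<open>
  Smoothing: the decay \<open>l\<^bsup>-2\<^esup>\<close> of the relaxation functions compensates the Sobolev
  weight, uniformly for times bounded away from \<open>0\<close>.
\<close>

lemma weighted_relaxed_power_le:
  assumes a: "0 < a" "a \<le> t"
  shows "real l ^ 4 * coeff_power (relaxed \<mu> f t) l \<le> (decay_const a)\<^sup>2 * sph_power f l"
proof (cases "l = 0")
  case True
  then show ?thesis by (simp add: sph_power_coeff coeff_power_nonneg)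
next
  case False
  then have l: "0 < real l * (real l + 1)" by simp
  have "cmod (sph_coeff f l m * relax_coeff \<mu> t l m) \<le> decay_const a / (real l)\<^sup>2 * cmod (sph_coeff f l m)" for m
  proof -
    have "cmod (relax_coeff \<mu> t l m) \<le> decay_const t / (real l * (real l + 1))"
      using relaxation_decay[of t "gen_eigenvalue \<mu> l m"] a l by (simp add: Re_gen_eigenvalue decay_const_def)
    also have "\<dots> \<le> decay_const a / (real l * (real l + 1))"
      using decay_const_antimono[OF a] l by (intro divide_right_mono) auto
    also have "\<dots> \<le> decay_const a / (real l)\<^sup>2"
      using decay_const_nonneg[OF a(1)] False by (intro divide_left_mono) (auto simp: power2_eq_square intro!: mult_pos_pos)
    finally show ?thesis unfolding norm_mult by (subst mult.commute) (rule mult_right_mono, auto)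
  qed
  then have "coeff_power (relaxed \<mu> f t) l \<le> (decay_const a / (real l)\<^sup>2)\<^sup>2 * sph_power f l"
    unfolding sph_power_coeff by (rule coeff_power_mono)
  then have "real l ^ 4 * coeff_power (relaxed \<mu> f t) l \<le> real l ^ 4 * ((decay_const a / (real l)\<^sup>2)\<^sup>2 * sph_power f l)"
    by (rule mult_left_mono) simp
  also have "real l ^ 4 * ((decay_const a / (real l)\<^sup>2)\<^sup>2 * sph_power f l) = (decay_const a)\<^sup>2 * sph_power f l"
    using False by (simp add: power_divide power_mult[symmetric])
  finally show ?thesis .
qed

lemma solution_sobolev:
  assumes f: "f \<in> L2_sphere" and t: "0 < t"
    and u: "sph_sums (relaxed \<mu> f t) g"
  shows "g \<in> sobolev 2"
    and "summable (\<lambda>l. real l ^ 4 * coeff_power (relaxed \<mu> f t) l)"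
proof -
  show s: "summable (\<lambda>l. real l ^ 4 * coeff_power (relaxed \<mu> f t) l)"
    by (rule summable_comparison_test'[OF summable_mult[OF Bessel[OF f]], of 0 _ "(decay_const t)\<^sup>2"])
       (use weighted_relaxed_power_le[OF t order_refl] coeff_power_nonneg in simp)
  have "sph_power g l = coeff_power (relaxed \<mu> f t) l" for l
    by (rule sph_power_cong) (rule sph_sums_coeff[OF u])
  then show "g \<in> sobolev 2" using s u by (simp add: sobolev_2_iff sph_sums_def)
qed

lemma sobolev_norm_2: "sobolev_norm 2 g = L2_norm g + sqrt (\<Sum>l. real l ^ 4 * sph_power g l)"
  by (simp add: sobolev_norm_def sobolev_weight)

lemma solution_sobolev_continuous:
  assumes f: "f \<in> L2_sphere"
    and u: "\<And>t. 0 \<le> t \<Longrightarrow> sph_sums (relaxed \<mu> f t) (u t)"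
  shows "continuous_curve (sobolev_norm 2) {0<..} u"
  unfolding continuous_curve_def
proof
  fix t :: real assume "t \<in> {0<..}"
  then have t: "0 < t" by simp
  let ?c = "\<lambda>s l m. sph_coeff f l m * relax_coeff \<mu> s l m - sph_coeff f l m * relax_coeff \<mu> t l m"
  have uL: "u s \<in> L2_sphere" if "0 \<le> s" for s using u[OF that] by (simp add: sph_sums_def)
  have p: "sobolev_norm 2 (\<lambda>x. u s x - u t x) = L2_norm (\<lambda>x. u s x - u t x) + sqrt (\<Sum>l. real l ^ 4 * coeff_power (?c s) l)" if s: "0 \<le> s" for s
  proof -
    have "sph_power (\<lambda>x. u s x - u t x) l = coeff_power (?c s) l" for l
      using sph_coeff_diff[OF uL[OF s] uL] sph_sums_coeff[OF u[OF s]] sph_sums_coeff[OF u, of t] t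
      by (intro sph_power_cong) simp
    then show ?thesis by (simp add: sobolev_norm_2)
  qed
  have "((\<lambda>s. \<Sum>l. real l ^ 4 * coeff_power (?c s) l) \<longlongrightarrow> 0) (at t within {0<..})"
  proof (rule weighted_curve_tendsto[OF f])
    \<comment> \<open>Near \<open>t\<close>, times stay above \<open>t / 2\<close>, where the decay estimate is uniform.\<close>
    show "summable (\<lambda>l. 4 * ((decay_const (t / 2))\<^sup>2 * sph_power f l))" by (intro summable_mult Bessel f)
    have "real l ^ 4 * coeff_power (?c s) l \<le> 4 * ((decay_const (t / 2))\<^sup>2 * sph_power f l)" if "t / 2 < s" for s l
    proof -
      have "real l ^ 4 * coeff_power (?c s) l \<le> real l ^ 4 * (2 * coeff_power (relaxed \<mu> f s) l + 2 * coeff_power (relaxed \<mu> f t) l)"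
        by (intro mult_left_mono coeff_power_diff_le) simp
      also have "\<dots> = 2 * (real l ^ 4 * coeff_power (relaxed \<mu> f s) l) + 2 * (real l ^ 4 * coeff_power (relaxed \<mu> f t) l)"
        by (simp add: algebra_simps)
      also have "\<dots> \<le> 4 * ((decay_const (t / 2))\<^sup>2 * sph_power f l)"
        using weighted_relaxed_power_le[of "t / 2" s l f \<mu>] weighted_relaxed_power_le[of "t / 2" t l f \<mu>] t that by linarith
      finally show ?thesis .
    qed
    moreover have "\<forall>\<^sub>F s in at t within {0<..}. t / 2 < s"
      using order_tendstoD(1)[OF tendsto_ident_at, of "t / 2" t "{0<..}"] t by simp
    ultimately show "\<forall>\<^sub>F s in at t within {0<..}. \<forall>l. real l ^ 4 * coeff_power (?c s) l \<le> 4 * ((decay_const (t / 2))\<^sup>2 * sph_power f l)"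
      by (auto elim: eventually_mono)
  qed (use t in auto)
  then have "((\<lambda>s. sqrt (\<Sum>l. real l ^ 4 * coeff_power (?c s) l)) \<longlongrightarrow> sqrt 0) (at t within {0<..})"
    by (intro tendsto_intros)
  moreover have "((\<lambda>s. L2_norm (\<lambda>x. u s x - u t x)) \<longlongrightarrow> 0) (at t within {0<..})"
  proof (rule tendsto_within_subset)
    show "((\<lambda>s. L2_norm (\<lambda>x. u s x - u t x)) \<longlongrightarrow> 0) (at t within {0..})"
      using solution_norm_continuous[OF f u] t unfolding continuous_curve_def by simp
  qed auto
  ultimately have "((\<lambda>s. L2_norm (\<lambda>x. u s x - u t x) + sqrt (\<Sum>l. real l ^ 4 * coeff_power (?c s) l)) \<longlongrightarrow> 0 + sqrt 0) (at t within {0<..})"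
    by (intro tendsto_add)
  then have "((\<lambda>s. L2_norm (\<lambda>x. u s x - u t x) + sqrt (\<Sum>l. real l ^ 4 * coeff_power (?c s) l)) \<longlongrightarrow> 0) (at t within {0<..})"
    by simp
  then show "((\<lambda>s. sobolev_norm 2 (\<lambda>x. u s x - u t x)) \<longlongrightarrow> 0) (at t within {0<..})"
    by (rule Lim_transform_eventually) (use p in \<open>auto simp: eventually_at_filter\<close>)
qed

lemma solution_series_sobolev:
  assumes f: "f \<in> L2_sphere" and t: "0 < t"
    and u: "sph_sums (relaxed \<mu> f t) g"
  shows "(\<lambda>n. sobolev_norm 2 (\<lambda>x. g x - sph_partial_sum (relaxed \<mu> f t) n x)) \<longlonglongrightarrow> 0"
proof -
  let ?c = "relaxed \<mu> f t"
  have uL: "g \<in> L2_sphere" using u by (simp add: sph_sums_def)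
  have p: "sph_power (\<lambda>x. g x - sph_partial_sum ?c n x) l = (if l \<le> n then 0 else coeff_power ?c l)" for n l
  proof -
    have "sph_power (\<lambda>x. g x - sph_partial_sum ?c n x) l = coeff_power (\<lambda>l m. if l \<le> n then 0 else ?c l m) l"
      using sph_coeff_diff[OF uL sph_partial_sum_L2] sph_sums_coeff[OF u] sph_coeff_partial_sum[of _ l ?c n]
      by (intro sph_power_cong) simp
    then show ?thesis by (simp add: coeff_power_def)
  qed
  have "(\<lambda>n. \<Sum>l. real l ^ 4 * (if l \<le> n then 0 else coeff_power ?c l)) \<longlonglongrightarrow> 0"
  proof (rule tendsto_suminf_zero[OF _ _ solution_sobolev(2)[OF f t u]])
    show "(\<lambda>n. real l ^ 4 * (if l \<le> n then 0 else coeff_power ?c l)) \<longlonglongrightarrow> 0" for l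
      by (rule tendsto_eventually, rule eventually_mono[OF eventually_ge_at_top[of l]]) simp
    show "\<forall>\<^sub>F n in sequentially. \<forall>l. \<bar>real l ^ 4 * (if l \<le> n then 0 else coeff_power ?c l)\<bar> \<le> real l ^ 4 * coeff_power ?c l"
      by (simp add: coeff_power_nonneg)
  qed
  then have "(\<lambda>n. sqrt (\<Sum>l. real l ^ 4 * (if l \<le> n then 0 else coeff_power ?c l))) \<longlonglongrightarrow> sqrt 0"
    by (intro tendsto_intros)
  moreover have "(\<lambda>n. L2_norm (\<lambda>x. g x - sph_partial_sum ?c n x)) \<longlonglongrightarrow> 0"
    using u by (simp add: sph_sums_def)
  ultimately have "(\<lambda>n. L2_norm (\<lambda>x. g x - sph_partial_sum ?c n x) + sqrt (\<Sum>l. real l ^ 4 * (if l \<le> n then 0 else coeff_power ?c l))) \<longlonglongrightarrow> 0 + sqrt 0"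
    by (rule tendsto_add[rotated])
  then show ?thesis unfolding sobolev_norm_2 p by simp
qed

text \<open>
  By Tonelli's theorem, \<open>\<integral> \<integral> e\<^bsup>-t\<^esup> |u(t,x)| dt d\<sigma>\<close> is
  finite, as the \<open>L\<^sup>1\<close>-norm of \<open>u(t)\<close> is bounded by a constant times the
  \<open>L\<^sup>2\<close>-norm of \<open>f\<close>. So \<open>q > 1\<close> is admissible for almost every
  \<open>x\<close>.
\<close>

lemma solution_laplace_transformable:
  assumes f: "f \<in> L2_sphere"
    and um: "(\<lambda>(t, x). u t x) \<in> borel_measurable (restrict_space borel {0..} \<Otimes>\<^sub>M \<sigma>)"
    and uL: "\<And>t. 0 \<le> t \<Longrightarrow> u t \<in> L2_sphere" and un: "\<And>t. 0 \<le> t \<Longrightarrow> L2_norm (u t) \<le> L2_norm f"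
  shows "laplace_transformable u"
proof -
  interpret P: pair_sigma_finite lborel \<sigma> ..
  let ?g = "\<lambda>t x. ennreal (exp (- 1 * t) * cmod (u (max 0 t) x)) * indicator {0..} t"
  note [measurable] = measurable_clamp_time[OF um]
  have gm: "case_prod ?g \<in> borel_measurable (lborel \<Otimes>\<^sub>M \<sigma>)" unfolding case_prod_beta' by measurable
  have gm': "(\<lambda>(x, t). ?g t x) \<in> borel_measurable (\<sigma> \<Otimes>\<^sub>M lborel)"
    using measurable_compose[OF measurable_pair_swap' gm] by (simp add: case_prod_beta')
  define C where "C = L2_norm f * L2_norm (\<lambda>_. 1)"
  have C: "0 \<le> C" by (simp add: C_def L2_norm_nonneg)
  have "(\<integral>\<^sup>+x. (\<integral>\<^sup>+t. ?g t x \<partial>lborel) \<partial>\<sigma>) = (\<integral>\<^sup>+t. (\<integral>\<^sup>+x. ?g t x \<partial>\<sigma>) \<partial>lborel)"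
    by (rule P.Fubini'[OF gm])
  also have "\<dots> \<le> (\<integral>\<^sup>+t. ennreal C * (ennreal (exp (- 1 * t)) * indicator {0..} t) \<partial>lborel)"
  proof (rule nn_integral_mono)
    fix t :: real
    show "(\<integral>\<^sup>+x. ?g t x \<partial>\<sigma>) \<le> ennreal C * (ennreal (exp (- 1 * t)) * indicator {0..} t)"
    proof (cases "0 \<le> t")
      case True
      have ut: "u t \<in> L2_sphere" by (rule uL[OF True])
      then have [measurable]: "u t \<in> borel_measurable \<sigma>" by (rule L2D)
      have "(\<integral>\<^sup>+x. ?g t x \<partial>\<sigma>) = (\<integral>\<^sup>+x. ennreal (exp (- 1 * t)) * ennreal (cmod (u t x)) \<partial>\<sigma>)"
        using True by (intro nn_integral_cong) (simp add: ennreal_mult max_def)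
      also have "\<dots> = ennreal (exp (- 1 * t)) * (\<integral>\<^sup>+x. ennreal (cmod (u t x)) \<partial>\<sigma>)"
        by (rule nn_integral_cmult) measurable
      also have "(\<integral>\<^sup>+x. ennreal (cmod (u t x)) \<partial>\<sigma>) = ennreal (\<integral>x. cmod (u t x) \<partial>\<sigma>)"
        by (rule nn_integral_eq_integral) (use L2_integrable[OF ut] in auto)
      also have "ennreal (exp (- 1 * t)) * ennreal (\<integral>x. cmod (u t x) \<partial>\<sigma>) \<le> ennreal (exp (- 1 * t)) * ennreal C"
      proof (intro mult_left_mono ennreal_leI)
        have "(\<integral>x. cmod (u t x) \<partial>\<sigma>) \<le> L2_norm (u t) * L2_norm (\<lambda>_. 1)"
          using L2_Cauchy_Schwarz_abs[OF ut L2_const[of 1]] by simp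
        also have "\<dots> \<le> C" unfolding C_def by (rule mult_right_mono[OF un[OF True] L2_norm_nonneg])
        finally show "(\<integral>x. cmod (u t x) \<partial>\<sigma>) \<le> C" .
      qed simp
      finally show ?thesis using True by (simp add: mult.commute)
    qed simp
  qed
  also have "\<dots> = ennreal C * (\<integral>\<^sup>+t. ennreal (exp (- 1 * t)) * indicator {0..} t \<partial>lborel)"
    by (rule nn_integral_cmult) measurable
  also have "\<dots> < \<infinity>"
  proof -
    have "(\<integral>\<^sup>+t. ennreal (exp (- 1 * t)) * indicator {0..} t \<partial>lborel) = (\<integral>\<^sup>+t. ennreal (norm (indicator {0..} t *\<^sub>R exp (- 1 * complex_of_real t))) \<partial>lborel)"
      by (intro nn_integral_cong) (auto simp: indicator_def)
    also have "\<dots> < \<infinity>"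
      using laplace_exp(1)[of 1] unfolding integrable_iff_bounded by simp
    finally show ?thesis by (simp add: ennreal_mult_less_top)
  qed
  finally have fin: "(\<integral>\<^sup>+x. (\<integral>\<^sup>+t. ?g t x \<partial>lborel) \<partial>\<sigma>) \<noteq> \<infinity>" by simp
  have "AE x in \<sigma>. (\<integral>\<^sup>+t. ?g t x \<partial>lborel) \<noteq> \<infinity>"
    by (rule nn_integral_PInf_AE[OF _ fin]) (rule lborel.borel_measurable_nn_integral[OF gm'])
  then show ?thesis unfolding laplace_transformable_def
  proof eventually_elim
    case (elim x)
    show ?case
    proof (intro exI[of _ 1] conjI allI impI)
      fix q :: real assume q: "1 < q"
      have "(\<integral>\<^sup>+t\<in>{0..}. ennreal (exp (- q * t) * cmod (u t x)) \<partial>lborel) \<le> (\<integral>\<^sup>+t. ?g t x \<partial>lborel)"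
      proof (rule nn_integral_mono)
        fix t :: real
        show "ennreal (exp (- q * t) * cmod (u t x)) * indicator {0..} t \<le> ?g t x"
        proof (cases "0 \<le> t")
          case True
          then have "exp (- q * t) \<le> exp (- 1 * t)" using q by (simp add: mult_right_mono[of 1 q t, simplified])
          then show ?thesis using True by (auto simp: max_def intro!: ennreal_leI mult_right_mono)
        qed simp
      qed
      then show "(\<integral>\<^sup>+t\<in>{0..}. ennreal (exp (- q * t) * cmod (u t x)) \<partial>lborel) < \<infinity>"
        using elim by (simp add: top.not_eq_extremum le_less_trans)
    qed simp
  qed
qed

section \<open>The weak equation\<close>

text \<open>
  For the partial sums of \<open>h\<close> the claim is a finite combination of scalar equations. The left-hand
  side is continuous in \<open>h\<close> and the right-hand side in \<open>gen_op (- \<mu>) h\<close>, both for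
  the \<open>L\<^sup>2\<close>-norm, and the partial sums converge in both respects because \<open>h\<close>
  lies in \<open>H\<^sup>2\<close>.
\<close>

lemma solution_weak_equation:
  assumes f: "f \<in> L2_sphere" and h: "h \<in> sobolev 2" and s: "0 \<le> s"
    and u: "\<And>t. 0 \<le> t \<Longrightarrow> sph_sums (relaxed \<mu> f t) (u t)"
  shows "(\<integral>\<tau>. tail_kernel (s - \<tau>) * (heaviside \<tau> * (\<integral>x. (u \<tau> x - f x) * h x \<partial>\<sigma>)) \<partial>lborel)
       = (\<integral>\<tau>. indicator {0..s} \<tau> *\<^sub>R (\<integral>x. u \<tau> x * gen_op (- \<mu>) h x \<partial>\<sigma>) \<partial>lborel)"
proof -
  let ?e = "\<lambda>l m. gen_eigenvalue (- \<mu>) l m * sph_coeff h l m"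
  define H where "H = gen_op (- \<mu>) h"
  define hn where "hn = sph_partial_sum (sph_coeff h)"
  define Hn where "Hn = sph_partial_sum ?e"
  have hL: "h \<in> L2_sphere" using h by (simp add: sobolev_2_iff)
  have Hs: "sph_sums ?e H" unfolding H_def by (rule gen_op_sums[OF h])
  have HL: "H \<in> L2_sphere" using Hs by (simp add: sph_sums_def)
  have hnL: "hn n \<in> L2_sphere" and HnL: "Hn n \<in> L2_sphere" for n unfolding hn_def Hn_def by (rule sph_partial_sum_L2)+
  have uL: "u t \<in> L2_sphere" and un: "L2_norm (u t) \<le> L2_norm f" if "0 \<le> t" for t
    using relaxed_solution_facts[OF f that u[OF that]] by auto
  have cc: "continuous_curve L2_norm {0..} u" by (rule solution_norm_continuous[OF f u])
  define P where "P g \<tau> = (\<integral>x. (u \<tau> x - f x) * g x \<partial>\<sigma>)" for g \<tau>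
  define G where "G g \<tau> = (\<integral>x. u \<tau> x * g x \<partial>\<sigma>)" for g \<tau>
  have Gc: "continuous_on {0..} (G g)" if "g \<in> L2_sphere" for g
    unfolding G_def[abs_def] by (rule curve_pairing_continuous[OF cc uL that])
  have PG: "P g \<tau> = G g \<tau> - (\<integral>x. f x * g x \<partial>\<sigma>)" if "g \<in> L2_sphere" "0 \<le> \<tau>" for g \<tau>
    unfolding P_def G_def using L2_prod_integrable[OF uL[OF that(2)] that(1)] L2_prod_integrable[OF f that(1)]
    by (simp add: left_diff_distrib)
  have Pc: "continuous_on {0..} (P g)" if g: "g \<in> L2_sphere" for g
  proof -
    have "continuous_on {0..} (\<lambda>\<tau>. G g \<tau> - (\<integral>x. f x * g x \<partial>\<sigma>))" by (intro continuous_intros Gc g)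
    then show ?thesis using continuous_on_cong[OF refl, of "{0..}" "P g" "\<lambda>\<tau>. G g \<tau> - (\<integral>x. f x * g x \<partial>\<sigma>)"] PG[OF g] by simp
  qed
  let ?C = "\<lambda>k. tail_conv k s"
  let ?I = "\<lambda>k. initial_integral k s"
  have finite: "?C (P (hn n)) = ?I (G (Hn n))" for n
  proof -
    let ?\<kappa> = "\<lambda>p. sph_coeff h (fst p) (snd p) * ((-1) ^ nat \<bar>snd p\<bar> * sph_coeff f (fst p) (- snd p))"
    let ?z = "\<lambda>p. gen_eigenvalue \<mu> (fst p) (- snd p)"
    let ?w = "\<lambda>p \<tau>. relaxation M S \<tau> (?z p)"
    have wc: "continuous_on {0..} (?w p)" for p by (rule relaxation_continuous[OF Re_gen_eigenvalue_le])
    have val: "nat \<bar>- snd p\<bar> \<le> fst p" if "p \<in> sph_idx n" for p using that by (cases p) (simp add: sph_idx_iff)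
    have Pn: "P (hn n) \<tau> = (\<Sum>p\<in>sph_idx n. ?\<kappa> p * (?w p \<tau> - 1))" if "0 \<le> \<tau>" for \<tau>
      unfolding P_def hn_def pairing_partial_sum[OF L2_diff[OF uL[OF that] f]]
    proof (rule sum.cong[OF refl])
      fix p assume p: "p \<in> sph_idx n"
      obtain l m where lm: "p = (l, m)" by (cases p)
      have "sph_coeff (\<lambda>x. u \<tau> x - f x) l (- m) = sph_coeff f l (- m) * (?w p \<tau> - 1)"
        using val[OF p] unfolding lm fst_conv snd_conv
        by (simp add: sph_coeff_diff[OF uL[OF that] f] relaxed_solution_facts(2)[OF f that u[OF that]] right_diff_distrib)
      then show "(case p of (l, m) \<Rightarrow> sph_coeff h l m * ((- 1) ^ nat \<bar>m\<bar> * sph_coeff (\<lambda>x. u \<tau> x - f x) l (- m))) = ?\<kappa> p * (?w p \<tau> - 1)"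
        unfolding lm by simp
    qed
    have Gn: "G (Hn n) \<tau> = (\<Sum>p\<in>sph_idx n. ?\<kappa> p * (?z p * ?w p \<tau>))" if "0 \<le> \<tau>" for \<tau>
      unfolding G_def Hn_def pairing_partial_sum[OF uL[OF that]]
    proof (rule sum.cong[OF refl])
      fix p assume p: "p \<in> sph_idx n"
      obtain l m where lm: "p = (l, m)" by (cases p)
      have "sph_coeff (u \<tau>) l (- m) = sph_coeff f l (- m) * ?w p \<tau>"
        using val[OF p] unfolding lm fst_conv snd_conv by (rule relaxed_solution_facts(2)[OF f that u[OF that]])
      then show "(case p of (l, m) \<Rightarrow> gen_eigenvalue (- \<mu>) l m * sph_coeff h l m * ((- 1) ^ nat \<bar>m\<bar> * sph_coeff (u \<tau>) l (- m))) = ?\<kappa> p * (?z p * ?w p \<tau>)"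
        unfolding lm by (simp add: gen_eigenvalue_minus mult_ac)
    qed
    have "tail_kernel (s - \<tau>) * (heaviside \<tau> * P (hn n) \<tau>) = (\<Sum>p\<in>sph_idx n. ?\<kappa> p * (tail_kernel (s - \<tau>) * (heaviside \<tau> * (?w p \<tau> - 1))))" for \<tau>
      using Pn[of \<tau>] by (cases "0 \<le> \<tau>") (simp_all add: sum_distrib_left mult_ac)
    then have "?C (P (hn n)) = (\<integral>\<tau>. (\<Sum>p\<in>sph_idx n. ?\<kappa> p * (tail_kernel (s - \<tau>) * (heaviside \<tau> * (?w p \<tau> - 1)))) \<partial>lborel)"
      by (simp only:)
    also have "\<dots> = (\<Sum>p\<in>sph_idx n. \<integral>\<tau>. ?\<kappa> p * (tail_kernel (s - \<tau>) * (heaviside \<tau> * (?w p \<tau> - 1))) \<partial>lborel)"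
      by (intro Bochner_Integration.integral_sum integrable_mult_right tail_kernel_continuous_integrable continuous_intros wc)
    also have "\<dots> = (\<Sum>p\<in>sph_idx n. ?\<kappa> p * (?z p * ?I (?w p)))"
      unfolding integral_mult_right_zero by (simp only: relaxation_equation[OF Re_gen_eigenvalue_le s])
    also have "\<dots> = (\<Sum>p\<in>sph_idx n. \<integral>\<tau>. (?\<kappa> p * ?z p) * (indicator {0..s} \<tau> *\<^sub>R ?w p \<tau>) \<partial>lborel)"
      unfolding integral_mult_right_zero by (simp only: mult.assoc)
    also have "\<dots> = (\<integral>\<tau>. (\<Sum>p\<in>sph_idx n. (?\<kappa> p * ?z p) * (indicator {0..s} \<tau> *\<^sub>R ?w p \<tau>)) \<partial>lborel)"
      by (intro Bochner_Integration.integral_sum[symmetric] integrable_mult_right continuous_initial_integrable wc)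
    also have "\<dots> = ?I (G (Hn n))"
    proof (rule Bochner_Integration.integral_cong[OF refl])
      fix \<tau>
      show "(\<Sum>p\<in>sph_idx n. (?\<kappa> p * ?z p) * (indicator {0..s} \<tau> *\<^sub>R ?w p \<tau>)) = indicator {0..s} \<tau> *\<^sub>R G (Hn n) \<tau>"
        using Gn[of \<tau>] by (cases "\<tau> \<in> {0..s}") (simp_all add: mult_ac)
    qed
    finally show ?thesis .
  qed
  let ?K = "\<integral>\<tau>. norm (heaviside \<tau> * tail_kernel (s - \<tau>)) \<partial>lborel"
  \<comment> \<open>Both limits use that \<open>u\<close> stays in the ball of radius \<open>L2_norm f\<close>.\<close>
  have "(\<lambda>n. ?C (P (hn n))) \<longlonglongrightarrow> ?C (P h)"
  proof -
    have b: "norm (?C (P (hn n)) - ?C (P h)) \<le> (2 * L2_norm f) * L2_norm (\<lambda>x. h x - hn n x) * ?K" for n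
    proof -
      have d: "continuous_on {0..} (\<lambda>\<tau>. P (hn n) \<tau> - P h \<tau>)" by (intro continuous_intros Pc hnL hL)
      have "?C (P (hn n)) - ?C (P h) = ?C (\<lambda>\<tau>. P (hn n) \<tau> - P h \<tau>)"
        using Bochner_Integration.integral_diff[OF tail_kernel_continuous_integrable[OF Pc[OF hnL[of n]], of s] tail_kernel_continuous_integrable[OF Pc[OF hL], of s]]
        by (simp add: right_diff_distrib)
      also have "norm \<dots> \<le> (2 * L2_norm f) * L2_norm (\<lambda>x. h x - hn n x) * ?K"
      proof (rule tail_kernel_continuous_bound[OF d])
        fix \<tau> :: real assume t: "0 \<le> \<tau>"
        have uf: "(\<lambda>x. u \<tau> x - f x) \<in> L2_sphere" by (intro L2_diff uL t f)
        have "P h \<tau> - P (hn n) \<tau> = (\<integral>x. (u \<tau> x - f x) * (h x - hn n x) \<partial>\<sigma>)"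
          unfolding P_def using L2_prod_integrable[OF uf hL] L2_prod_integrable[OF uf hnL[of n]] by (simp add: right_diff_distrib)
        then have "norm (P (hn n) \<tau> - P h \<tau>) \<le> L2_norm (\<lambda>x. u \<tau> x - f x) * L2_norm (\<lambda>x. h x - hn n x)"
          using L2_Cauchy_Schwarz[OF uf L2_diff[OF hL hnL[of n]]] by (simp add: norm_minus_commute)
        also have "\<dots> \<le> (2 * L2_norm f) * L2_norm (\<lambda>x. h x - hn n x)"
        proof (rule mult_right_mono[OF _ L2_norm_nonneg])
          show "L2_norm (\<lambda>x. u \<tau> x - f x) \<le> 2 * L2_norm f"
            using L2_norm_triangle_diff[OF uL[OF t] L2_const[of 0] f] un[OF t] L2_norm_minus_commute[of "\<lambda>_. 0" f] by simp
        qed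
        finally show "norm (P (hn n) \<tau> - P h \<tau>) \<le> (2 * L2_norm f) * L2_norm (\<lambda>x. h x - hn n x)" .
      qed
      finally show ?thesis .
    qed
    have "(\<lambda>n. L2_norm (\<lambda>x. h x - hn n x)) \<longlonglongrightarrow> 0"
      using sph_sums_self[OF hL] by (simp add: sph_sums_def hn_def)
    then have "(\<lambda>n. (2 * L2_norm f) * L2_norm (\<lambda>x. h x - hn n x) * ?K) \<longlonglongrightarrow> 0"
      by (intro tendsto_mult_left_zero tendsto_mult_right_zero)
    then have "(\<lambda>n. ?C (P (hn n)) - ?C (P h)) \<longlonglongrightarrow> 0"
      by (rule Lim_null_comparison[rotated]) (use b in \<open>simp add: always_eventually\<close>)
    then show ?thesis by (simp add: LIM_zero_iff)
  qed
  moreover have "(\<lambda>n. ?I (G (Hn n))) \<longlonglongrightarrow> ?I (G H)"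
  proof -
    have b: "norm (?I (G (Hn n)) - ?I (G H)) \<le> L2_norm f * L2_norm (\<lambda>x. H x - Hn n x) * s" for n
    proof -
      have d: "continuous_on {0..} (\<lambda>\<tau>. G (Hn n) \<tau> - G H \<tau>)" by (intro continuous_intros Gc HnL HL)
      have "?I (G (Hn n)) - ?I (G H) = ?I (\<lambda>\<tau>. G (Hn n) \<tau> - G H \<tau>)"
        using Bochner_Integration.integral_diff[OF continuous_initial_integrable[OF Gc[OF HnL[of n]], of s] continuous_initial_integrable[OF Gc[OF HL], of s]]
        by (simp add: scaleR_diff_right)
      also have "norm \<dots> \<le> L2_norm f * L2_norm (\<lambda>x. H x - Hn n x) * s"
      proof (rule continuous_initial_integral_bound[OF d s])
        fix \<tau> :: real assume t: "0 \<le> \<tau>"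
        have "G H \<tau> - G (Hn n) \<tau> = (\<integral>x. u \<tau> x * (H x - Hn n x) \<partial>\<sigma>)"
          unfolding G_def using L2_prod_integrable[OF uL[OF t] HL] L2_prod_integrable[OF uL[OF t] HnL[of n]] by (simp add: right_diff_distrib)
        then have "norm (G (Hn n) \<tau> - G H \<tau>) \<le> L2_norm (u \<tau>) * L2_norm (\<lambda>x. H x - Hn n x)"
          using L2_Cauchy_Schwarz[OF uL[OF t] L2_diff[OF HL HnL[of n]]] by (simp add: norm_minus_commute)
        also have "\<dots> \<le> L2_norm f * L2_norm (\<lambda>x. H x - Hn n x)"
          by (rule mult_right_mono[OF un[OF t] L2_norm_nonneg])
        finally show "norm (G (Hn n) \<tau> - G H \<tau>) \<le> L2_norm f * L2_norm (\<lambda>x. H x - Hn n x)" .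
      qed
      finally show ?thesis .
    qed
    have "(\<lambda>n. L2_norm (\<lambda>x. H x - Hn n x)) \<longlonglongrightarrow> 0"
      using Hs by (simp add: sph_sums_def Hn_def)
    then have "(\<lambda>n. L2_norm f * L2_norm (\<lambda>x. H x - Hn n x) * s) \<longlonglongrightarrow> 0"
      by (intro tendsto_mult_left_zero tendsto_mult_right_zero)
    then have "(\<lambda>n. ?I (G (Hn n)) - ?I (G H)) \<longlonglongrightarrow> 0"
      by (rule Lim_null_comparison[rotated]) (use b in \<open>simp add: always_eventually\<close>)
    then show ?thesis by (simp add: LIM_zero_iff)
  qed
  ultimately have "?C (P h) = ?I (G H)" unfolding finite by (rule LIMSEQ_unique)
  then show ?thesis by (simp add: P_def G_def H_def)
qed

text \<open>
  By continuity of the curve, the integrated equation can be differentiated at every \<open>t > 0\<close>.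
\<close>

lemma solution_very_weak:
  assumes f: "f \<in> L2_sphere"
    and um: "(\<lambda>(t, x). u t x) \<in> borel_measurable (restrict_space borel {0..} \<Otimes>\<^sub>M \<sigma>)"
    and u: "\<And>t. 0 \<le> t \<Longrightarrow> sph_sums (relaxed \<mu> f t) (u t)"
  shows "very_weak_solution \<nu> \<mu> f u"
  unfolding very_weak_solution_def
proof (intro conjI um ballI allI impI)
  have uL: "u t \<in> L2_sphere" if "0 \<le> t" for t using u[OF that] by (simp add: sph_sums_def)
  show "u t \<in> L2_sphere" if "0 \<le> t" for t by (rule uL[OF that])
  show cc: "continuous_curve L2_norm {0..} u" by (rule solution_norm_continuous[OF f u])
  fix h and t :: real assume h: "h \<in> sobolev 2" and t: "0 < t"
  let ?G = "\<lambda>\<tau>. \<integral>x. u \<tau> x * gen_op (- \<mu>) h x \<partial>\<sigma>"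
  have "continuous_on {0..} ?G"
    by (rule curve_pairing_continuous[OF cc uL]) (use gen_op_sums[OF h, of "- \<mu>"] in \<open>auto simp: sph_sums_def\<close>)
  from integral_curve_FTC[OF this t]
  show "((\<lambda>s. \<integral>x. h x * conv (levy_tail \<nu>) (\<lambda>\<tau>. u \<tau> x - f x) s \<partial>\<sigma>) has_vector_derivative ?G t) (at t)"
  proof (rule has_vector_derivative_transform_within_open)
    fix s :: real assume "s \<in> {0<..}"
    then have s: "0 \<le> s" by simp
    have "(\<integral>x. h x * conv (levy_tail \<nu>) (\<lambda>\<tau>. u \<tau> x - f x) s \<partial>\<sigma>)
        = (\<integral>\<tau>. tail_kernel (s - \<tau>) * (heaviside \<tau> * (\<integral>x. (u \<tau> x - f x) * h x \<partial>\<sigma>)) \<partial>lborel)"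
      by (rule conv_pairing[OF um uL cc f]) (use h in \<open>auto simp: sobolev_2_iff\<close>)
    also have "\<dots> = (\<integral>\<tau>. indicator {0..s} \<tau> *\<^sub>R ?G \<tau> \<partial>lborel)"
      by (rule solution_weak_equation[OF f h s u])
    finally show "(\<integral>\<tau>. indicator {0..s} \<tau> *\<^sub>R ?G \<tau> \<partial>lborel) = (\<integral>x. h x * conv (levy_tail \<nu>) (\<lambda>\<tau>. u \<tau> x - f x) s \<partial>\<sigma>)"
      by (rule sym)
  qed (use t in auto)
qed

end

theorem theorem3p16:
  fixes \<mu> :: real and f :: "real^3 \<Rightarrow> complex" and \<nu> :: "real measure"
    and M :: "'w measure" and S :: "real \<Rightarrow> 'w \<Rightarrow> real"
  assumes "subordinator_levy_measure \<nu>"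
    and "subordinator M S"
    and "\<And>t q. 0 \<le> t \<Longrightarrow> 0 \<le> q \<Longrightarrow>
           (\<integral>\<omega>. exp (- q * S t \<omega>) \<partial>M) = exp (- t * laplace_exponent \<nu> q)"
    and "f \<in> L2_sphere"
  shows "\<exists>u. very_weak_solution \<nu> \<mu> f u \<and> laplace_transformable u \<and>
           (AE x in sphere_measure. u 0 x = f x) \<and>
           (\<forall>v. very_weak_solution \<nu> \<mu> f v \<and> laplace_transformable v \<longrightarrow>
              (\<forall>t\<ge>0. AE x in sphere_measure. v t x = u t x)) \<and>
           (\<forall>t>0. u t \<in> sobolev 2) \<and> continuous_curve (sobolev_norm 2) {0<..} u \<and>
           (\<forall>t>0. (\<lambda>n. sobolev_norm 2 (\<lambda>x. u t x -
              sph_partial_sum (\<lambda>l m. sph_coeff f l m * relaxation M S t (gen_eigenvalue \<mu> l m)) n x))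
              \<longlonglongrightarrow> 0)"
proof -
  interpret subordinator_inverse \<nu> M S
    by unfold_locales (rule assms(1), rule assms(2), rule assms(3))
  note f = assms(4)
  obtain u where um: "(\<lambda>(t, x). u t x) \<in> borel_measurable (restrict_space borel {0..} \<Otimes>\<^sub>M \<sigma>)"
    and u: "\<And>t. 0 \<le> t \<Longrightarrow> sph_sums (relaxed \<mu> f t) (u t)"
    using solution_exists[OF f, of \<mu>] by blast
  note facts = relaxed_solution_facts[OF f _ u]
  have weak: "very_weak_solution \<nu> \<mu> f u" by (rule solution_very_weak[OF f um u])
  have "AE x in sphere_measure. u 0 x = f x"
  proof (rule L2_eq_AE_if_coeffs_eq[OF facts(1) f])
    show "sph_coeff (u 0) l m = sph_coeff f l m" if "nat \<bar>m\<bar> \<le> l" for l m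
      using facts(2)[OF order_refl order_refl that] relaxation_zero[OF Re_gen_eigenvalue_le] by simp
  qed simp_all
  moreover have "laplace_transformable u"
    by (rule solution_laplace_transformable[OF f um]) (use facts in auto)
  moreover have "\<forall>v. very_weak_solution \<nu> \<mu> f v \<and> laplace_transformable v \<longrightarrow> (\<forall>t\<ge>0. AE x in sphere_measure. v t x = u t x)"
    using weak_solution_unique[OF _ weak f] by blast
  moreover have "\<forall>t>0. u t \<in> sobolev 2"
    using solution_sobolev(1)[OF f _ u] by simp
  moreover have "continuous_curve (sobolev_norm 2) {0<..} u"
    by (rule solution_sobolev_continuous[OF f u])
  moreover have "\<forall>t>0. (\<lambda>n. sobolev_norm 2 (\<lambda>x. u t x - sph_partial_sum (\<lambda>l m. sph_coeff f l m * relax_coeff \<mu> t l m) n x)) \<longlonglongrightarrow> 0"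
    using solution_series_sobolev[OF f _ u] by simp
  ultimately show ?thesis using weak by blast
qed

end
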